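(* Let $k$ be a perfect field of characteristic $p>0$, and let $A$ be a connected graded commutative $k$-algebra of finite type. The quasi-shuffle algebra $J^{\vee}(A)$ is a polynomial algebra exactly in the following cases: - $p=2$ and the squaring map $F:A\to A$, $F(x)=x^2$, is injective; - $p$ is odd, $A$ is concentrated in even degrees, and the $p$-th power map $F:A\to A$, $F(x)=x^p$, is injective.
   Context: Graded vector spaces $M=\{M_n\}_{n\ge 0}$ are non-negatively graded over $k$ and of finite type; $\bar M$ denotes the positive degree part. The tensor product is the graded one with braiding $x\otimes y\mapsto (-1)^{|x||y|}y\otimes x$, so "commutative" means graded commutative. "Connected" means the degree $0$ part is $k$. A graded commutative algebra is polynomial if it is isomorphic as a graded algebra to a polynomial ring on a set of homogeneous generators of positive degree (necessarily of even degree if $p$ is odd). $\mathcal A^*(k)$ is the category of connected commutative graded algebras of finite type, and $\mathcal H^*(k)$ is the category of connected commutative graded Hopf algebras of finite type. $J^{\vee}:\mathcal A^*(k)\to\mathcal H^*(k)$ is the right adjoint of the forgetful functor. Explicitly, $J^{\vee}(A)=\bigoplus_{r\ge 0}\bar A^{\otimes r}$, with coproduct given by deconcatenation of tensors and with the quasi-shuffle product: the component $\bar A^{\otimes l}\otimes\bar A^{\otimes m}\to\bar A^{\otimes n}$ of the product is the sum, over all pairs of order preserving injections $\alpha:\{1,\dots,l\}\to\{1,\dots,n\}$, $\beta:\{1,\dots,m\}\to\{1,\dots,n\}$ whose images together cover $\{1,\dots,n\}$, of the map sending $a_1\otimes\cdots\otimes a_{l+m}$ to $\bigotimes_{i=1}^n\prod_{j\in\gamma^{-1}(i)}a_j$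 (with Koszul signs), where $\gamma:\{1,\dots,l+m\}\to\{1,\dots,n\}$ is $\alpha$ on the first $l$ elements and $\beta$ on the last $m$. *)

theory Defs
  imports
    "HOL-Algebra.QuotRing"
    "HOL-Algebra.Module"
    "HOL-Algebra.Algebraic_Closure_Type"
    "HOL-Library.Poly_Mapping"
    "HOL-Library.FuncSet"
begin

section \<open>Ground field\<close>

definition perfect_field :: "'k::field itself \<Rightarrow> bool" where
  "perfect_field (_ :: 'k itself) \<longleftrightarrow> CHAR('k) = 0 \<or> surj (\<lambda>x::'k. x ^ CHAR('k))"


section \<open>Graded algebras\<close>

text \<open>
  The ground field is a type of class \<^class>\<open>field\<close>.  A graded algebra over it is a
  \<^type>\<open>module\<close> record whose carrier is the internal direct sum of the subspaces
  \<open>homog A n\<close>, for \<open>n\<close> a natural number.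
\<close>

record ('k, 'a) graded_algebra = "('k, 'a) module" +
  homog :: "nat \<Rightarrow> 'a set"

locale graded_algebra =
  module "ring_of_type_algebra :: 'k ring" A + ring A
  for A :: "('k::field, 'a, 'm) graded_algebra_scheme" (structure) +
  assumes smult_mult_left:
      "\<lbrakk>x \<in> carrier A; y \<in> carrier A\<rbrakk> \<Longrightarrow> (c \<odot> x) \<otimes> y = c \<odot> (x \<otimes> y)"
    and smult_mult_right:
      "\<lbrakk>x \<in> carrier A; y \<in> carrier A\<rbrakk> \<Longrightarrow> x \<otimes> (c \<odot> y) = c \<odot> (x \<otimes> y)"
    and homog_subset: "homog A n \<subseteq> carrier A"
    and homog_zero: "\<zero> \<in> homog A n"
    and homog_add: "\<lbrakk>x \<in> homog A n; y \<in> homog A n\<rbrakk> \<Longrightarrow> x \<oplus> y \<in> homog A n"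
    and homog_smult: "x \<in> homog A n \<Longrightarrow> c \<odot> x \<in> homog A n"
    and homog_one: "\<one> \<in> homog A 0"
    and homog_mult: "\<lbrakk>x \<in> homog A m; y \<in> homog A n\<rbrakk> \<Longrightarrow> x \<otimes> y \<in> homog A (m + n)"
    and homog_direct_sum:
      "x \<in> carrier A \<Longrightarrow>
         \<exists>!c. (\<forall>n. c n \<in> homog A n) \<and> finite {n. c n \<noteq> \<zero>} \<and> x = (\<Oplus>n\<in>{n. c n \<noteq> \<zero>}. c n)"

locale connected_comm_graded_algebra = graded_algebra A
  for A :: "('k::field, 'a, 'm) graded_algebra_scheme" (structure) +
  assumes graded_commutative:
      "\<lbrakk>x \<in> homog A m; y \<in> homog A n\<rbrakk> \<Longrightarrow> x \<otimes> y = ((- 1) ^ (m * n)) \<odot> (y \<otimes> x)"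
    and connected: "bij_betw (\<lambda>c. c \<odot> \<one>) UNIV (homog A 0)"
    and finite_type:
      "\<exists>B. finite B \<and> B \<subseteq> homog A n \<and> (\<forall>x\<in>homog A n. \<exists>c. x = (\<Oplus>b\<in>B. c b \<odot> b))"

definition graded_algebra_iso ::
  "('k, 'a, 'm) graded_algebra_scheme \<Rightarrow> ('k, 'b, 'n) graded_algebra_scheme \<Rightarrow> ('a \<Rightarrow> 'b) set"
  where
  "graded_algebra_iso A B = {h \<in> ring_iso A B.
     (\<forall>c. \<forall>x\<in>carrier A. h (c \<odot>\<^bsub>A\<^esub> x) = c \<odot>\<^bsub>B\<^esub> h x) \<and>
     (\<forall>n. h ` homog A n = homog B n)}"


section \<open>Polynomial algebras\<close>

text \<open>
  \<open>(('x \<Rightarrow>\<^sub>0 nat) \<Rightarrow>\<^sub>0 'k)\<close> is the commutative polynomial ring over \<open>'k\<close> in the variables of type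
  \<open>'x\<close>; we take the polynomials in the variables \<open>V\<close>, the variable \<open>x\<close> having degree \<open>d x\<close>.
\<close>

definition poly_algebra ::
  "'x set \<Rightarrow> ('x \<Rightarrow> nat) \<Rightarrow> ('k::field, ('x \<Rightarrow>\<^sub>0 nat) \<Rightarrow>\<^sub>0 'k) graded_algebra" where
  "poly_algebra V d = \<lparr>
     carrier = {P. \<forall>m\<in>Poly_Mapping.keys P. Poly_Mapping.keys m \<subseteq> V},
     monoid.mult = (*), one = 1, ring.zero = 0, add = (+),
     module.smult = (\<lambda>c. Poly_Mapping.map ((*) c)),
     homog = (\<lambda>n. {P. \<forall>m\<in>Poly_Mapping.keys P. Poly_Mapping.keys m \<subseteq> V \<and>
       (\<Sum>x\<in>Poly_Mapping.keys m. Poly_Mapping.lookup m x * d x) = n})\<rparr>"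

text \<open>
  Indexing the generators by elements of \<open>'b\<close> is no restriction, since an isomorphism maps
  the variables injectively into the carrier of \<open>B\<close>.
\<close>

definition is_polynomial_algebra :: "('k::field, 'b, 'm) graded_algebra_scheme \<Rightarrow> bool" where
  "is_polynomial_algebra B \<longleftrightarrow>
     (\<exists>(V :: 'b set) d. (\<forall>x\<in>V. 0 < d x) \<and> graded_algebra_iso (poly_algebra V d) B \<noteq> {})"


section \<open>The quasi-shuffle algebra\<close>

text \<open>
  A letter \<open>(n, a)\<close> is an element \<open>a\<close> of positive degree \<open>n\<close>, and a word
  \<open>[(n\<^sub>1, a\<^sub>1), \<dots>, (n\<^sub>r, a\<^sub>r)]\<close> stands for the tensor \<open>a\<^sub>1 \<otimes> \<dots> \<otimes> a\<^sub>r\<close>.  The degree is recorded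
  because the zero element lies in every degree.
\<close>

type_synonym 'a word = "(nat \<times> 'a) list"

definition letters :: "('k, 'a, 'm) graded_algebra_scheme \<Rightarrow> (nat \<times> 'a) set" where
  "letters A = {(n, a). 0 < n \<and> a \<in> homog A n}"

definition word_degree :: "'a word \<Rightarrow> nat" where
  "word_degree w = sum_list (map fst w)"

text \<open>
  Pairs of order preserving injections jointly covering the target, with the target size \<open>n\<close>;
  positions are counted from 0.  The covering condition implies the bound \<open>n \<le> l + m\<close>.
\<close>

definition quasi_shuffles :: "nat \<Rightarrow> nat \<Rightarrow> (nat \<times> (nat \<Rightarrow> nat) \<times> (nat \<Rightarrow> nat)) set" where
  "quasi_shuffles l m = {(n, \<alpha>, \<beta>). n \<le> l + m \<and>
     \<alpha> \<in> {..<l} \<rightarrow>\<^sub>E {..<n} \<and> strict_mono_on {..<l} \<alpha> \<and>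
     \<beta> \<in> {..<m} \<rightarrow>\<^sub>E {..<n} \<and> strict_mono_on {..<m} \<beta> \<and>
     \<alpha> ` {..<l} \<union> \<beta> ` {..<m} = {..<n}}"

definition joint_map :: "nat \<Rightarrow> (nat \<Rightarrow> nat) \<Rightarrow> (nat \<Rightarrow> nat) \<Rightarrow> nat \<Rightarrow> nat" where
  "joint_map l \<alpha> \<beta> j = (if j < l then \<alpha> j else \<beta> (j - l))"

text \<open>
  In \<open>merge_word A n \<gamma> w\<close>, letter number \<open>i\<close> is the product, in increasing order of \<open>j\<close>, of the
  letters of \<open>w\<close> at the positions \<open>j\<close> with \<open>\<gamma> j = i\<close>.
\<close>

definition merge_word ::
  "('k, 'a, 'm) graded_algebra_scheme \<Rightarrow> nat \<Rightarrow> (nat \<Rightarrow> nat) \<Rightarrow> 'a word \<Rightarrow> 'a word" where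
  "merge_word A n \<gamma> w =
     map (\<lambda>i. let js = filter (\<lambda>j. \<gamma> j = i) [0..<length w]
              in (\<Sum>j\<leftarrow>js. fst (w ! j), foldr (\<otimes>\<^bsub>A\<^esub>) (map (\<lambda>j. snd (w ! j)) js) \<one>\<^bsub>A\<^esub>))
         [0..<n]"

text \<open>
  The Koszul sign of reordering the letters of \<open>w\<close> by increasing \<open>\<gamma>\<close>, keeping the order of the
  letters with the same value of \<open>\<gamma>\<close>.
\<close>

definition koszul_sign :: "(nat \<Rightarrow> nat) \<Rightarrow> 'a word \<Rightarrow> 'k::field" where
  "koszul_sign \<gamma> w =
     (- 1) ^ (\<Sum>(i, j)\<in>{(i, j). i < j \<and> j < length w \<and> \<gamma> j < \<gamma> i}. fst (w ! i) * fst (w ! j))"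

definition quasi_shuffle_mult ::
  "('k::field, 'a, 'm) graded_algebra_scheme \<Rightarrow> ('a word \<Rightarrow>\<^sub>0 'k) \<Rightarrow> ('a word \<Rightarrow>\<^sub>0 'k) \<Rightarrow> ('a word \<Rightarrow>\<^sub>0 'k)"
  where
  "quasi_shuffle_mult A f g =
     (\<Sum>u\<in>Poly_Mapping.keys f. \<Sum>v\<in>Poly_Mapping.keys g.
        \<Sum>(n, \<alpha>, \<beta>)\<in>quasi_shuffles (length u) (length v).
          Poly_Mapping.single (merge_word A n (joint_map (length u) \<alpha> \<beta>) (u @ v))
            (koszul_sign (joint_map (length u) \<alpha> \<beta>) (u @ v) *
             Poly_Mapping.lookup f u * Poly_Mapping.lookup g v))"

text \<open>
  The direct sum of the tensor powers of the positive degree part of \<open>A\<close> is the vector space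
  freely generated by the words, modulo multilinearity in each letter.
\<close>

definition free_word_algebra ::
  "('k::field, 'a, 'm) graded_algebra_scheme \<Rightarrow> ('k, 'a word \<Rightarrow>\<^sub>0 'k) graded_algebra" where
  "free_word_algebra A = \<lparr>
     carrier = {f. Poly_Mapping.keys f \<subseteq> lists (letters A)},
     monoid.mult = quasi_shuffle_mult A, one = Poly_Mapping.single [] 1, ring.zero = 0, add = (+),
     module.smult = (\<lambda>c. Poly_Mapping.map ((*) c)),
     homog = (\<lambda>n. {f. Poly_Mapping.keys f \<subseteq> {w \<in> lists (letters A). word_degree w = n}})\<rparr>"

definition multilinear_relators ::
  "('k::field, 'a, 'm) graded_algebra_scheme \<Rightarrow> ('a word \<Rightarrow>\<^sub>0 'k) set" where
  "multilinear_relators A =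
     {Poly_Mapping.single (u @ (n, a \<oplus>\<^bsub>A\<^esub> b) # v) 1
        - Poly_Mapping.single (u @ (n, a) # v) 1 - Poly_Mapping.single (u @ (n, b) # v) 1 | u v n a b.
        u \<in> lists (letters A) \<and> v \<in> lists (letters A) \<and> (n, a) \<in> letters A \<and> (n, b) \<in> letters A} \<union>
     {Poly_Mapping.single (u @ (n, c \<odot>\<^bsub>A\<^esub> a) # v) 1 - Poly_Mapping.single (u @ (n, a) # v) c | u v n a c.
        u \<in> lists (letters A) \<and> v \<in> lists (letters A) \<and> (n, a) \<in> letters A}"

definition multilinear_relations ::
  "('k::field, 'a, 'm) graded_algebra_scheme \<Rightarrow> ('a word \<Rightarrow>\<^sub>0 'k) set" where
  "multilinear_relations A =
     module.span (\<lambda>c. Poly_Mapping.map ((*) c)) (multilinear_relators A)"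

text \<open>
  The algebra underlying the Hopf algebra \<open>J\<^sup>\<or>(A)\<close>.  Its coproduct plays no role for being
  polynomial and is not recorded.
\<close>

definition quasi_shuffle_algebra ::
  "('k::field, 'a, 'm) graded_algebra_scheme \<Rightarrow> ('k, ('a word \<Rightarrow>\<^sub>0 'k) set) graded_algebra" where
  "quasi_shuffle_algebra A =
     (let F = free_word_algebra A; R = multilinear_relations A; Q = F Quot R in
      \<lparr>carrier = carrier Q, monoid.mult = monoid.mult Q, one = one Q, ring.zero = ring.zero Q,
       add = add Q,
       module.smult = (\<lambda>c S. \<Union>f\<in>S. R +>\<^bsub>F\<^esub> (c \<odot>\<^bsub>F\<^esub> f)),
       homog = (\<lambda>n. (\<lambda>f. R +>\<^bsub>F\<^esub> f) ` homog F n)\<rparr>)"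

end

theory Submission
  imports Defs
begin

text \<open>
  A basis of the positive degree part of \<open>A\<close> identifies \<open>J\<^sup>\<or>(A)\<close> with the space spanned by the
  words in the basis, and the quasi-shuffle product then satisfies the recursion
  \<open>au * bv = a(u * bv) + b(au * v) + (ab)(u * v)\<close>.  In characteristic \<open>p\<close> the recursion gives
  \<open>(au)\<^sup>p = a\<^sup>p u\<^sup>p\<close>, so the Frobenius map of \<open>J\<^sup>\<or>(A)\<close> acts letterwise; over a perfect field
  it is injective as soon as that of \<open>A\<close> is.

  Suppose it is injective, and let \<open>g\<^sub>x\<close> be homogeneous lifts of a basis of the indecomposables.  They
  generate.  A functional \<open>\<phi>\<close> on the indecomposables gives a derivation \<open>(id \<otimes> \<phi>)\<Delta>\<close>, where \<open>\<Delta>\<close> is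
  deconcatenation; the derivations of a dual family act on the \<open>g\<^sub>x\<close> by a matrix that is
  unitriangular for the degree.  Hence all partial derivatives of a relation \<open>P\<close> of minimal degree
  vanish, \<open>P\<close> is a \<open>p\<close>-th power \<open>Q\<^sup>p\<close> as \<open>k\<close> is perfect, and \<open>Q\<close> is a relation of smaller degree.

  Conversely, polynomial rings are reduced.  If \<open>p\<close> is odd, the one-letter word of an element \<open>a\<close>
  of odd degree has square zero, so \<open>a = 0\<close>; and if \<open>a\<^sup>p = 0\<close>, the one-letter word of \<open>a\<close> has
  \<open>p\<close>-th power zero, so again \<open>a = 0\<close>.
\<close>

section \<open>Linear algebra on finitely supported functions\<close>

text \<open>The obstacle is the Koszul sign. \<open>quasi_shuffle_algebra\<close> multiplies cosets
  as unions over representatives, and with signs present the relations are not shown to be an ideal.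
  So the proof splits by signs. For odd p, an isomorphism with a polynomial ring is first used to
  make the odd parts of A vanish, which takes only the square of a one-letter word and one inclusion
  of cosets. After that, and for p = 2 from the start, signs do not affect any reduced word and the
  coset product is the plain commutative product \<open>qm\<close>. In the p-th power of
  \<open>au\<close>, binomial coefficients count which of the p first letters merge into the leading
  letter; modulo p only the merger of all of them survives. Injectivity of the letterwise Frobenius
  then uses p-th roots: for a fixed suffix, the coefficients of the various first letters combine
  into one vector whose p-th power is 0. And (id \<otimes> \<phi>)\<Delta> is a derivation because
  \<phi> kills products of nonempty words: the only terms that break the Leibniz rule are values of
  \<phi> on such products.\<close>

definition pscale :: "'k::field \<Rightarrow> ('w \<Rightarrow>\<^sub>0 'k) \<Rightarrow> ('w \<Rightarrow>\<^sub>0 'k)" where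
  "pscale c = Poly_Mapping.map ((*) c)"

lemma lookup_pscale [simp]: "Poly_Mapping.lookup (pscale c t) w = c * Poly_Mapping.lookup t w"
  unfolding pscale_def by transfer (simp add: when_def)

lemma pscale_add: "pscale c (s + t) = pscale c s + pscale c t"
  and pscale_add_left: "pscale (c + d) t = pscale c t + pscale d t"
  and pscale_pscale [simp]: "pscale c (pscale d t) = pscale (c * d) t"
  and pscale_one [simp]: "pscale 1 t = t"
  and pscale_zero [simp]: "pscale 0 t = 0"
  and pscale_0 [simp]: "pscale c 0 = 0"
  and pscale_single [simp]: "pscale c (Poly_Mapping.single w d) = Poly_Mapping.single w (c * d)"
  by (rule poly_mapping_eqI, simp add: lookup_add algebra_simps lookup_single when_def)+

global_interpretation pm: vector_space pscale
  by standard (simp_all add: pscale_add pscale_add_left)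

text \<open>There is no case for zero because it is the zero multiple of any singleton.\<close>

lemma pm_induct [case_names single scale add]:
  fixes t :: "'w \<Rightarrow>\<^sub>0 'k::field"
  assumes "\<And>w. P (Poly_Mapping.single w 1)" "\<And>c t. P t \<Longrightarrow> P (pscale c t)"
    "\<And>s t. P s \<Longrightarrow> P t \<Longrightarrow> P (s + t)"
  shows "P t"
proof -
  have 0: "P 0"
    using assms(2)[OF assms(1), of 0 undefined] by simp
  have single: "P (Poly_Mapping.single w c)" for w c
    using assms(2)[OF assms(1)[of w], of c] by simp
  show ?thesis
  proof (induction t rule: update_induct)
    case const
    then show ?case by (rule 0)
  next
    case (update f a b)
    have "Poly_Mapping.update a b f = f + Poly_Mapping.single a b"
      using update(1) by (intro poly_mapping_eqI)
        (auto simp: lookup_update lookup_add lookup_single when_def in_keys_iff)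
    then show ?case
      using assms(3)[OF update(3) single] by simp
  qed
qed

text \<open>Linear extension of a map prescribed on the basis of singletons.\<close>

definition lin :: "('w \<Rightarrow> ('v \<Rightarrow>\<^sub>0 'k::field)) \<Rightarrow> ('w \<Rightarrow>\<^sub>0 'k) \<Rightarrow> ('v \<Rightarrow>\<^sub>0 'k)" where
  "lin f t = (\<Sum>w\<in>Poly_Mapping.keys t. pscale (Poly_Mapping.lookup t w) (f w))"

lemma lin_superset:
  assumes "finite S" "Poly_Mapping.keys t \<subseteq> S"
  shows "lin f t = (\<Sum>w\<in>S. pscale (Poly_Mapping.lookup t w) (f w))"
  unfolding lin_def using assms
  by (intro sum.mono_neutral_left) (auto simp: in_keys_iff)

lemma lin_add [simp]: "lin f (s + t) = lin f s + lin f t"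
  using keys_add[of s t]
  by (subst (1 2 3) lin_superset[of "Poly_Mapping.keys s \<union> Poly_Mapping.keys t"])
    (auto simp: lookup_add pscale_add_left sum.distrib)

lemma keys_pscale: "Poly_Mapping.keys (pscale c t) \<subseteq> Poly_Mapping.keys t"
  by (auto simp: in_keys_iff)

lemma lin_pscale [simp]: "lin f (pscale c t) = pscale c (lin f t)"
  using keys_pscale[of c t]
  by (subst (1 2) lin_superset[of "Poly_Mapping.keys t"]) (auto simp: pm.scale_sum_right)

lemma lin_zero [simp]: "lin f 0 = 0"
  by (simp add: lin_def)

lemma lin_single [simp]: "lin f (Poly_Mapping.single w c) = pscale c (f w)"
  by (subst lin_superset[of "{w}"]) auto

lemma lin_uminus [simp]: "lin f (- t) = - lin f t"
  using lin_add[of f t "- t"] by (simp add: eq_neg_iff_add_eq_0 add.commute)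

lemma lin_diff [simp]: "lin f (s - t) = lin f s - lin f t"
  using lin_add[of f s "- t"] by simp

lemma lin_sum: "lin f (\<Sum>i\<in>I. g i) = (\<Sum>i\<in>I. lin f (g i))"
  by (induction I rule: infinite_finite_induct) auto

lemma lin_fun_add [simp]: "lin (\<lambda>w. f w + g w) t = lin f t + lin g t"
  by (simp add: lin_def sum.distrib pscale_add)

lemma lin_fun_pscale [simp]: "lin (\<lambda>w. pscale c (f w)) t = pscale c (lin f t)"
  by (simp add: lin_def pm.scale_sum_right mult.commute)

lemma lin_fun_zero [simp]: "lin (\<lambda>w. 0) t = 0"
  by (simp add: lin_def)

lemma lin_single_id [simp]: "lin (\<lambda>w. Poly_Mapping.single w 1) t = t"
  by (induction t rule: pm_induct) auto

lemma lin_in_subspace: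
  assumes "pm.subspace S" "\<And>w. w \<in> Poly_Mapping.keys t \<Longrightarrow> f w \<in> S"
  shows "lin f t \<in> S"
  unfolding lin_def by (intro pm.subspace_sum pm.subspace_scale assms)

definition supp_in :: "'w set \<Rightarrow> ('w \<Rightarrow>\<^sub>0 'k::field) set" where
  "supp_in S = {t. Poly_Mapping.keys t \<subseteq> S}"

lemma supp_in_keys: "t \<in> supp_in S \<Longrightarrow> w \<in> Poly_Mapping.keys t \<Longrightarrow> w \<in> S"
  by (auto simp: supp_in_def)

lemma supp_in_mono: "t \<in> supp_in S \<Longrightarrow> S \<subseteq> S' \<Longrightarrow> t \<in> supp_in S'"
  by (auto simp: supp_in_def)

lemma subspace_supp_in [simp]: "pm.subspace (supp_in S)"
  by (auto simp: pm.subspace_def supp_in_def in_keys_iff subset_iff lookup_add) (metis add_0)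

lemma single_in_supp_in [simp]: "w \<in> S \<Longrightarrow> Poly_Mapping.single w c \<in> supp_in S"
  by (auto simp: supp_in_def)

text \<open>Zero has its own case here because \<open>S\<close> may be empty.\<close>

lemma supp_in_induct [consumes 1, case_names single scale add zero]:
  assumes "t \<in> supp_in S"
    and "\<And>w. w \<in> S \<Longrightarrow> P (Poly_Mapping.single w 1)" "\<And>c t. t \<in> supp_in S \<Longrightarrow> P t \<Longrightarrow> P (pscale c t)"
    "\<And>s t. s \<in> supp_in S \<Longrightarrow> t \<in> supp_in S \<Longrightarrow> P s \<Longrightarrow> P t \<Longrightarrow> P (s + t)" "P 0"
  shows "P t"
proof -
  have "lin (\<lambda>w. Poly_Mapping.single w 1) t \<in> {t \<in> supp_in S. P t}"
  proof (rule lin_in_subspace)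
    show "pm.subspace {t \<in> supp_in S. P t}"
      using subspace_supp_in[of S] assms(3-5) unfolding pm.subspace_def by auto
    show "Poly_Mapping.single w 1 \<in> {t \<in> supp_in S. P t}" if "w \<in> Poly_Mapping.keys t" for w
      using that assms(1,2) by (auto simp: supp_in_def)
  qed
  then show ?thesis by simp
qed

section \<open>The Frobenius map of a commutative ring\<close>

context cring
begin

text \<open>The added top coefficient is 0; this aligns the index ranges for Pascal's rule.\<close>

lemma finsum_choose_extend:
  assumes "\<And>i. E i \<in> carrier R"
  shows "(\<Oplus>i\<in>{..n}. [(n choose i)] \<cdot>\<^bsub>R\<^esub> E i) = (\<Oplus>i\<in>{..Suc n}. [(n choose i)] \<cdot>\<^bsub>R\<^esub> E i)"
  using assms by (subst finsum_Suc, simp, subst binomial_eq_0, simp, subst add.nat_pow_0, simp)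

text \<open>Pascal's rule. The products with \<open>x\<close> and with \<open>y\<close> are both
  written in the one family \<open>E\<close> of monomials of total degree \<open>Suc n\<close>, so
  that the two sums can be added termwise after an index shift.\<close>

lemma binomial_finsum:
  assumes x: "x \<in> carrier R" and y: "y \<in> carrier R"
  shows "(x \<oplus> y) [^] (n::nat) = (\<Oplus>i\<in>{..n}. [(n choose i)] \<cdot>\<^bsub>R\<^esub> (x [^] i \<otimes> y [^] (n - i)))"
proof (induction n)
  case 0
  then show ?case using x y by (simp add: add_pow_def)
next
  case (Suc n)
  define E where "E j = x [^] j \<otimes> y [^] (Suc n - j)" for j
  have E [simp]: "E j \<in> carrier R" for j
    using x y by (simp add: E_def)
  have 1: "[c] \<cdot>\<^bsub>R\<^esub> (x [^] i \<otimes> y [^] (n - i)) \<otimes> x = [c] \<cdot>\<^bsub>R\<^esub> E (Suc i)" for c i :: nat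
    using x y m_comm[of "y [^] (n - i)" x] by (simp add: E_def add_pow_ldistr m_assoc)
  have 2: "[c] \<cdot>\<^bsub>R\<^esub> (x [^] i \<otimes> y [^] (n - i)) \<otimes> y = [c] \<cdot>\<^bsub>R\<^esub> E i" if "i \<le> n" for c i :: nat
    using x y that by (simp add: E_def add_pow_ldistr m_assoc Suc_diff_le)
  have "(x \<oplus> y) [^] Suc n = (\<Oplus>i\<in>{..n}. [(n choose i)] \<cdot>\<^bsub>R\<^esub> (x [^] i \<otimes> y [^] (n - i))) \<otimes> x
      \<oplus> (\<Oplus>i\<in>{..n}. [(n choose i)] \<cdot>\<^bsub>R\<^esub> (x [^] i \<otimes> y [^] (n - i))) \<otimes> y"
    using Suc.IH x y by (simp add: r_distr)
  also have "\<dots> = (\<Oplus>i\<in>{..n}. [(n choose i)] \<cdot>\<^bsub>R\<^esub> E (Suc i)) \<oplus> (\<Oplus>i\<in>{..n}. [(n choose i)] \<cdot>\<^bsub>R\<^esub> E i)"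
    using x y by (simp add: finsum_ldistr) (intro arg_cong2[of _ _ _ _ "(\<oplus>)"] finsum_cong'; simp add: 1 2)
  also have "(\<Oplus>i\<in>{..n}. [(n choose i)] \<cdot>\<^bsub>R\<^esub> E i) = (\<Oplus>i\<in>{..Suc n}. [(n choose i)] \<cdot>\<^bsub>R\<^esub> E i)"
    by (rule finsum_choose_extend) simp
  also have "\<dots> = (\<Oplus>i\<in>{..n}. [(n choose Suc i)] \<cdot>\<^bsub>R\<^esub> E (Suc i)) \<oplus> [(1::nat)] \<cdot>\<^bsub>R\<^esub> E 0"
    by (subst finsum_Suc2) auto
  also have "(\<Oplus>i\<in>{..n}. [(n choose i)] \<cdot>\<^bsub>R\<^esub> E (Suc i)) \<oplus> ((\<Oplus>i\<in>{..n}. [(n choose Suc i)] \<cdot>\<^bsub>R\<^esub> E (Suc i)) \<oplus> [(1::nat)] \<cdot>\<^bsub>R\<^esub> E 0)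
     = (\<Oplus>i\<in>{..n}. [(Suc n choose Suc i)] \<cdot>\<^bsub>R\<^esub> E (Suc i)) \<oplus> [(1::nat)] \<cdot>\<^bsub>R\<^esub> E 0"
    by (subst a_assoc[symmetric], simp, simp, simp, subst finsum_addf[symmetric])
      (auto simp: add.nat_pow_mult intro!: arg_cong2[of _ _ _ _ "(\<oplus>)"] finsum_cong')
  also have "\<dots> = (\<Oplus>i\<in>{..Suc n}. [(Suc n choose i)] \<cdot>\<^bsub>R\<^esub> E i)"
    by (subst finsum_Suc2) auto
  finally show ?case unfolding E_def .
qed

text \<open>Stated for record rings so that it applies to \<open>qring\<close>, to \<open>A\<close>
  and, through \<open>ring_of_type_algebra\<close>, to polynomial rings.\<close>

lemma frobenius_add:
  assumes p: "prime p" and char: "\<And>x. x \<in> carrier R \<Longrightarrow> [p] \<cdot>\<^bsub>R\<^esub> x = \<zero>"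
    and x: "x \<in> carrier R" and y: "y \<in> carrier R"
  shows "(x \<oplus> y) [^] p = x [^] p \<oplus> y [^] (p::nat)"
proof -
  have zero: "[(p choose i)] \<cdot>\<^bsub>R\<^esub> z = \<zero>" if i: "0 < i" "i < p" and z: "z \<in> carrier R" for i z
  proof -
    have "p dvd (p choose i)"
      using i p by (intro dvd_choose_prime) auto
    then obtain c where "p choose i = p * c" by blast
    then have "[(p choose i)] \<cdot>\<^bsub>R\<^esub> z = [p] \<cdot>\<^bsub>R\<^esub> ([c] \<cdot>\<^bsub>R\<^esub> z)"
      using z by (simp add: add.nat_pow_pow mult.commute)
    then show ?thesis using z char by simp
  qed
  obtain n where n: "p = Suc n"
    using p by (cases p) auto
  have "(x \<oplus> y) [^] p = (\<Oplus>i\<in>{..Suc n}. [(p choose i)] \<cdot>\<^bsub>R\<^esub> (x [^] i \<otimes> y [^] (p - i)))"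
    using binomial_finsum[OF x y, of p] by (simp only: n)
  also have "\<dots> = [(p choose p)] \<cdot>\<^bsub>R\<^esub> (x [^] p \<otimes> y [^] (p - p)) \<oplus>
      (\<Oplus>i\<in>{..n}. [(p choose i)] \<cdot>\<^bsub>R\<^esub> (x [^] i \<otimes> y [^] (p - i)))"
    using x y by (simp only: n finsum_Suc) auto
  also have "(\<Oplus>i\<in>{..n}. [(p choose i)] \<cdot>\<^bsub>R\<^esub> (x [^] i \<otimes> y [^] (p - i)))
     = (\<Oplus>i\<in>{..n}. if i = 0 then y [^] p else \<zero>)"
  proof (intro finsum_cong')
    show "[(p choose i)] \<cdot>\<^bsub>R\<^esub> (x [^] i \<otimes> y [^] (p - i)) = (if i = 0 then y [^] p else \<zero>)"
      if "i \<in> {..n}" for i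
      using zero[of i "x [^] i \<otimes> y [^] (p - i)"] x y that n 
      by (cases "i = 0") (simp_all del: nat_pow_Suc)
  qed (use y in auto)
  also have "\<dots> = y [^] p"
    using x y add.finprod_singleton_swap[of 0 "{..n}" "\<lambda>_. y [^] p"] by auto
  finally show ?thesis using x y by simp
qed

end

section \<open>Bilinear extension of maps given on singletons\<close>

definition bilin :: "('u \<Rightarrow> 'v \<Rightarrow> ('w \<Rightarrow>\<^sub>0 'k::field)) \<Rightarrow> ('u \<Rightarrow>\<^sub>0 'k) \<Rightarrow> ('v \<Rightarrow>\<^sub>0 'k) \<Rightarrow> ('w \<Rightarrow>\<^sub>0 'k)" where
  "bilin f s t = lin (\<lambda>u. lin (f u) t) s"

lemma bilin_simps [simp]:
  "bilin f (s + s') t = bilin f s t + bilin f s' t"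
  "bilin f s (t + t') = bilin f s t + bilin f s t'"
  "bilin f (pscale c s) t = pscale c (bilin f s t)"
  "bilin f s (pscale c t) = pscale c (bilin f s t)"
  "bilin f (Poly_Mapping.single u c) (Poly_Mapping.single v d) = pscale (c * d) (f u v)"
  "bilin f 0 t = 0" "bilin f s 0 = 0"
  by (simp_all add: bilin_def)

lemma bilin_sum:
  "bilin f (\<Sum>i\<in>I. g i) t = (\<Sum>i\<in>I. bilin f (g i) t)"
  "bilin f s (\<Sum>i\<in>I. h i) = (\<Sum>i\<in>I. bilin f s (h i))"
  by (induction I rule: infinite_finite_induct) auto

lemma bilin_in_subspace:
  assumes "pm.subspace S"
    and "\<And>u v. u \<in> Poly_Mapping.keys s \<Longrightarrow> v \<in> Poly_Mapping.keys t \<Longrightarrow> f u v \<in> S"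
  shows "bilin f s t \<in> S"
  unfolding bilin_def by (intro lin_in_subspace assms)

lemma bilin_flip: "bilin (\<lambda>u v. f v u) s t = bilin f t s"
proof (induction s rule: pm_induct)
  case (single w)
  show ?case by (induction t rule: pm_induct) auto
qed auto

section \<open>The quasi-shuffle ring on words in a basis\<close>

text \<open>The tensor x \<otimes> t with x as leading letter. It is bilinear because a merged
  leading letter \<open>mu a b\<close> is a combination of letters.\<close>

definition pre :: "('l \<Rightarrow>\<^sub>0 'k::field) \<Rightarrow> ('l list \<Rightarrow>\<^sub>0 'k) \<Rightarrow> ('l list \<Rightarrow>\<^sub>0 'k)" where
  "pre = bilin (\<lambda>l w. Poly_Mapping.single (l # w) 1)"

lemma pre_simps [simp]:
  "pre (x + x') t = pre x t + pre x' t"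
  "pre x (t + t') = pre x t + pre x t'"
  "pre (pscale c x) t = pscale c (pre x t)"
  "pre x (pscale c t) = pscale c (pre x t)"
  "pre 0 t = 0" "pre x 0 = 0"
  "pre (Poly_Mapping.single l c) (Poly_Mapping.single w d) = Poly_Mapping.single (l # w) (c * d)"
  by (simp_all add: pre_def)

lemma pre_sum:
  "pre (\<Sum>i\<in>I. g i) t = (\<Sum>i\<in>I. pre (g i) t)"
  "pre x (\<Sum>i\<in>I. h i) = (\<Sum>i\<in>I. pre x (h i))"
  by (simp_all add: pre_def bilin_sum)

lemma lookup_pre_Nil [simp]: "Poly_Mapping.lookup (pre x t) [] = 0"
proof (induction x rule: pm_induct)
  case (single l)
  show ?case
    by (induction t rule: pm_induct) (simp_all add: lookup_add lookup_single)
qed (simp_all add: lookup_add)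

lemma lookup_pre_Cons [simp]:
  "Poly_Mapping.lookup (pre x t) (l # w) = Poly_Mapping.lookup x l * Poly_Mapping.lookup t w"
proof (induction x rule: pm_induct)
  case (single l')
  show ?case
    by (induction t rule: pm_induct) (simp_all add: lookup_add lookup_single algebra_simps when_def)
qed (simp_all add: lookup_add algebra_simps)

abbreviation wone :: "'l list \<Rightarrow>\<^sub>0 'k::field" where
  "wone \<equiv> Poly_Mapping.single [] 1"

text \<open>Words are sorted by their first letter; \<open>map_key (Cons l)\<close> collects the
  suffixes that follow \<open>l\<close>. This drives the induction on word length in
  \<open>frobenius_inj\<close>.\<close>

lemma word_split:
  "\<exists>L. finite L \<and> L = {l. \<exists>w. l # w \<in> Poly_Mapping.keys t} \<and>
    t = pscale (Poly_Mapping.lookup t []) wone +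
      (\<Sum>l\<in>L. pre (Poly_Mapping.single l 1) (Poly_Mapping.map_key (Cons l) t))"
proof -
  define L where "L = {l. \<exists>w. l # w \<in> Poly_Mapping.keys t}"
  have "L \<subseteq> hd ` Poly_Mapping.keys t" by (force simp: L_def)
  then have fin: "finite L" by (rule finite_subset) simp
  have "t = pscale (Poly_Mapping.lookup t []) wone +
      (\<Sum>l\<in>L. pre (Poly_Mapping.single l 1) (Poly_Mapping.map_key (Cons l) t))"
  proof (rule poly_mapping_eqI)
    fix w
    show "Poly_Mapping.lookup t w = Poly_Mapping.lookup (pscale (Poly_Mapping.lookup t []) wone +
      (\<Sum>l\<in>L. pre (Poly_Mapping.single l 1) (Poly_Mapping.map_key (Cons l) t))) w"
    proof (cases w)
      case (Cons l v)
      have "(\<Sum>l'\<in>L. (1 when l' = l) * Poly_Mapping.lookup t (l' # v)) = Poly_Mapping.lookup t (l # v)"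
        using fin by (cases "l \<in> L") (auto simp: L_def when_def in_keys_iff if_distrib if_distribR
            sum.delta cong: if_cong)
      then show ?thesis
        by (simp add: Cons lookup_add lookup_single lookup_sum map_key.rep_eq)
    qed (simp add: lookup_add lookup_sum)
  qed
  then show ?thesis using fin L_def by blast
qed

text \<open>Structure constants of a commutative associative algebra on the letters. No unit is
  asked for, since the model is the positive degree part of a connected algebra.\<close>

locale quasi_shuffle =
  fixes mu :: "'l \<Rightarrow> 'l \<Rightarrow> ('l \<Rightarrow>\<^sub>0 'k::field)"
  assumes mu_comm: "mu a b = mu b a"
    and mu_assoc: "lin (\<lambda>x. mu x c) (mu a b) = lin (\<lambda>x. mu a x) (mu b c)"
begin

definition vm :: "('l \<Rightarrow>\<^sub>0 'k) \<Rightarrow> ('l \<Rightarrow>\<^sub>0 'k) \<Rightarrow> ('l \<Rightarrow>\<^sub>0 'k)" where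
  "vm = bilin mu"

fun qs :: "'l list \<Rightarrow> 'l list \<Rightarrow> ('l list \<Rightarrow>\<^sub>0 'k)" where
  "qs [] v = Poly_Mapping.single v 1"
| "qs (a # u) [] = Poly_Mapping.single (a # u) 1"
| "qs (a # u) (b # v) = pre (Poly_Mapping.single a 1) (qs u (b # v)) +
     pre (Poly_Mapping.single b 1) (qs (a # u) v) + pre (mu a b) (qs u v)"

definition qm :: "('l list \<Rightarrow>\<^sub>0 'k) \<Rightarrow> ('l list \<Rightarrow>\<^sub>0 'k) \<Rightarrow> ('l list \<Rightarrow>\<^sub>0 'k)" where
  "qm = bilin qs"

lemma vm_simps [simp]:
  "vm (x + x') t = vm x t + vm x' t"
  "vm x (t + t') = vm x t + vm x t'"
  "vm (pscale c x) t = pscale c (vm x t)"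
  "vm x (pscale c t) = pscale c (vm x t)"
  "vm 0 t = 0" "vm x 0 = 0"
  "vm (Poly_Mapping.single l c) (Poly_Mapping.single l' d) = pscale (c * d) (mu l l')"
  by (simp_all add: vm_def)

lemma qm_simps [simp]:
  "qm (x + x') t = qm x t + qm x' t"
  "qm x (t + t') = qm x t + qm x t'"
  "qm (pscale c x) t = pscale c (qm x t)"
  "qm x (pscale c t) = pscale c (qm x t)"
  "qm 0 t = 0" "qm x 0 = 0"
  "qm (Poly_Mapping.single u c) (Poly_Mapping.single v d) = pscale (c * d) (qs u v)"
  by (simp_all add: qm_def)

lemma qm_sum:
  "qm (\<Sum>i\<in>I. g i) t = (\<Sum>i\<in>I. qm (g i) t)"
  "qm s (\<Sum>i\<in>I. g i) = (\<Sum>i\<in>I. qm s (g i))"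
  by (simp_all add: qm_def bilin_sum)

lemma vm_assoc: "vm (vm x y) z = vm x (vm y z)"
proof (induction x rule: pm_induct)
  case x: (single a)
  show ?case
  proof (induction y rule: pm_induct)
    case y: (single b)
    show ?case
    proof (induction z rule: pm_induct)
      case (single c)
      show ?case using mu_assoc[of c a b] by (simp add: vm_def bilin_def)
    qed auto
  qed auto
qed auto

lemma qs_Nil_right [simp]: "qs u [] = Poly_Mapping.single u 1"
  by (cases u) auto

lemma qs_comm: "qs u v = qs v u"
  by (induction u v rule: qs.induct) (simp_all add: mu_comm)

lemma qm_comm: "qm s t = qm t s"
proof -
  have "(\<lambda>u v. qs v u) = qs" by (intro ext) (rule qs_comm)
  then show ?thesis using bilin_flip[of qs t s] by (simp add: qm_def)
qed

lemma qm_one [simp]: "qm wone t = t" "qm t wone = t"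
  by (induction t rule: pm_induct) auto

text \<open>The defining recursion with vectors in place of single letters, so that it can be
  applied again to its own merged letters.\<close>

lemma qm_pre:
  "qm (pre x s) (pre y t) = pre x (qm s (pre y t)) + pre y (qm (pre x s) t) + pre (vm x y) (qm s t)"
proof (induction x rule: pm_induct)
  case x: (single a)
  show ?case
  proof (induction y rule: pm_induct)
    case y: (single b)
    show ?case
    proof (induction s rule: pm_induct)
      case s: (single u)
      show ?case
      proof (induction t rule: pm_induct)
        case (scale c t)
        then show ?case by (simp flip: pscale_add)
      qed auto
    next
      case (scale c t)
      then show ?case by (simp flip: pscale_add)
    qed auto
  next
    case (scale c t)
    then show ?case by (simp flip: pscale_add)
  qed auto
next
  case (scale c t)
  then show ?case by (simp flip: pscale_add)
qed auto

text \<open>Both bracketings expand into seven terms, one for each nonempty set of first letters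
  that merges into the leading letter. The tails agree by induction, the triple merger by
  \<open>vm_assoc\<close>.\<close>

lemma qm_assoc_words:
  "qm (qm (Poly_Mapping.single u 1) (Poly_Mapping.single v 1)) (Poly_Mapping.single w 1) =
   qm (Poly_Mapping.single u 1) (qm (Poly_Mapping.single v 1) (Poly_Mapping.single w 1))"
proof (induction "length u + length v + length w" arbitrary: u v w rule: less_induct)
  case less
  show ?case
  proof (cases "u = [] \<or> v = [] \<or> w = []")
    case False
    then obtain a u' b v' c w' where uvw: "u = a # u'" "v = b # v'" "w = c # w'"
      by (metis list.exhaust)
    define e :: "'l list \<Rightarrow> ('l list \<Rightarrow>\<^sub>0 'k)" where "e = (\<lambda>u. Poly_Mapping.single u 1)"
    define x y z :: "'l \<Rightarrow>\<^sub>0 'k"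
      where "x = Poly_Mapping.single a 1" and "y = Poly_Mapping.single b 1"
        and "z = Poly_Mapping.single c 1"
    have e: "e u = pre x (e u')" "e v = pre y (e v')" "e w = pre z (e w')"
      by (simp_all add: e_def x_def y_def z_def uvw)
    have IH: "qm (qm (e u1) (e v1)) (e w1) = qm (e u1) (qm (e v1) (e w1))"
      if "length u1 + length v1 + length w1 < length u + length v + length w" for u1 v1 w1
      using less[OF that] by (simp add: e_def)
    have l: "qm (qm (e u) (e v)) (e w) =
       pre x (qm (qm (e u') (e v)) (e w)) + pre y (qm (qm (e u) (e v')) (e w))
       + pre (vm x y) (qm (qm (e u') (e v')) (e w))
       + pre z (qm (qm (e u) (e v)) (e w'))
       + pre (vm x z) (qm (qm (e u') (e v)) (e w')) + pre (vm y z) (qm (qm (e u) (e v')) (e w'))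
       + pre (vm (vm x y) z) (qm (qm (e u') (e v')) (e w'))"
      by (simp add: e qm_pre algebra_simps)
    have r: "qm (e u) (qm (e v) (e w)) =
       pre x (qm (e u') (qm (e v) (e w))) + pre y (qm (e u) (qm (e v') (e w)))
       + pre (vm x y) (qm (e u') (qm (e v') (e w)))
       + pre z (qm (e u) (qm (e v) (e w')))
       + pre (vm x z) (qm (e u') (qm (e v) (e w'))) + pre (vm y z) (qm (e u) (qm (e v') (e w')))
       + pre (vm x (vm y z)) (qm (e u') (qm (e v') (e w')))"
      by (simp add: e qm_pre algebra_simps)
    have "qm (qm (e u) (e v)) (e w) = qm (e u) (qm (e v) (e w))"
      unfolding l r by (simp add: IH uvw vm_assoc)
    then show ?thesis by (simp add: e_def)
  qed auto
qed

lemma qm_assoc: "qm (qm x y) z = qm x (qm y z)"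
proof (induction x rule: pm_induct)
  case x: (single a)
  show ?case
  proof (induction y rule: pm_induct)
    case y: (single b)
    show ?case
    proof (induction z rule: pm_induct)
      case (single c)
      show ?case by (rule qm_assoc_words)
    qed auto
  qed auto
qed auto

lemma qm_left_comm: "qm x (qm y z) = qm y (qm x z)"
  by (metis qm_comm qm_assoc)

lemmas qm_ac = qm_assoc qm_comm qm_left_comm

text \<open>The carrier is the whole type, which keeps membership conditions out of the ring
  calculus; the tensors over a set of basis letters appear later as the subset
  \<open>TJ\<close>.\<close>

definition qring :: "('l list \<Rightarrow>\<^sub>0 'k) ring" where
  "qring = \<lparr>carrier = UNIV, monoid.mult = qm, one = wone, ring.zero = 0, add = (+)\<rparr>"

lemma qring_simps [simp]:
  "carrier qring = UNIV" "monoid.mult qring = qm" "one qring = wone" "ring.zero qring = 0"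
  "add qring = (+)"
  by (simp_all add: qring_def)

sublocale Q: cring qring
proof (intro cringI abelian_groupI comm_monoidI)
  show "\<exists>y\<in>carrier qring. y \<oplus>\<^bsub>qring\<^esub> x = \<zero>\<^bsub>qring\<^esub>" for x
    by (auto intro: exI[of _ "- x"])
qed (auto simp: algebra_simps qm_assoc intro: qm_comm)

abbreviation qpow :: "('l list \<Rightarrow>\<^sub>0 'k) \<Rightarrow> nat \<Rightarrow> ('l list \<Rightarrow>\<^sub>0 'k)" where
  "qpow t n \<equiv> t [^]\<^bsub>qring\<^esub> n"

lemma qpow_0 [simp]: "qpow t 0 = wone"
  and qpow_Suc [simp]: "qpow t (Suc n) = qm (qpow t n) t"
  by (simp_all add: nat_pow_def)

lemma qpow_pscale: "qpow (pscale c t) n = pscale (c ^ n) (qpow t n)"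
  by (induction n) (auto simp: mult.commute)

lemma qpow_zero: "n > 0 \<Longrightarrow> qpow 0 n = 0"
  by (cases n) auto

lemma add_pow_qring: "[n] \<cdot>\<^bsub>qring\<^esub> t = pscale (of_nat n) t" for n :: nat
proof (induction n)
  case (Suc n)
  have "[Suc n] \<cdot>\<^bsub>qring\<^esub> t = [n] \<cdot>\<^bsub>qring\<^esub> t + t"
    using Q.add.nat_pow_Suc[of n t] by simp
  then show ?case using Suc by (simp add: pscale_add_left add.commute)
qed (use Q.add.nat_pow_0 in simp)

text \<open>Powers in an algebra without unit: only \<open>n > 0\<close> is meaningful, and
  truncated subtraction gives \<open>vpow x 0 = x\<close>.\<close>

definition vpow :: "('l \<Rightarrow>\<^sub>0 'k) \<Rightarrow> nat \<Rightarrow> ('l \<Rightarrow>\<^sub>0 'k)" where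
  "vpow x n = (vm x ^^ (n - 1)) x"

lemma vpow_Suc_0 [simp]: "vpow x (Suc 0) = x"
  and vpow_Suc: "n > 0 \<Longrightarrow> vpow x (Suc n) = vm x (vpow x n)"
  by (cases n; simp add: vpow_def)+

text \<open>Term \<open>i\<close> collects the ways in which \<open>Suc i\<close> of the
  \<open>Suc n\<close> factors give their first letters to the leading letter. Their tails are
  multiplied together, and the other \<open>n - i\<close> factors stay intact behind it.\<close>

lemma qpow_pre:
  "qpow (pre x t) (Suc n) = (\<Sum>i\<le>n. pscale (of_nat (Suc n choose Suc i))
     (pre (vpow x (Suc i)) (qm (qpow t (Suc i)) (qpow (pre x t) (n - i)))))"
proof (induction n)
  case 0
  then show ?case by simp
next
  case (Suc n)
  let ?X = "pre x t"
  define E where "E j = pre (vpow x (Suc j)) (qm (qpow t (Suc j)) (qpow ?X (Suc n - j)))" for j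
  \<comment> \<open>The leading letter of the new factor stands in front alone, stays behind the old
    leading letter (\<open>E i\<close>), or merges with it (\<open>E (Suc i)\<close>).\<close>
  have step: "qm ?X (pre (vpow x (Suc i)) (qm (qpow t (Suc i)) (qpow ?X (n - i)))) =
      pre x (qm t (pre (vpow x (Suc i)) (qm (qpow t (Suc i)) (qpow ?X (n - i))))) + E i + E (Suc i)"
    if "i \<le> n" for i
  proof -
    have 1: "qm ?X (qm (qpow t (Suc i)) (qpow ?X (n - i))) = qm (qpow t (Suc i)) (qpow ?X (Suc n - i))"
      using that by (simp add: Suc_diff_le qm_ac)
    have 2: "qm t (qm (qpow t (Suc i)) (qpow ?X (n - i))) = qm (qpow t (Suc (Suc i))) (qpow ?X (n - i))"
      by (simp add: qm_ac)
    show ?thesis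
      unfolding qm_pre 1 2 E_def by (simp add: vpow_Suc)
  qed
  have "qpow ?X (Suc (Suc n)) = qm ?X (qpow ?X (Suc n))"
    by (metis qpow_Suc qm_comm)
  also have "\<dots> = (\<Sum>i\<le>n. pscale (of_nat (Suc n choose Suc i))
      (pre x (qm t (pre (vpow x (Suc i)) (qm (qpow t (Suc i)) (qpow ?X (n - i))))) + E i + E (Suc i)))"
    unfolding Suc.IH by (simp only: qm_sum qm_simps) (intro sum.cong refl arg_cong[of _ _ "pscale _"], rule step, simp)
  also have "\<dots> = pre x (qm t (qpow ?X (Suc n))) + (\<Sum>i\<le>n. pscale (of_nat (Suc n choose Suc i)) (E i))
      + (\<Sum>i\<le>n. pscale (of_nat (Suc n choose Suc i)) (E (Suc i)))"
    unfolding Suc.IH by (simp add: pscale_add sum.distrib qm_sum pre_sum)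
  \<comment> \<open>The terms with the new letter alone in front, summed up by the induction
    hypothesis, are the bottom term missing from Pascal's rule.\<close>
  also have "pre x (qm t (qpow ?X (Suc n))) = E 0"
    by (simp add: E_def)
  also have "(\<Sum>i\<le>n. pscale (of_nat (Suc n choose Suc i)) (E i))
      = (\<Sum>i\<le>Suc n. pscale (of_nat (Suc n choose Suc i)) (E i))"
    by (simp add: binomial_eq_0)
  also have "E 0 + (\<Sum>i\<le>Suc n. pscale (of_nat (Suc n choose Suc i)) (E i)) +
      (\<Sum>i\<le>n. pscale (of_nat (Suc n choose Suc i)) (E (Suc i)))
     = (\<Sum>i\<le>Suc n. pscale (of_nat (Suc n choose Suc i)) (E i)) +
       (\<Sum>i\<le>Suc n. pscale (of_nat (Suc n choose i)) (E i))"
    by (subst sum.atMost_Suc_shift[of "\<lambda>i. pscale (of_nat (Suc n choose i)) (E i)"])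
      (simp add: algebra_simps del: binomial_Suc_Suc)
  also have "\<dots> = (\<Sum>i\<le>Suc n. pscale (of_nat (Suc (Suc n) choose Suc i)) (E i))"
    by (simp only: sum.distrib[symmetric] pscale_add_left[symmetric] of_nat_add[symmetric]
        binomial_Suc_Suc[of "Suc n"] add.commute)
  finally show ?case unfolding E_def .
qed

lemma qpow_pre_prime:
  assumes p: "prime p" "of_nat p = (0::'k)"
  shows "qpow (pre x t) p = pre (vpow x p) (qpow t p)"
proof -
  obtain n where n: "p = Suc n" using p by (cases p) auto
  have "of_nat (p choose i) = (0::'k)" if "0 < i" "i < p" for i
  proof -
    have "p dvd (p choose i)" using that p by (intro dvd_choose_prime) auto
    then show ?thesis using p(2) by (auto simp: dvd_def)
  qed
  then have choose: "of_nat (Suc n choose Suc i) = (if i = n then 1 else 0 :: 'k)" if "i \<le> n" for i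
    using that by (auto simp: n simp del: binomial_Suc_Suc)
  have "qpow (pre x t) p = (\<Sum>i\<le>n. if i = n then pre (vpow x p) (qpow t p) else 0)"
    unfolding n qpow_pre by (intro sum.cong refl) (simp add: choose del: binomial_Suc_Suc)
  then show ?thesis by simp
qed

lemma qpow_add:
  assumes p: "prime p" "of_nat p = (0::'k)"
  shows "qpow (s + t) p = qpow s p + qpow t p"
  using Q.frobenius_add[OF p(1), of s t] p(2) by (simp add: add_pow_qring)

lemma qpow_setsum:
  assumes p: "prime p" "of_nat p = (0::'k)"
  shows "qpow (\<Sum>i\<in>I. f i) p = (\<Sum>i\<in>I. qpow (f i) p)"
  using prime_gt_0_nat[OF p(1)] by (induction I rule: infinite_finite_induct) (auto simp: qpow_add[OF p] qpow_zero)

lemma pre_wone_inj: "pre x wone = pre y wone \<Longrightarrow> x = y"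
  by (metis lookup_pre_Cons lookup_single_eq mult.right_neutral poly_mapping_eqI)

text \<open>Vectors embed as one-letter words. Since \<open>wone\<close> is idempotent,
  \<open>qpow_pre_prime\<close> turns \<open>vpow z p\<close> into a p-th power in the unital ring
  \<open>qring\<close>, where the Frobenius map is known to be additive.\<close>

lemma vpow_linear:
  assumes p: "prime p" "of_nat p = (0::'k)"
  shows "vpow (x + y) p = vpow x p + vpow y p" "vpow (pscale c x) p = pscale (c ^ p) (vpow x p)"
proof -
  have pre: "pre (vpow z p) wone = qpow (pre z wone) p" for z
    using qpow_pre_prime[OF p, of z wone] Q.nat_pow_one[of p] by simp
  show "vpow (x + y) p = vpow x p + vpow y p"
    by (rule pre_wone_inj) (simp add: pre qpow_add[OF p])
  show "vpow (pscale c x) p = pscale (c ^ p) (vpow x p)"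
    by (rule pre_wone_inj) (simp add: pre qpow_pscale)
qed

end

section \<open>Grading and derivations\<close>

text \<open>Only the letters in \<open>B\<close> are graded. Positive degrees encode connectedness:
  among the words over \<open>B\<close>, only the empty one has degree 0.\<close>

locale graded_quasi_shuffle = quasi_shuffle mu
  for mu :: "'l \<Rightarrow> 'l \<Rightarrow> ('l \<Rightarrow>\<^sub>0 'k::field)" +
  fixes B :: "'l set" and dg :: "'l \<Rightarrow> nat"
  assumes dg_pos: "l \<in> B \<Longrightarrow> 0 < dg l"
    and mu_graded: "a \<in> B \<Longrightarrow> b \<in> B \<Longrightarrow> mu a b \<in> supp_in {l \<in> B. dg l = dg a + dg b}"
begin

definition wdeg :: "'l list \<Rightarrow> nat" where
  "wdeg w = sum_list (map dg w)"

lemma wdeg_simps [simp]: "wdeg [] = 0" "wdeg (l # w) = dg l + wdeg w"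
  by (simp_all add: wdeg_def)

definition VH :: "nat \<Rightarrow> ('l \<Rightarrow>\<^sub>0 'k) set" where
  "VH n = supp_in {l \<in> B. dg l = n}"

definition TH :: "nat \<Rightarrow> ('l list \<Rightarrow>\<^sub>0 'k) set" where
  "TH n = supp_in {w \<in> lists B. wdeg w = n}"

definition TJ :: "('l list \<Rightarrow>\<^sub>0 'k) set" where
  "TJ = supp_in (lists B)"

lemma subspaces [simp]: "pm.subspace (VH n)" "pm.subspace (TH n)" "pm.subspace TJ"
  by (simp_all add: VH_def TH_def TJ_def subspace_supp_in)

lemma TH_TJ: "t \<in> TH n \<Longrightarrow> t \<in> TJ"
  by (auto simp: TH_def TJ_def supp_in_def)

lemma pre_TH: "x \<in> VH m \<Longrightarrow> t \<in> TH n \<Longrightarrow> pre x t \<in> TH (m + n)"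
  unfolding pre_def TH_def VH_def by (rule bilin_in_subspace) (auto dest!: supp_in_keys intro!: single_in_supp_in)

lemma single_TH: "w \<in> lists B \<Longrightarrow> Poly_Mapping.single w c \<in> TH (wdeg w)"
  by (simp add: TH_def)

lemma single_VH: "l \<in> B \<Longrightarrow> Poly_Mapping.single l c \<in> VH (dg l)"
  by (simp add: VH_def)

lemma qs_TH: "u \<in> lists B \<Longrightarrow> v \<in> lists B \<Longrightarrow> qs u v \<in> TH (wdeg u + wdeg v)"
proof (induction u v rule: qs.induct)
  case (3 a u b v)
  from 3(4,5) have B: "a \<in> B" "b \<in> B" by auto
  let ?N = "wdeg (a # u) + wdeg (b # v)"
  have N: "?N = dg a + (wdeg u + wdeg (b # v))" "?N = dg b + (wdeg (a # u) + wdeg v)"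
    "?N = (dg a + dg b) + (wdeg u + wdeg v)"
    by simp_all
  have "pre (Poly_Mapping.single a 1) (qs u (b # v)) \<in> TH ?N"
    unfolding N(1) using 3 B by (intro pre_TH single_VH) auto
  moreover have "pre (Poly_Mapping.single b 1) (qs (a # u) v) \<in> TH ?N"
    unfolding N(2) using 3 B by (intro pre_TH single_VH) auto
  moreover have "pre (mu a b) (qs u v) \<in> TH ?N"
    unfolding N(3) using 3 B mu_graded[of a b] by (intro pre_TH) (auto simp: VH_def)
  ultimately show ?case
    unfolding qs.simps by (intro pm.subspace_add subspaces)
next
  case (1 v)
  then show ?case using single_TH[of v 1] by simp
next
  case (2 a u)
  then show ?case using single_TH[of "a # u" 1] by simp
qed

lemma qm_TH: "s \<in> TH m \<Longrightarrow> t \<in> TH n \<Longrightarrow> qm s t \<in> TH (m + n)"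
  unfolding qm_def
proof (rule bilin_in_subspace)
  fix u v
  assume "s \<in> TH m" "t \<in> TH n" "u \<in> Poly_Mapping.keys s" "v \<in> Poly_Mapping.keys t"
  then have "u \<in> lists B" "wdeg u = m" "v \<in> lists B" "wdeg v = n"
    unfolding TH_def by (blast dest: supp_in_keys)+
  then show "qs u v \<in> TH (m + n)" using qs_TH by blast
qed simp

lemma qm_TJ: "s \<in> TJ \<Longrightarrow> t \<in> TJ \<Longrightarrow> qm s t \<in> TJ"
  unfolding qm_def
proof (rule bilin_in_subspace)
  fix u v
  assume "s \<in> TJ" "t \<in> TJ" "u \<in> Poly_Mapping.keys s" "v \<in> Poly_Mapping.keys t"
  then have "u \<in> lists B" "v \<in> lists B"
    unfolding TJ_def by (blast dest: supp_in_keys)+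
  then show "qs u v \<in> TJ" using qs_TH TH_TJ by blast
qed simp

lemma wone_TH: "wone \<in> TH 0"
  by (simp add: TH_def)

lemma wone_TJ: "wone \<in> TJ"
  by (simp add: TJ_def)

lemma qpow_TJ: "t \<in> TJ \<Longrightarrow> qpow t n \<in> TJ"
  by (induction n) (auto intro: wone_TJ qm_TJ)

lemma TH_0:
  assumes "t \<in> TH 0"
  shows "t = pscale (Poly_Mapping.lookup t []) wone"
proof (rule poly_mapping_eqI)
  fix w
  have "w = []" if "w \<in> Poly_Mapping.keys t"
    using supp_in_keys[OF assms[unfolded TH_def] that] by (cases w) (auto dest: dg_pos)
  then show "Poly_Mapping.lookup t w = Poly_Mapping.lookup (pscale (Poly_Mapping.lookup t []) wone) w"
    by (cases "w = []") (auto simp: lookup_single in_keys_iff when_def)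
qed

lemma TH_disjoint: "t \<in> TH m \<Longrightarrow> t \<in> TH n \<Longrightarrow> m \<noteq> n \<Longrightarrow> t = 0"
  by (force simp: TH_def supp_in_def simp flip: keys_eq_empty)

text \<open>Words outside \<open>lists B\<close> are sent to 0, so that the image lies in
  \<open>TH n\<close> for every tensor.\<close>

definition proj :: "nat \<Rightarrow> ('l list \<Rightarrow>\<^sub>0 'k) \<Rightarrow> ('l list \<Rightarrow>\<^sub>0 'k)" where
  "proj n = lin (\<lambda>w. if w \<in> lists B \<and> wdeg w = n then Poly_Mapping.single w 1 else 0)"

lemma proj_simps [simp]:
  "proj n (s + t) = proj n s + proj n t" "proj n (pscale c t) = pscale c (proj n t)" "proj n 0 = 0"
  by (simp_all add: proj_def)

lemma proj_TH: "t \<in> TH m \<Longrightarrow> proj n t = (if m = n then t else 0)"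
  unfolding TH_def by (induction rule: supp_in_induct) (auto simp: proj_def)

lemma proj_in_TH: "proj n t \<in> TH n"
  unfolding proj_def by (intro lin_in_subspace) (auto simp: TH_def pm.subspace_0[OF subspace_supp_in])

lemma TJ_decomp:
  assumes "t \<in> TJ"
  shows "\<exists>N. finite N \<and> t = (\<Sum>n\<in>N. proj n t)"
proof -
  let ?N = "wdeg ` Poly_Mapping.keys t"
  have "Poly_Mapping.lookup t w = (\<Sum>n\<in>?N. Poly_Mapping.lookup (proj n t) w)" for w
  proof -
    have lookup: "Poly_Mapping.lookup (proj n t) w = (if wdeg w = n then Poly_Mapping.lookup t w else 0)" for n
      using assms unfolding TJ_def
      by (induction rule: supp_in_induct) (auto simp: proj_def lookup_add lookup_single when_def)
    show ?thesis
      unfolding lookup by (auto simp: sum.delta in_keys_iff image_iff)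
  qed
  then show ?thesis
    by (intro exI[of _ ?N]) (auto intro: poly_mapping_eqI simp: lookup_sum)
qed

text \<open>\<open>D \<phi>\<close> is \<open>(id \<otimes> \<phi>)\<Delta>\<close> for the deconcatenation \<open>\<Delta>\<close>, except that the suffix \<open>[]\<close> is left out, as if
  \<open>\<phi> wone = 0\<close>.\<close>

primrec dw :: "(('l list \<Rightarrow>\<^sub>0 'k) \<Rightarrow> 'k) \<Rightarrow> 'l list \<Rightarrow> ('l list \<Rightarrow>\<^sub>0 'k)" where
  "dw \<phi> [] = 0"
| "dw \<phi> (l # w) = pre (Poly_Mapping.single l 1) (dw \<phi> w)
     + pscale (\<phi> (Poly_Mapping.single (l # w) 1)) wone"

definition D :: "(('l list \<Rightarrow>\<^sub>0 'k) \<Rightarrow> 'k) \<Rightarrow> ('l list \<Rightarrow>\<^sub>0 'k) \<Rightarrow> ('l list \<Rightarrow>\<^sub>0 'k)" where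
  "D \<phi> = lin (dw \<phi>)"

lemma D_simps [simp]:
  "D \<phi> (s + t) = D \<phi> s + D \<phi> t" "D \<phi> (pscale c t) = pscale c (D \<phi> t)" "D \<phi> 0 = 0"
  "D \<phi> (Poly_Mapping.single w c) = pscale c (dw \<phi> w)"
  by (simp_all add: D_def)

definition functional :: "(('l list \<Rightarrow>\<^sub>0 'k) \<Rightarrow> 'k) \<Rightarrow> bool" where
  "functional \<phi> \<longleftrightarrow> (\<forall>s t. \<phi> (s + t) = \<phi> s + \<phi> t) \<and> (\<forall>c t. \<phi> (pscale c t) = c * \<phi> t)"

text \<open>A linear form on the indecomposables, that is, on the augmentation ideal modulo its
  square; \<open>dw\<close> evaluates it on nonempty words only.\<close>

definition indecomposable_functional :: "(('l list \<Rightarrow>\<^sub>0 'k) \<Rightarrow> 'k) \<Rightarrow> bool" where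
  "indecomposable_functional \<phi> \<longleftrightarrow> functional \<phi> \<and>
     (\<forall>u\<in>lists B. \<forall>v\<in>lists B. u \<noteq> [] \<longrightarrow> v \<noteq> [] \<longrightarrow> \<phi> (qs u v) = 0)"

text \<open>A nonempty suffix cut off from x \<otimes> t is either a suffix of t or all of x
  \<otimes> t.\<close>

lemma D_pre:
  assumes "functional \<phi>"
  shows "D \<phi> (pre x t) = pre x (D \<phi> t) + pscale (\<phi> (pre x t)) wone"
proof (induction x rule: pm_induct)
  case x: (single l)
  show ?case
  proof (induction t rule: pm_induct)
    case (scale c t)
    then show ?case using assms by (simp add: functional_def pscale_add)
  next
    case (add s t)
    then show ?case using assms by (simp add: functional_def single_add)
  qed simp
next
  case (scale c x)
  then show ?case using assms by (simp add: functional_def pscale_add)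
next
  case (add s t)
  then show ?case using assms by (simp add: functional_def single_add)
qed

text \<open>By \<open>D_pre\<close>, the three terms of the recursion yield three prefixed
  derivatives, which induction matches with the Leibniz rule, and three multiples of
  \<open>wone\<close>, which cancel.\<close>

lemma D_qs:
  assumes \<phi>: "indecomposable_functional \<phi>"
  shows "u \<in> lists B \<Longrightarrow> v \<in> lists B \<Longrightarrow>
    D \<phi> (qs u v) = qm (dw \<phi> u) (Poly_Mapping.single v 1) + qm (Poly_Mapping.single u 1) (dw \<phi> v)"
proof (induction u v rule: qs.induct)
  case (3 a u b v)
  have fn: "functional \<phi>" using \<phi> by (simp add: indecomposable_functional_def)
  define x y where "x = Poly_Mapping.single a (1::'k)" and "y = Poly_Mapping.single b (1::'k)"
  define su sv where "su = Poly_Mapping.single u (1::'k)" and "sv = Poly_Mapping.single v (1::'k)"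
  have words: "Poly_Mapping.single (a # u) 1 = pre x su" "Poly_Mapping.single (b # v) 1 = pre y sv"
    by (simp_all add: x_def y_def su_def sv_def)
  have "\<phi> (pre x (qs u (b # v)) + pre y (qs (a # u) v) + pre (mu a b) (qs u v)) = \<phi> (qs (a # u) (b # v))"
    by (simp add: x_def y_def)
  also have "\<dots> = 0"
    using \<phi> 3(4,5) by (simp only: indecomposable_functional_def) blast
  \<comment> \<open>The coefficients of the three multiples of \<open>wone\<close> add up to \<phi>
    of the whole product, hence to 0.\<close>
  finally have \<phi>0: "\<phi> (pre x (qs u (b # v))) + \<phi> (pre y (qs (a # u) v)) + \<phi> (pre (mu a b) (qs u v)) = 0"
    using fn by (simp add: functional_def)
  have mu: "mu a b = vm x y" by (simp add: x_def y_def)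
  have IH: "D \<phi> (qs u (b # v)) = qm (dw \<phi> u) (pre y sv) + qm su (dw \<phi> (b # v))"
    "D \<phi> (qs (a # u) v) = qm (dw \<phi> (a # u)) sv + qm (pre x su) (dw \<phi> v)"
    "D \<phi> (qs u v) = qm (dw \<phi> u) sv + qm su (dw \<phi> v)"
    using 3 by (simp_all add: su_def sv_def x_def y_def)
  have dw: "dw \<phi> (a # u) = pre x (dw \<phi> u) + pscale (\<phi> (pre x su)) wone"
    "dw \<phi> (b # v) = pre y (dw \<phi> v) + pscale (\<phi> (pre y sv)) wone"
    by (simp_all add: su_def sv_def x_def y_def)
  have "D \<phi> (qs (a # u) (b # v)) = pre x (D \<phi> (qs u (b # v))) + pre y (D \<phi> (qs (a # u) v))
      + pre (mu a b) (D \<phi> (qs u v)) +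
      pscale (\<phi> (pre x (qs u (b # v))) + \<phi> (pre y (qs (a # u) v)) + \<phi> (pre (mu a b) (qs u v))) wone"
    by (simp add: D_pre[OF fn] x_def y_def pscale_add_left algebra_simps del: pscale_single)
  also have "\<dots> = qm (dw \<phi> (a # u)) (pre y sv) + qm (pre x su) (dw \<phi> (b # v))"
    unfolding \<phi>0 unfolding IH mu dw by (simp add: qm_pre algebra_simps del: pscale_single)
  finally show ?case by (simp only: words)
qed auto

lemma D_qm:
  assumes \<phi>: "indecomposable_functional \<phi>" and "s \<in> TJ" "t \<in> TJ"
  shows "D \<phi> (qm s t) = qm (D \<phi> s) t + qm s (D \<phi> t)"
  using assms(2) unfolding TJ_def
proof (induction s rule: supp_in_induct)
  case u: (single u)
  show ?case using assms(3) unfolding TJ_def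
  proof (induction t rule: supp_in_induct)
    case (single v)
    then show ?case using D_qs[OF \<phi>] u by simp
  next
    case (scale c t)
    then show ?case by (simp add: pscale_add)
  qed (auto simp: algebra_simps)
next
  case (scale c t)
  then show ?case by (simp add: pscale_add)
qed (auto simp: algebra_simps)

text \<open>When \<phi> is concentrated in degree \<open>n\<close>, only suffixes of degree
  \<open>n\<close> contribute, and a word of lower degree has none.\<close>

lemma dw_low:
  assumes "\<And>w. w \<in> lists B \<Longrightarrow> wdeg w \<noteq> n \<Longrightarrow> \<phi> (Poly_Mapping.single w 1) = 0"
    and "w \<in> lists B" "wdeg w < n"
  shows "dw \<phi> w = 0"
  using assms(2,3) by (induction w) (auto simp: assms(1))

lemma D_low:
  assumes "\<And>w. w \<in> lists B \<Longrightarrow> wdeg w \<noteq> n \<Longrightarrow> \<phi> (Poly_Mapping.single w 1) = 0"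
    and "t \<in> TH m" "m < n"
  shows "D \<phi> t = 0"
  using assms(2) unfolding TH_def
proof (induction rule: supp_in_induct)
  case (single w)
  then show ?case using dw_low[of n \<phi> w] assms by auto
qed auto

text \<open>In degree \<open>n\<close> only the whole word can be cut off: dropping its first
  letter, which has positive degree, leaves too little.\<close>

lemma D_top:
  assumes "\<And>w. w \<in> lists B \<Longrightarrow> wdeg w \<noteq> n \<Longrightarrow> \<phi> (Poly_Mapping.single w 1) = 0"
    and fn: "functional \<phi>" and "t \<in> TH n" "n > 0"
  shows "D \<phi> t = pscale (\<phi> t) wone"
  using assms(3) unfolding TH_def
proof (induction rule: supp_in_induct)
  case (single w)
  then obtain l v where w: "w = l # v" using \<open>n > 0\<close> by (cases w) auto
  then have "dw \<phi> v = 0"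
    using single dg_pos[of l] by (intro dw_low[of n]) (auto simp: assms(1))
  then show ?case by (simp add: w)
next
  case zero
  show ?case using fn[unfolded functional_def] pscale_zero[of 0]
    by (metis D_simps(3) mult_zero_left pscale_zero)
qed (use fn in \<open>auto simp: functional_def single_add\<close>)

end

section \<open>The Frobenius map of the quasi-shuffle ring\<close>

locale graded_quasi_shuffle_char = graded_quasi_shuffle mu B dg
  for mu :: "'l \<Rightarrow> 'l \<Rightarrow> ('l \<Rightarrow>\<^sub>0 'k::field)" and B :: "'l set" and dg :: "'l \<Rightarrow> nat" +
  fixes p :: nat
  assumes char_p: "CHAR('k) = p" and p_pos: "0 < p" and perfect: "\<exists>d::'k. d ^ p = c"
begin

lemma prime_p: "prime p"
  using prime_CHAR_semidom[where 'a = 'k] char_p p_pos by simp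

lemma of_nat_p: "of_nat p = (0::'k)"
  using of_nat_CHAR[where 'a = 'k] char_p by simp

definition root :: "'k \<Rightarrow> 'k" where
  "root c = (SOME d. d ^ p = c)"

lemma root_pow [simp]: "root c ^ p = c"
  unfolding root_def by (rule someI_ex) (rule perfect)

lemma root_eq_0_iff: "root c = 0 \<longleftrightarrow> c = 0"
  using root_pow[of c] p_pos by (metis power_eq_0_iff power_not_zero)

lemmas char_p_simps =
  qpow_pre_prime[OF prime_p of_nat_p] qpow_add[OF prime_p of_nat_p] qpow_setsum[OF prime_p of_nat_p]
  vpow_linear[OF prime_p of_nat_p]

lemma vpow_zero [simp]: "vpow 0 p = 0"
  using vpow_linear(2)[OF prime_p of_nat_p, of 0 0] p_pos by (simp add: power_0_left)

lemma vpow_sum: "vpow (\<Sum>i\<in>I. f i) p = (\<Sum>i\<in>I. vpow (f i) p)"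
  by (induction I rule: infinite_finite_induct) (auto simp: char_p_simps)

lemma vm_VH: "x \<in> VH m \<Longrightarrow> y \<in> VH n \<Longrightarrow> vm x y \<in> VH (m + n)"
  unfolding vm_def
proof (rule bilin_in_subspace)
  fix a b
  assume "x \<in> VH m" "y \<in> VH n" "a \<in> Poly_Mapping.keys x" "b \<in> Poly_Mapping.keys y"
  then have "a \<in> B" "dg a = m" "b \<in> B" "dg b = n"
    unfolding VH_def by (blast dest: supp_in_keys)+
  then show "mu a b \<in> VH (m + n)" using mu_graded[of a b] by (simp add: VH_def)
qed simp

lemma vpow_VH: "x \<in> VH n \<Longrightarrow> i > 0 \<Longrightarrow> vpow x i \<in> VH (i * n)"
proof (induction i)
  case (Suc i)
  then show ?case
    using vm_VH[of x n "vpow x i" "i * n"] by (cases "i = 0") (auto simp: vpow_Suc)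
qed auto

text \<open>The p-th power multiplies degrees by p, so the powers of the homogeneous components of
  \<open>v\<close> lie in different degrees and vanish one by one.\<close>

lemma vpow_inj_of_homogeneous:
  assumes inj: "\<And>n x. x \<in> VH n \<Longrightarrow> vpow x p = 0 \<Longrightarrow> x = 0"
    and v: "v \<in> supp_in B" "vpow v p = 0"
  shows "v = 0"
proof -
  define part where "part n = lin (\<lambda>l. if dg l = n then Poly_Mapping.single l 1 else 0) v" for n
  have lookup_part: "Poly_Mapping.lookup (part n) l = (if dg l = n then Poly_Mapping.lookup v l else 0)" for n l
    unfolding part_def by (induction v rule: pm_induct) (auto simp: lookup_add lookup_single when_def)
  have VH: "part n \<in> VH n" for n
    using v(1) unfolding part_def VH_def
    by (intro lin_in_subspace) (auto simp: pm.subspace_0 dest: supp_in_keys)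
  define N where "N = dg ` Poly_Mapping.keys v"
  have "v = (\<Sum>n\<in>N. part n)"
    by (rule poly_mapping_eqI) (auto simp: lookup_sum lookup_part N_def in_keys_iff image_iff)
  then have sum: "(\<Sum>n\<in>N. vpow (part n) p) = 0"
    using v(2) by (metis vpow_sum)
  have "vpow (part n) p = 0" if n: "n \<in> N" for n
  proof (rule poly_mapping_eqI)
    fix l
    have low: "Poly_Mapping.lookup (vpow (part m) p) l = 0" if "dg l \<noteq> p * m" for m
      using vpow_VH[OF VH p_pos, of m] that by (auto simp: VH_def supp_in_def in_keys_iff)
    show "Poly_Mapping.lookup (vpow (part n) p) l = Poly_Mapping.lookup 0 l"
    proof (cases "dg l = p * n")
      case True
      have "(\<Sum>m\<in>N. Poly_Mapping.lookup (vpow (part m) p) l) = Poly_Mapping.lookup (vpow (part n) p) l"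
        using n True p_pos by (subst sum.remove[of _ n]) (auto simp: N_def intro!: sum.neutral low)
      then show ?thesis using sum by (simp flip: lookup_sum)
    qed (simp add: low)
  qed
  then have "part n = 0" if "n \<in> N" for n
    using that inj VH by blast
  then show ?thesis using \<open>v = (\<Sum>n\<in>N. part n)\<close> by simp
qed

text \<open>Induction on a bound for the word length, through the decomposition by first letters:
  the constant term vanishes on its own, and each suffix tensor \<open>part l\<close> turns out to
  have p-th power 0.\<close>

lemma frobenius_inj:
  assumes inj: "\<And>n x. x \<in> VH n \<Longrightarrow> vpow x p = 0 \<Longrightarrow> x = 0"
    and "t \<in> TJ" "qpow t p = 0"
  shows "t = 0"
proof -
  have "t = 0" if "\<forall>w\<in>Poly_Mapping.keys t. length w < N" "t \<in> TJ" "qpow t p = 0" for N t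
    using that
  proof (induction N arbitrary: t)
    case (Suc N)
    define c where "c = Poly_Mapping.lookup t []"
    define part where "part l = Poly_Mapping.map_key (Cons l) t" for l
    obtain L where L: "finite L" "L = {l. \<exists>w. l # w \<in> Poly_Mapping.keys t}"
      and t: "t = pscale c wone + (\<Sum>l\<in>L. pre (Poly_Mapping.single l 1) (part l))"
      using word_split[of t] unfolding c_def part_def by blast
    have keys_part: "w \<in> Poly_Mapping.keys (part l) \<longleftrightarrow> l # w \<in> Poly_Mapping.keys t" for l w
      by (simp add: part_def in_keys_iff map_key.rep_eq)
    have LB: "L \<subseteq> B"
      using Suc.prems(2) by (auto simp: L(2) TJ_def supp_in_def)
    have 0: "pscale (c ^ p) wone + (\<Sum>l\<in>L. pre (vpow (Poly_Mapping.single l 1) p) (qpow (part l) p)) = 0"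
      using Suc.prems(3) Q.nat_pow_one[of p] by (subst (asm) t) (simp add: char_p_simps qpow_pscale del: pscale_single)
    have "c ^ p = 0"
      using arg_cong[OF 0, of "\<lambda>t. Poly_Mapping.lookup t []"] by (simp add: lookup_add lookup_sum)
    then have c: "c = 0" using p_pos by simp
    have "qpow (part l) p = 0" if l: "l \<in> L" for l
    proof (rule poly_mapping_eqI)
      fix w
      \<comment> \<open>The vector attached to the suffix \<open>w\<close>. Its p-th power restores
        the coefficients under the roots, so its coefficient at a letter \<open>x\<close> is that of
        the vanishing power of \<open>t\<close> at \<open>x # w\<close>.\<close>
      define v where "v = (\<Sum>l\<in>L. pscale (root (Poly_Mapping.lookup (qpow (part l) p) w)) (Poly_Mapping.single l (1::'k)))"
      have "v \<in> supp_in B"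
        unfolding v_def using LB by (intro pm.subspace_sum pm.subspace_scale) auto
      moreover have "vpow v p = 0"
      proof (rule poly_mapping_eqI)
        fix x
        show "Poly_Mapping.lookup (vpow v p) x = Poly_Mapping.lookup 0 x"
          using arg_cong[OF 0, of "\<lambda>t. Poly_Mapping.lookup t (x # w)"]
          unfolding v_def vpow_sum
          by (simp add: lookup_add lookup_sum char_p_simps lookup_single mult.commute del: pscale_single)
      qed
      ultimately have "v = 0" using vpow_inj_of_homogeneous[of v] inj by blast
      then have "Poly_Mapping.lookup v l = 0" by simp
      moreover have "Poly_Mapping.lookup v l = root (Poly_Mapping.lookup (qpow (part l) p) w)"
        unfolding v_def using l L(1) by (simp add: lookup_sum lookup_single when_def if_distrib sum.delta' cong: if_cong)
      ultimately show "Poly_Mapping.lookup (qpow (part l) p) w = Poly_Mapping.lookup 0 w"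
        by (simp add: root_eq_0_iff)
    qed
    moreover have "\<forall>w\<in>Poly_Mapping.keys (part l). length w < N" for l
    proof
      fix w assume "w \<in> Poly_Mapping.keys (part l)"
      then have "length (l # w) < Suc N" using Suc.prems(1) keys_part by blast
      then show "length w < N" by simp
    qed
    moreover have "part l \<in> TJ" for l
      unfolding TJ_def supp_in_def
    proof (intro CollectI subsetI)
      fix w assume "w \<in> Poly_Mapping.keys (part l)"
      then have "l # w \<in> lists B" using Suc.prems(2) keys_part unfolding TJ_def supp_in_def by blast
      then show "w \<in> lists B" by simp
    qed
    ultimately have "part l = 0" if "l \<in> L" for l
      using Suc.IH that by blast
    then show ?case using t c by simp
  qed (auto simp flip: keys_eq_empty)
  moreover have "\<forall>w\<in>Poly_Mapping.keys t. length w < Suc (Max (length ` Poly_Mapping.keys t))"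
    by (simp add: less_Suc_eq_le)
  ultimately show ?thesis using assms(2,3) by blast
qed

end

section \<open>Algebraic independence\<close>

definition wt :: "('x \<Rightarrow> nat) \<Rightarrow> ('x \<Rightarrow>\<^sub>0 nat) \<Rightarrow> nat" where
  "wt d m = (\<Sum>x\<in>Poly_Mapping.keys m. Poly_Mapping.lookup m x * d x)"

lemma wt_superset:
  assumes "finite S" "Poly_Mapping.keys m \<subseteq> S"
  shows "wt d m = (\<Sum>x\<in>S. Poly_Mapping.lookup m x * d x)"
  unfolding wt_def using assms by (intro sum.mono_neutral_left) (auto simp: in_keys_iff)

lemma keys_add_nat: "Poly_Mapping.keys (m + n :: 'x \<Rightarrow>\<^sub>0 nat) = Poly_Mapping.keys m \<union> Poly_Mapping.keys n"
  by (auto simp: in_keys_iff lookup_add)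

lemma wt_add: "wt d (m + n) = wt d m + wt d n"
  by (subst (1 2 3) wt_superset[of "Poly_Mapping.keys m \<union> Poly_Mapping.keys n"])
    (auto simp: keys_add_nat lookup_add sum.distrib algebra_simps)

lemma wt_single [simp]: "wt d (Poly_Mapping.single x n) = n * d x"
  by (subst wt_superset[of "{x}"]) auto

lemma wt_0 [simp]: "wt d 0 = 0"
  by (simp add: wt_def)

lemma monomial_induct [case_names zero step]:
  fixes m :: "'x \<Rightarrow>\<^sub>0 nat"
  assumes "P 0" "\<And>m x. P m \<Longrightarrow> P (m + Poly_Mapping.single x 1)"
  shows "P m"
proof (induction m rule: update_induct)
  case (update f a b)
  have "P (f + Poly_Mapping.single a n)" for n
  proof (induction n)
    case 0
    show ?case using update by simp
  next
    case (Suc n)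
    have "Poly_Mapping.single a (Suc n) = Poly_Mapping.single a n + Poly_Mapping.single a 1"
      by (simp flip: single_add)
    then show ?case using assms(2)[OF Suc, of a] by (simp add: add.assoc)
  qed
  moreover have "Poly_Mapping.update a b f = f + Poly_Mapping.single a b"
    using update(1) by (intro poly_mapping_eqI)
      (auto simp: lookup_update lookup_add lookup_single when_def in_keys_iff)
  ultimately show ?case by simp
qed (rule assms)

lemma monomial_diff_add:
  "0 < Poly_Mapping.lookup m x \<Longrightarrow> m - Poly_Mapping.single x 1 + Poly_Mapping.single x (1::nat) = m"
  by (rule poly_mapping_eqI) (auto simp: lookup_add lookup_minus lookup_single when_def)

definition PH :: "'x set \<Rightarrow> ('x \<Rightarrow> nat) \<Rightarrow> nat \<Rightarrow> (('x \<Rightarrow>\<^sub>0 nat) \<Rightarrow>\<^sub>0 'k::field) set" where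
  "PH V d n = supp_in {m. Poly_Mapping.keys m \<subseteq> V \<and> wt d m = n}"

text \<open>The formal partial derivative. Truncated subtraction of exponents does no harm: if
  \<open>x\<close> does not occur in \<open>m\<close>, the coefficient is 0.\<close>

definition pdiff :: "'x \<Rightarrow> (('x \<Rightarrow>\<^sub>0 nat) \<Rightarrow>\<^sub>0 'k::field) \<Rightarrow> (('x \<Rightarrow>\<^sub>0 nat) \<Rightarrow>\<^sub>0 'k)" where
  "pdiff x = lin (\<lambda>m. Poly_Mapping.single (m - Poly_Mapping.single x 1) (of_nat (Poly_Mapping.lookup m x)))"

lemma pdiff_simps [simp]:
  "pdiff x (P + Q) = pdiff x P + pdiff x Q" "pdiff x (pscale c P) = pscale c (pdiff x P)"
  "pdiff x 0 = 0"
  "pdiff x (Poly_Mapping.single m c) =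
     Poly_Mapping.single (m - Poly_Mapping.single x 1) (c * of_nat (Poly_Mapping.lookup m x))"
  by (simp_all add: pdiff_def)

lemma lookup_pdiff:
  "Poly_Mapping.lookup (pdiff x P) m =
     of_nat (Poly_Mapping.lookup m x + 1) * Poly_Mapping.lookup P (m + Poly_Mapping.single x 1)"
proof (induction P rule: pm_induct)
  case (single m')
  show ?case
  proof (cases "m' = m + Poly_Mapping.single x 1")
    case True
    have "m + Poly_Mapping.single x 1 - Poly_Mapping.single x 1 = m"
      by (rule poly_mapping_eqI) (simp add: lookup_add lookup_minus)
    then show ?thesis by (simp add: True lookup_add)
  next
    case False
    then have "Poly_Mapping.lookup m' x = 0 \<or> m' - Poly_Mapping.single x 1 \<noteq> m"
      using monomial_diff_add[of m' x] by auto
    then show ?thesis using False by (auto simp: lookup_single)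
  qed
qed (auto simp: lookup_add algebra_simps)

text \<open>The truncated degree is right as well: if \<open>d x\<close> exceeds \<open>n\<close>,
  then \<open>x\<close> occurs in no monomial of \<open>P\<close> and the derivative is 0.\<close>

lemma pdiff_PH:
  assumes "P \<in> PH V d n"
  shows "pdiff x P \<in> PH V d (n - d x)"
  unfolding pdiff_def PH_def
proof (rule lin_in_subspace)
  fix m assume m: "m \<in> Poly_Mapping.keys P"
  show "Poly_Mapping.single (m - Poly_Mapping.single x 1) (of_nat (Poly_Mapping.lookup m x))
      \<in> supp_in {m. Poly_Mapping.keys m \<subseteq> V \<and> wt d m = n - d x}"
  proof (cases "Poly_Mapping.lookup m x = 0")
    case False
    then have *: "m - Poly_Mapping.single x 1 + Poly_Mapping.single x 1 = m"
      by (intro monomial_diff_add) simp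
    have "Poly_Mapping.keys m \<subseteq> V" "wt d m = n"
      using m assms by (auto simp: PH_def supp_in_def)
    then have "Poly_Mapping.keys (m - Poly_Mapping.single x 1) \<subseteq> V"
      "wt d (m - Poly_Mapping.single x 1) + d x = n"
      using arg_cong[OF *, of Poly_Mapping.keys] arg_cong[OF *, of "wt d"]
      by (auto simp: keys_add_nat wt_add)
    then show ?thesis by (intro single_in_supp_in) auto
  qed (simp add: pm.subspace_0)
qed simp

lemma PH_0:
  assumes "P \<in> PH V d 0" "\<And>x. x \<in> V \<Longrightarrow> 0 < d x"
  shows "P = Poly_Mapping.single 0 (Poly_Mapping.lookup P 0)"
proof (rule poly_mapping_eqI)
  fix m
  have "m = 0" if "m \<in> Poly_Mapping.keys P"
  proof -
    have m: "Poly_Mapping.keys m \<subseteq> V" "wt d m = 0"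
      using assms that by (auto simp: PH_def supp_in_def)
    have "x \<notin> Poly_Mapping.keys m" for x
    proof
      assume x: "x \<in> Poly_Mapping.keys m"
      then have "Poly_Mapping.lookup m x * d x = 0" using m(2) by (simp add: wt_def)
      moreover have "x \<in> V" "Poly_Mapping.lookup m x \<noteq> 0" using x m(1) by (auto simp: in_keys_iff)
      ultimately show False using assms(2)[of x] by simp
    qed
    then show "m = 0" by (metis all_not_in_conv keys_eq_empty)
  qed
  then show "Poly_Mapping.lookup P m = Poly_Mapping.lookup (Poly_Mapping.single 0 (Poly_Mapping.lookup P 0)) m"
    by (cases "m = 0") (auto simp: lookup_single in_keys_iff when_def)
qed

section \<open>Substitution of tensors into polynomials and the chain rule\<close>

context graded_quasi_shuffle
begin

definition mon :: "('x \<Rightarrow> ('l list \<Rightarrow>\<^sub>0 'k)) \<Rightarrow> ('x \<Rightarrow>\<^sub>0 nat) \<Rightarrow> ('l list \<Rightarrow>\<^sub>0 'k)" where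
  "mon g m = (\<Otimes>\<^bsub>qring\<^esub>x\<in>Poly_Mapping.keys m. qpow (g x) (Poly_Mapping.lookup m x))"

text \<open>The algebra homomorphism from the polynomial ring that substitutes \<open>g x\<close>
  for \<open>x\<close>.\<close>

definition ev :: "('x \<Rightarrow> ('l list \<Rightarrow>\<^sub>0 'k)) \<Rightarrow> (('x \<Rightarrow>\<^sub>0 nat) \<Rightarrow>\<^sub>0 'k) \<Rightarrow> ('l list \<Rightarrow>\<^sub>0 'k)" where
  "ev g = lin (mon g)"

lemma ev_simps [simp]:
  "ev g (P + Q) = ev g P + ev g Q" "ev g (pscale c P) = pscale c (ev g P)" "ev g 0 = 0"
  "ev g (Poly_Mapping.single m c) = pscale c (mon g m)"
  by (simp_all add: ev_def)

lemma mon_superset: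
  assumes "finite S" "Poly_Mapping.keys m \<subseteq> S"
  shows "mon g m = (\<Otimes>\<^bsub>qring\<^esub>x\<in>S. qpow (g x) (Poly_Mapping.lookup m x))"
  unfolding mon_def using assms
  by (intro Q.finprod_mono_neutral_cong_left) (auto simp: in_keys_iff)

lemma mon_add: "mon g (m + n) = qm (mon g m) (mon g n)"
proof -
  let ?S = "Poly_Mapping.keys m \<union> Poly_Mapping.keys n"
  have "mon g (m + n) = (\<Otimes>\<^bsub>qring\<^esub>x\<in>?S. qpow (g x) (Poly_Mapping.lookup m x) \<otimes>\<^bsub>qring\<^esub> qpow (g x) (Poly_Mapping.lookup n x))"
    using Q.nat_pow_mult by (subst mon_superset[of ?S]) (auto simp: keys_add_nat lookup_add)
  also have "\<dots> = qm (mon g m) (mon g n)"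
    by (subst Q.finprod_multf) (auto simp: mon_superset[of ?S])
  finally show ?thesis .
qed

lemma mon_0 [simp]: "mon g 0 = wone"
  by (simp add: mon_def)

lemma mon_single [simp]: "mon g (Poly_Mapping.single x (Suc 0)) = g x"
  by (simp add: mon_def)

lemma ev_mult: "ev g (P * Q) = qm (ev g P) (ev g Q)"
proof (induction P rule: pm_induct)
  case m: (single m)
  show ?case
  proof (induction Q rule: pm_induct)
    case (scale c Q)
    have "Poly_Mapping.single m 1 * pscale c Q = pscale c (Poly_Mapping.single m 1 * Q)"
      by (simp add: pscale_def mult_map_scale_conv_mult algebra_simps)
    then show ?case using scale by simp
  qed (auto simp: mult_single mon_add distrib_left)
next
  case (scale c P)
  have "pscale c P * Q = pscale c (P * Q)"
    by (simp add: pscale_def mult_map_scale_conv_mult algebra_simps)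
  then show ?case using scale by simp
qed (auto simp: algebra_simps)

lemma ev_one [simp]: "ev g 1 = wone"
  using ev_simps(4)[of g 0 1] by (simp del: ev_simps(4))

lemma mon_TH:
  assumes "\<And>x. x \<in> V \<Longrightarrow> g x \<in> TH (d x)"
  shows "Poly_Mapping.keys m \<subseteq> V \<Longrightarrow> mon g m \<in> TH (wt d m)"
proof (induction m rule: monomial_induct)
  case (step m x)
  then have "mon g m \<in> TH (wt d m)" "x \<in> V" by (auto simp: keys_add_nat)
  then show ?case using qm_TH[OF _ assms[of x]] by (auto simp: mon_add wt_add)
qed (simp add: wone_TH)

lemma ev_TH:
  assumes "\<And>x. x \<in> V \<Longrightarrow> g x \<in> TH (d x)" "P \<in> PH V d n"
  shows "ev g P \<in> TH n"
  unfolding ev_def using assms(2) mon_TH[of V g d, OF assms(1)]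
  by (intro lin_in_subspace) (auto simp: PH_def supp_in_def)

text \<open>Leibniz rule for a monomial. The sum runs over a fixed finite \<open>S\<close> and not
  over the variables of \<open>m\<close>, so that its range is stable in the induction.\<close>

lemma D_mon:
  assumes \<phi>: "indecomposable_functional \<phi>" and g: "\<And>x. x \<in> V \<Longrightarrow> g x \<in> TH (d x)"
    and S: "finite S" "S \<subseteq> V"
  shows "Poly_Mapping.keys m \<subseteq> S \<Longrightarrow> D \<phi> (mon g m) =
    (\<Sum>y\<in>S. qm (pscale (of_nat (Poly_Mapping.lookup m y)) (mon g (m - Poly_Mapping.single y 1))) (D \<phi> (g y)))"
proof (induction m rule: monomial_induct)
  case zero
  then show ?case by simp
next
  case (step m x)
  define dm where "dm m y = pscale (of_nat (Poly_Mapping.lookup m y)) (mon g (m - Poly_Mapping.single y 1))" for m y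
  have keys: "Poly_Mapping.keys m \<subseteq> S" "x \<in> S" using step.prems by (auto simp: keys_add_nat)
  have TJ: "mon g m \<in> TJ" "g x \<in> TJ"
    using mon_TH[of V g d m, OF g] g keys S by (blast intro: TH_TJ)+
  \<comment> \<open>Product rule for the derivative of \<open>m\<close> times \<open>x\<close> in
    direction \<open>y\<close>.\<close>
  have dm: "dm (m + Poly_Mapping.single x 1) y = qm (dm m y) (g x) + (if y = x then mon g m else 0)" for y
  proof (cases "Poly_Mapping.lookup m y = 0")
    case True
    have "m + Poly_Mapping.single x 1 - Poly_Mapping.single x 1 = m"
      by (rule poly_mapping_eqI) (simp add: lookup_add lookup_minus)
    then show ?thesis using True by (auto simp: dm_def lookup_add lookup_single)
  next
    case False
    then have "m + Poly_Mapping.single x 1 - Poly_Mapping.single y 1 = (m - Poly_Mapping.single y 1) + Poly_Mapping.single x 1"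
      by (intro poly_mapping_eqI) (auto simp: lookup_add lookup_minus lookup_single when_def)
    moreover have "qm (mon g (m - Poly_Mapping.single x 1)) (g x) = mon g m" if "y = x"
      using monomial_diff_add[of m x] False that mon_add[of g "m - Poly_Mapping.single x 1" "Poly_Mapping.single x 1"] by simp
    ultimately show ?thesis
      by (auto simp: dm_def lookup_add lookup_single mon_add pscale_add_left)
  qed
  have "D \<phi> (mon g (m + Poly_Mapping.single x 1)) = qm (D \<phi> (mon g m)) (g x) + qm (mon g m) (D \<phi> (g x))"
    using D_qm[OF \<phi> TJ] by (simp add: mon_add)
  also have "qm (D \<phi> (mon g m)) (g x) = (\<Sum>y\<in>S. qm (qm (dm m y) (g x)) (D \<phi> (g y)))"
    unfolding step.IH[OF keys(1)] dm_def[symmetric] qm_sum by (intro sum.cong refl) (simp only: qm_ac)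
  also have "qm (mon g m) (D \<phi> (g x)) = (\<Sum>y\<in>S. qm (if y = x then mon g m else 0) (D \<phi> (g y)))"
    using keys S(1) by (simp add: if_distrib[of "\<lambda>t. qm t _"] cong: if_cong)
  finally show ?case unfolding dm_def[symmetric] by (simp only: dm qm_simps sum.distrib)
qed

text \<open>The chain rule for the derivation \<open>D \<phi>\<close>, by linearity from the Leibniz
  rule for monomials.\<close>

lemma D_ev:
  assumes \<phi>: "indecomposable_functional \<phi>" and g: "\<And>x. x \<in> V \<Longrightarrow> g x \<in> TH (d x)"
    and S: "finite S" "S \<subseteq> V" and P: "P \<in> supp_in {m. Poly_Mapping.keys m \<subseteq> S}"
  shows "D \<phi> (ev g P) = (\<Sum>y\<in>S. qm (ev g (pdiff y P)) (D \<phi> (g y)))"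
  using P
proof (induction rule: supp_in_induct)
  case (single m)
  then show ?case using D_mon[OF \<phi> g S] by simp
next
  case (scale c t)
  then show ?case by (simp add: pm.scale_sum_right)
qed (auto simp: sum.distrib)

lemma qpow_mon: "\<exists>m'. qpow (mon g m) n = mon g m' \<and> (\<forall>x. Poly_Mapping.lookup m' x = n * Poly_Mapping.lookup m x)"
proof (induction n)
  case 0
  then show ?case by (intro exI[of _ 0]) simp
next
  case (Suc n)
  then obtain m' where "qpow (mon g m) n = mon g m'" "\<forall>x. Poly_Mapping.lookup m' x = n * Poly_Mapping.lookup m x"
    by blast
  then show ?case by (intro exI[of _ "m' + m"]) (simp add: mon_add lookup_add)
qed

end

section \<open>Vanishing of relations between the generators\<close>

context graded_quasi_shuffle_char
begin

text \<open>A functional \<open>\<phi> x\<close> dual to the generator \<open>g x\<close> yields a derivation that lowers degrees by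
  \<open>d x\<close>; on the generators of degree at most \<open>d x\<close> it is the Kronecker delta.\<close>

lemma ev_eq_0:
  fixes V :: "'x set"
  assumes inj: "\<And>t. t \<in> TJ \<Longrightarrow> qpow t p = 0 \<Longrightarrow> t = 0"
    and d: "\<And>x. x \<in> V \<Longrightarrow> 0 < d x" and g: "\<And>x. x \<in> V \<Longrightarrow> g x \<in> TH (d x)"
    and \<phi>: "\<And>x. x \<in> V \<Longrightarrow> indecomposable_functional (\<phi> x)"
    and \<phi>_deg: "\<And>x w. x \<in> V \<Longrightarrow> w \<in> lists B \<Longrightarrow> wdeg w \<noteq> d x \<Longrightarrow> \<phi> x (Poly_Mapping.single w 1) = 0"
    and dual: "\<And>x y. x \<in> V \<Longrightarrow> y \<in> V \<Longrightarrow> d x = d y \<Longrightarrow> \<phi> x (g y) = (if x = y then 1 else 0)"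
  shows "P \<in> PH V d n \<Longrightarrow> ev g P = 0 \<Longrightarrow> P = 0"
proof (induction n arbitrary: P rule: less_induct)
  case (less n)
  show ?case
  proof (cases "n = 0")
    case True
    then have P: "P = Poly_Mapping.single 0 (Poly_Mapping.lookup P 0)"
      using PH_0 less.prems(1) d by blast
    then have "ev g P = Poly_Mapping.single [] (Poly_Mapping.lookup P 0)"
      by (metis ev_simps(4) mon_0 pscale_single mult.right_neutral)
    then have "Poly_Mapping.lookup P 0 = 0" using less.prems(2) by (metis lookup_single_eq lookup_zero)
    then show ?thesis using P by simp
  next
    case False
    define S where "S = (\<Union>m\<in>Poly_Mapping.keys P. Poly_Mapping.keys m)"
    have S: "finite S" "S \<subseteq> V" and P_S: "P \<in> supp_in {m. Poly_Mapping.keys m \<subseteq> S}"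
      using less.prems(1) by (auto simp: S_def PH_def supp_in_def)
    have pdiff_0: "pdiff x P = 0" if "x \<in> S" for x
    proof (rule ccontr)
      assume "pdiff x P \<noteq> 0"
      \<comment> \<open>A variable \<open>y\<close> of maximal degree is taken in \<open>S'\<close>.
        Generators of lower degree are killed by \<open>D (\<phi> y)\<close>, those of higher degree
        come with a zero derivative of \<open>P\<close>, and in equal degree duality leaves only
        \<open>y\<close>.\<close>
      define S' where "S' = {x \<in> S. pdiff x P \<noteq> 0}"
      have "finite S'" "S' \<noteq> {}"
        using \<open>pdiff x P \<noteq> 0\<close> that S by (auto simp: S'_def)
      then have "Max (d ` S') \<in> d ` S'" by (intro Max_in) auto
      then obtain y where y: "y \<in> S'" "d y = Max (d ` S')" by (metis imageE)
      then have y_max: "d z \<le> d y" if "z \<in> S'" for z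
        using that \<open>finite S'\<close> by simp
      have yV: "y \<in> V" "y \<in> S" using S y(1) by (auto simp: S'_def)
      have summand: "qm (ev g (pdiff z P)) (D (\<phi> y) (g z)) = (if z = y then ev g (pdiff y P) else 0)" if z: "z \<in> S" for z
      proof (cases "d z < d y")
        case True
        then have "D (\<phi> y) (g z) = 0"
          using D_low[of "d y" "\<phi> y" "g z" "d z"] \<phi>_deg[OF yV(1)] g z S by blast
        then show ?thesis using True by auto
      next
        case False
        show ?thesis
        proof (cases "pdiff z P = 0")
          case True
          then show ?thesis using y by (auto simp: S'_def)
        next
          case pd: False
          then have "d z = d y" using y_max[of z] z False by (simp add: S'_def)
          then have "D (\<phi> y) (g z) = pscale (\<phi> y (g z)) wone"
            using D_top[of "d y" "\<phi> y" "g z"] \<phi>_deg[OF yV(1)] \<phi>[OF yV(1)] g[of z] d[OF yV(1)] z S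
            by (auto simp: indecomposable_functional_def)
          then show ?thesis using dual[OF yV(1), of z] z S \<open>d z = d y\<close> by auto
        qed
      qed
      have "0 = D (\<phi> y) (ev g P)" using less.prems(2) by simp
      also have "\<dots> = (\<Sum>z\<in>S. if z = y then ev g (pdiff y P) else 0)"
        using D_ev[OF \<phi>[OF yV(1)] g S P_S] summand by simp
      also have "\<dots> = ev g (pdiff y P)" using S(1) yV(2) by simp
      finally have "ev g (pdiff y P) = 0" by simp
      moreover have "pdiff y P \<in> PH V d (n - d y)" "n - d y < n"
        using pdiff_PH[OF less.prems(1)] d[OF yV(1)] False by auto
      ultimately have "pdiff y P = 0" using less.IH by blast
      then show False using y(1) by (simp add: S'_def)
    qed
    \<comment> \<open>A coefficient of the derivative is a coefficient of \<open>P\<close> times an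
      exponent of \<open>x\<close>. As the derivative vanishes, the exponent is 0 in the
      field.\<close>
    have dvd: "p dvd Poly_Mapping.lookup m x" if m: "m \<in> Poly_Mapping.keys P" for m x
    proof (cases "Poly_Mapping.lookup m x = 0")
      case False
      then have "x \<in> S" using m by (auto simp: S_def in_keys_iff)
      then have "Poly_Mapping.lookup (pdiff x P) (m - Poly_Mapping.single x 1) = 0"
        using pdiff_0 by simp
      moreover have "m - Poly_Mapping.single x 1 + Poly_Mapping.single x 1 = m"
        using False by (intro monomial_diff_add) simp
      moreover have "Poly_Mapping.lookup (m - Poly_Mapping.single x 1) x + 1 = Poly_Mapping.lookup m x"
        using False by (simp add: lookup_minus)
      ultimately have "of_nat (Poly_Mapping.lookup m x) * Poly_Mapping.lookup P m = (0::'k)"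
        unfolding lookup_pdiff by metis
      then have "of_nat (Poly_Mapping.lookup m x) = (0::'k)" using m by (simp add: in_keys_iff)
      then show ?thesis using char_p by (simp add: of_nat_eq_0_iff_char_dvd)
    qed simp
    \<comment> \<open>\<open>rt\<close> divides all exponents by p, and \<open>R\<close> takes p-th
      roots of the coefficients, so that the p-th power of \<open>ev g R\<close> is
      \<open>ev g P\<close>.\<close>
    define rt where "rt m = Poly_Mapping.map (\<lambda>i. i div p) m" for m :: "'x \<Rightarrow>\<^sub>0 nat"
    have lookup_rt: "Poly_Mapping.lookup (rt m) x = Poly_Mapping.lookup m x div p" for m x
      unfolding rt_def by transfer (simp add: when_def)
    have rt: "p * Poly_Mapping.lookup (rt m) x = Poly_Mapping.lookup m x" if "m \<in> Poly_Mapping.keys P" for m x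
      using dvd[OF that] by (simp add: lookup_rt)
    have rt_inj: "inj_on rt (Poly_Mapping.keys P)"
      by (rule inj_onI, rule poly_mapping_eqI) (metis rt)
    define R where "R = (\<Sum>m\<in>Poly_Mapping.keys P. Poly_Mapping.single (rt m) (root (Poly_Mapping.lookup P m)))"
    have "qpow (ev g R) p = (\<Sum>m\<in>Poly_Mapping.keys P. pscale (Poly_Mapping.lookup P m) (mon g m))"
    proof -
      have "qpow (mon g (rt m)) p = mon g m" if m: "m \<in> Poly_Mapping.keys P" for m
      proof -
        obtain m' where "qpow (mon g (rt m)) p = mon g m'" "\<forall>x. Poly_Mapping.lookup m' x = p * Poly_Mapping.lookup (rt m) x"
          using qpow_mon by blast
        moreover have "m' = m" by (rule poly_mapping_eqI) (simp add: calculation(2) rt[OF m])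
        ultimately show ?thesis by simp
      qed
      then show ?thesis
        by (simp add: R_def ev_def lin_sum char_p_simps qpow_pscale)
    qed
    also have "\<dots> = ev g P" by (simp add: ev_def lin_def)
    finally have "qpow (ev g R) p = 0" using less.prems(2) by simp
    have wt_rt: "wt d (rt m) = n div p" "Poly_Mapping.keys (rt m) \<subseteq> V" if m: "m \<in> Poly_Mapping.keys P" for m
    proof -
      have keys: "Poly_Mapping.keys (rt m) = Poly_Mapping.keys m"
      proof (rule Set.set_eqI)
        show "x \<in> Poly_Mapping.keys (rt m) \<longleftrightarrow> x \<in> Poly_Mapping.keys m" for x
          using p_pos by (simp add: in_keys_iff rt[OF m, of x, symmetric])
      qed
      then have "p * wt d (rt m) = wt d m"
        using rt[OF m] by (simp add: wt_def sum_distrib_left mult.assoc[symmetric])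
      moreover have "Poly_Mapping.keys m \<subseteq> V" "wt d m = n"
        using less.prems(1) m by (auto simp: PH_def supp_in_def)
      ultimately show "wt d (rt m) = n div p" "Poly_Mapping.keys (rt m) \<subseteq> V" using keys p_pos by auto
    qed
    have R: "R \<in> PH V d (n div p)"
      unfolding R_def PH_def using wt_rt p_pos
      by (intro pm.subspace_sum subspace_supp_in single_in_supp_in) auto
    have "ev g R \<in> TJ" using TH_TJ[OF ev_TH[OF g R]] .
    then have "ev g R = 0" using inj \<open>qpow (ev g R) p = 0\<close> by blast
    moreover have "n div p < n" using False prime_gt_1_nat[OF prime_p] by simp
    ultimately have "R = 0" using less.IH R by blast
    \<comment> \<open>From \<open>R = 0\<close> back to \<open>P = 0\<close>: \<open>rt\<close> does
      not identify monomials of \<open>P\<close>, so no coefficients of \<open>R\<close> have been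
      added up.\<close>
    have "Poly_Mapping.lookup P m = 0" for m
    proof (rule ccontr)
      assume "Poly_Mapping.lookup P m \<noteq> 0"
      then have m: "m \<in> Poly_Mapping.keys P" by (simp add: in_keys_iff)
      have "Poly_Mapping.lookup R (rt m) =
        (\<Sum>m'\<in>Poly_Mapping.keys P. if m' = m then root (Poly_Mapping.lookup P m) else 0)"
        unfolding R_def lookup_sum using rt_inj m
        by (intro sum.cong refl) (auto simp: lookup_single when_def dest: inj_onD)
      then show False using \<open>R = 0\<close> m \<open>Poly_Mapping.lookup P m \<noteq> 0\<close> by (simp add: root_eq_0_iff)
    qed
    then show ?thesis by (intro poly_mapping_eqI) simp
  qed
qed

end

section \<open>Generators\<close>

context graded_quasi_shuffle
begin

text \<open>The products alone; their sums enter through \<open>pm.span\<close>.\<close>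

definition decomposables :: "nat \<Rightarrow> ('l list \<Rightarrow>\<^sub>0 'k) set" where
  "decomposables n = {qm s t | s t i j. 0 < i \<and> 0 < j \<and> i + j = n \<and> s \<in> TH i \<and> t \<in> TH j}"

lemma decomposablesI:
  "s \<in> TH i \<Longrightarrow> t \<in> TH j \<Longrightarrow> 0 < i \<Longrightarrow> 0 < j \<Longrightarrow> i + j = n \<Longrightarrow> qm s t \<in> decomposables n"
  by (auto simp: decomposables_def)

lemma decomposables_TH: "decomposables n \<subseteq> TH n"
  using qm_TH by (auto simp: decomposables_def)

lemma wdeg_pos: "w \<in> lists B \<Longrightarrow> w \<noteq> [] \<Longrightarrow> 0 < wdeg w"
  by (cases w) (auto dest: dg_pos)

text \<open>\<open>C\<close> is a basis of the span of the products, \<open>E\<close> extends it to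
  a basis of the part of degree \<open>n\<close>, and \<open>G = E - C\<close> represents a basis of
  the indecomposables. The form \<open>\<phi> x\<close> is the coordinate at \<open>x\<close>; it
  vanishes on \<open>C\<close>, hence on all products.\<close>

lemma generators_exist:
  "\<exists>G \<phi>. G \<subseteq> TH n \<and> 0 \<notin> G \<and> TH n \<subseteq> pm.span (decomposables n \<union> G) \<and>
     (\<forall>x\<in>G. indecomposable_functional (\<phi> x) \<and>
        (\<forall>w\<in>lists B. wdeg w \<noteq> n \<longrightarrow> \<phi> x (Poly_Mapping.single w 1) = 0) \<and>
        (\<forall>y\<in>G. \<phi> x y = (if x = y then 1 else 0)))"
proof -
  obtain C where C: "C \<subseteq> decomposables n" "pm.independent C" "decomposables n \<subseteq> pm.span C"
    using pm.maximal_independent_subset by blast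
  obtain E where E: "C \<subseteq> E" "E \<subseteq> TH n" "pm.independent E" "TH n \<subseteq> pm.span E"
    using pm.maximal_independent_subset_extend[of C "TH n"] C decomposables_TH by blast
  \<comment> \<open>A basis of the whole space makes coordinates linear on all tensors; the
    projection inside \<open>\<phi>\<close> confines them to degree \<open>n\<close>.\<close>
  define E' where "E' = pm.extend_basis E"
  have E': "E \<subseteq> E'" "pm.independent E'" "pm.span E' = UNIV"
    unfolding E'_def using pm.extend_basis_superset[OF E(3)] pm.independent_extend_basis[OF E(3)]
      pm.span_extend_basis[OF E(3)] by auto
  define G where "G = E - C"
  define \<phi> where "\<phi> x t = pm.representation E' (proj n t) x" for x t
  have fn: "functional (\<phi> x)" for x
    unfolding functional_def \<phi>_def
    by (simp add: pm.representation_add[OF E'(2)] pm.representation_scale[OF E'(2)] E'(3))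
  have basis: "\<phi> x y = (if x = y then 1 else 0)" if "y \<in> E" for x y
  proof -
    have "proj n y = y" "y \<in> E'" using that E' E(2) proj_TH[of y n n] by auto
    then show ?thesis by (simp add: \<phi>_def pm.representation_basis[OF E'(2)])
  qed
  have dec: "\<phi> x t = 0" if x: "x \<in> G" and t: "t \<in> decomposables n" for x t
  proof -
    have "pm.subspace {t. \<phi> x t = 0}"
      using fn[of x] unfolding pm.subspace_def functional_def
      by (auto simp: \<phi>_def pm.representation_zero)
    moreover have "C \<subseteq> {t. \<phi> x t = 0}" using basis[of _ x] x E(1) by (auto simp: G_def)
    ultimately have "pm.span C \<subseteq> {t. \<phi> x t = 0}" by (rule pm.span_minimal[rotated])
    then show ?thesis using t C(3) by blast
  qed
  have low: "\<phi> x t = 0" if "t \<in> TH m" "m \<noteq> n" for x m t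
    using that by (simp add: \<phi>_def proj_TH pm.representation_zero)
  have qs: "\<phi> x (qs u v) = 0" if "x \<in> G" "u \<in> lists B" "v \<in> lists B" "u \<noteq> []" "v \<noteq> []" for x u v
  proof (cases "wdeg u + wdeg v = n")
    case True
    have "qs u v = qm (Poly_Mapping.single u 1) (Poly_Mapping.single v 1)" by simp
    then have "qs u v \<in> decomposables n"
      using decomposablesI[OF single_TH[of u 1] single_TH[of v 1] wdeg_pos wdeg_pos True] that by simp
    then show ?thesis using dec that by blast
  next
    case False
    then show ?thesis using low[OF qs_TH] that by blast
  qed
  have "indecomposable_functional (\<phi> x)" if "x \<in> G" for x
    unfolding indecomposable_functional_def using fn qs that by blast
  moreover have "\<phi> x (Poly_Mapping.single w 1) = 0" if "w \<in> lists B" "wdeg w \<noteq> n" for x w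
    using low[OF single_TH] that by blast
  moreover have "G \<subseteq> TH n" "0 \<notin> G" using E pm.dependent_zero by (auto simp: G_def)
  moreover have "TH n \<subseteq> pm.span (decomposables n \<union> G)"
    using E(4) C(1) pm.span_mono[of E "decomposables n \<union> G"] by (auto simp: G_def)
  ultimately show ?thesis using basis E(1) by (intro exI[of _ G] exI[of _ \<phi>]) (auto simp: G_def)
qed

text \<open>Both factors of a decomposable have smaller degree and are polynomials in the generators
  by induction.\<close>

lemma generates:
  assumes G: "\<And>n. 0 < n \<Longrightarrow> TH n \<subseteq> pm.span (decomposables n \<union> g ` {x \<in> V. d x = n})"
  shows "TH n \<subseteq> ev g ` PH V d n"
proof (induction n rule: less_induct)
  case (less n)
  show ?case
  proof (cases "n = 0")
    case True
    show ?thesis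
    proof
      fix t assume "t \<in> TH n"
      then have "t = ev g (Poly_Mapping.single 0 (Poly_Mapping.lookup t []))"
        using TH_0 True by simp
      moreover have "Poly_Mapping.single 0 (Poly_Mapping.lookup t []) \<in> PH V d n"
        using True by (simp add: PH_def)
      ultimately show "t \<in> ev g ` PH V d n" by blast
    qed
  next
    case False
    have sub: "pm.subspace (ev g ` PH V d n)"
    proof -
      have "pm.subspace (PH V d n :: (_ \<Rightarrow>\<^sub>0 'k) set)" by (simp add: PH_def)
      note PH = this
      show ?thesis
      proof (rule pm.subspaceI)
        show "0 \<in> ev g ` PH V d n"
          using pm.subspace_0[OF PH] by (intro image_eqI[of _ _ 0]) auto
        show "s + t \<in> ev g ` PH V d n" if st: "s \<in> ev g ` PH V d n" "t \<in> ev g ` PH V d n" for s t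
        proof -
          obtain P Q where "P \<in> PH V d n" "s = ev g P" "Q \<in> PH V d n" "t = ev g Q"
            using st by blast
          then show ?thesis
            using pm.subspace_add[OF PH] by (intro image_eqI[of _ _ "P + Q"]) auto
        qed
        show "pscale c s \<in> ev g ` PH V d n" if s: "s \<in> ev g ` PH V d n" for c s
        proof -
          obtain P where "P \<in> PH V d n" "s = ev g P" using s by blast
          then show ?thesis
            using pm.subspace_scale[OF PH] by (intro image_eqI[of _ _ "pscale c P"]) auto
        qed
      qed
    qed
    have "decomposables n \<union> g ` {x \<in> V. d x = n} \<subseteq> ev g ` PH V d n"
    proof safe
      fix s assume "s \<in> decomposables n"
      then obtain a b i j where s: "s = qm a b" "0 < i" "0 < j" "i + j = n" "a \<in> TH i" "b \<in> TH j"
        by (auto simp: decomposables_def)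
      have "a \<in> ev g ` PH V d i" "b \<in> ev g ` PH V d j"
        using s less.IH[of i] less.IH[of j] by auto
      then obtain P Q where PQ: "P \<in> PH V d i" "a = ev g P" "Q \<in> PH V d j" "b = ev g Q"
        by blast
      have "P * Q \<in> PH V d n"
        unfolding PH_def supp_in_def
      proof (intro CollectI subsetI)
        fix m assume "m \<in> Poly_Mapping.keys (P * Q)"
        then obtain m1 m2 where "m = m1 + m2" "m1 \<in> Poly_Mapping.keys P" "m2 \<in> Poly_Mapping.keys Q"
          using keys_mult[of P Q] by blast
        then show "Poly_Mapping.keys m \<subseteq> V \<and> wt d m = n"
          using PQ(1,3) s(4) by (auto simp: PH_def supp_in_def keys_add_nat wt_add)
      qed
      then show "s \<in> ev g ` PH V d n" using s PQ by (metis ev_mult image_eqI)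
    next
      fix x assume "x \<in> V" "n = d x"
      then have "Poly_Mapping.single (Poly_Mapping.single x (Suc 0)) 1 \<in> PH V d (d x)"
        by (auto simp: PH_def intro!: single_in_supp_in)
      moreover have "g x = ev g (Poly_Mapping.single (Poly_Mapping.single x (Suc 0)) 1)" by simp
      ultimately show "g x \<in> ev g ` PH V d (d x)" by blast
    qed
    then show ?thesis using G[of n] False pm.span_minimal[OF _ sub] by blast
  qed
qed

end

section \<open>Reducedness of polynomial rings in characteristic p\<close>

lemma frobenius_comm_ring_1:
  fixes x y :: "'a::comm_ring_1"
  assumes p: "prime p" "of_nat p = (0::'a)"
  shows "(x + y) ^ p = x ^ p + y ^ p"
proof -
  interpret cring "ring_of_type_algebra :: 'a ring" by (rule cring_from_type_algebra)
  have pow: "z [^]\<^bsub>ring_of_type_algebra\<^esub> n = z ^ n" for z :: 'a and n :: nat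
    by (induction n) (auto simp: ring_of_type_algebra_def nat_pow_def mult.commute)
  have "[n] \<cdot>\<^bsub>ring_of_type_algebra\<^esub> z = of_nat n * z" for z :: 'a and n :: nat
  proof (induction n)
    case (Suc n)
    have "[Suc n] \<cdot>\<^bsub>ring_of_type_algebra\<^esub> z = [n] \<cdot>\<^bsub>ring_of_type_algebra\<^esub> z + z"
      using add.nat_pow_Suc[of n z] by (simp add: ring_of_type_algebra_def)
    then show ?case using Suc by (simp add: algebra_simps)
  next
    case 0
    show ?case using add.nat_pow_0[of z] by (simp add: ring_of_type_algebra_def)
  qed
  then show ?thesis
    using frobenius_add[OF p(1), of x y] p(2) by (simp add: pow) (simp add: ring_of_type_algebra_def)
qed

text \<open>The iterated sum is n times the exponent vector \<open>m\<close>;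
  \<open>funpow_add_monomial\<close> reads off its entries.\<close>

lemma single_power: "Poly_Mapping.single m c ^ n = Poly_Mapping.single (((+) m ^^ n) 0) (c ^ n)"
  for m :: "'x \<Rightarrow>\<^sub>0 nat" and c :: "'k::field"
  by (induction n) (simp_all add: mult_single)

lemma funpow_add_monomial: "Poly_Mapping.lookup (((+) m ^^ n) 0) x = n * Poly_Mapping.lookup m x"
  for m :: "'x \<Rightarrow>\<^sub>0 nat"
  by (induction n) (simp_all add: lookup_add)

text \<open>The p-th power is additive and sends different monomials to different monomials, so the
  p-th power of each coefficient of \<open>P\<close> reappears as a coefficient of
  \<open>P ^ p\<close>.\<close>

lemma polynomial_reduced:
  fixes P :: "('x \<Rightarrow>\<^sub>0 nat) \<Rightarrow>\<^sub>0 'k::field"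
  assumes p: "prime p" "of_nat p = (0::'k)" and P: "P ^ p = 0"
  shows "P = 0"
proof (rule poly_mapping_eqI)
  fix m
  define q where "q m = ((+) m ^^ p) 0" for m :: "'x \<Rightarrow>\<^sub>0 nat"
  have p0: "p > 0" using p(1) prime_gt_0_nat by blast
  have "inj q"
  proof (rule injI, rule poly_mapping_eqI)
    fix m n x assume "q m = q n"
    then show "Poly_Mapping.lookup m x = Poly_Mapping.lookup n x"
      using funpow_add_monomial[where x = x and n = p] p0 unfolding q_def by (metis mult_cancel1 neq0_conv)
  qed
  have of_nat_p: "of_nat p = (0 :: ('x \<Rightarrow>\<^sub>0 nat) \<Rightarrow>\<^sub>0 'k)"
    using p(2) by (metis single_of_nat single_zero)
  have sum: "(\<Sum>i\<in>I. f i) ^ p = (\<Sum>i\<in>I. f i ^ p)" for I :: "('x \<Rightarrow>\<^sub>0 nat) set" and f :: "_ \<Rightarrow> ('x \<Rightarrow>\<^sub>0 nat) \<Rightarrow>\<^sub>0 'k"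
    using p0 by (induction I rule: infinite_finite_induct) (auto simp: frobenius_comm_ring_1[OF p(1) of_nat_p] zero_power)
  have "P = (\<Sum>n\<in>Poly_Mapping.keys P. Poly_Mapping.single n (Poly_Mapping.lookup P n))"
    using lin_single_id[of P, unfolded lin_def] by simp
  then have "P ^ p = (\<Sum>n\<in>Poly_Mapping.keys P. Poly_Mapping.single (q n) (Poly_Mapping.lookup P n ^ p))"
    using sum unfolding q_def by (metis (no_types, lifting) single_power sum.cong)
  then have "Poly_Mapping.lookup (P ^ p) (q m) =
      (\<Sum>n\<in>Poly_Mapping.keys P. if n = m then Poly_Mapping.lookup P m ^ p else 0)"
    using \<open>inj q\<close> by (auto simp: lookup_sum lookup_single when_def inj_eq intro!: sum.cong)
  then show "Poly_Mapping.lookup P m = Poly_Mapping.lookup 0 m"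
    using P by (auto simp: in_keys_iff split: if_splits)
qed

section \<open>Polynomial generators of the ring of words\<close>

context graded_quasi_shuffle_char
begin

text \<open>The map \<iota> renames the generators: \<open>is_polynomial_algebra\<close> takes its
  variables from the type of the elements of the algebra, and for the quasi-shuffle algebra these
  are cosets, not tensors.\<close>

lemma polynomial_generators:
  fixes \<iota> :: "('l list \<Rightarrow>\<^sub>0 'k) \<Rightarrow> 'x"
  assumes inj: "\<And>t. t \<in> TJ \<Longrightarrow> qpow t p = 0 \<Longrightarrow> t = 0" and \<iota>: "inj_on \<iota> TJ"
  obtains V d g where "\<And>x. x \<in> V \<Longrightarrow> 0 < d x"
    "\<And>n. ev g ` PH V d n = TH n" "ev g ` supp_in {m. Poly_Mapping.keys m \<subseteq> V} = TJ"
    "inj_on (ev g) (supp_in {m. Poly_Mapping.keys m \<subseteq> (V :: 'x set)})"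
proof -
  obtain G \<phi> where G: "\<And>n. G n \<subseteq> TH n" "\<And>n. 0 \<notin> G n" "\<And>n. TH n \<subseteq> pm.span (decomposables n \<union> G n)"
    and \<phi>: "\<And>n x. x \<in> G n \<Longrightarrow> indecomposable_functional (\<phi> n x)"
      "\<And>n x w. x \<in> G n \<Longrightarrow> w \<in> lists B \<Longrightarrow> wdeg w \<noteq> n \<Longrightarrow> \<phi> n x (Poly_Mapping.single w 1) = 0"
      "\<And>n x y. x \<in> G n \<Longrightarrow> y \<in> G n \<Longrightarrow> \<phi> n x y = (if x = y then 1 else 0)"
    using generators_exist by metis
  define V where "V = \<iota> ` (\<Union>n\<in>{0<..}. G n)"
  define g where "g = inv_into TJ \<iota>"
  \<comment> \<open>A generator is nonzero and therefore homogeneous of one degree only, so on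
    \<open>V\<close> the choice is forced (\<open>d_eq\<close>).\<close>
  define d where "d x = (SOME n. g x \<in> G n \<and> 0 < n)" for x
  have g_\<iota>: "g (\<iota> t) = t" if "t \<in> G n" for t n
    using that G(1) TH_TJ \<iota> unfolding g_def by (metis inv_into_f_f subsetD)
  have d: "g x \<in> G (d x)" "0 < d x" if "x \<in> V" for x
  proof -
    have "\<exists>n. g x \<in> G n \<and> 0 < n" using that g_\<iota> by (auto simp: V_def)
    from someI_ex[OF this] show "g x \<in> G (d x)" "0 < d x" by (simp_all add: d_def)
  qed
  have d_eq: "d x = n" if "x \<in> V" "g x \<in> G n" for x n
    using d(1)[OF that(1)] that(2) G(1,2) TH_disjoint by (metis subsetD)
  have g_inj: "x = y" if "x \<in> V" "y \<in> V" "g x = g y" for x y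
    using that g_\<iota> by (auto simp: V_def)
  have gTH: "g x \<in> TH (d x)" if "x \<in> V" for x using d[OF that] G by blast
  have monTH: "mon g m \<in> TH (wt d m)" if "Poly_Mapping.keys m \<subseteq> V" for m
    using mon_TH[of V g d m] gTH that by blast
  have surj: "ev g ` PH V d n = TH n" for n
  proof
    show "ev g ` PH V d n \<subseteq> TH n" using ev_TH[OF gTH] by auto
    show "TH n \<subseteq> ev g ` PH V d n"
    proof (rule generates)
      fix n :: nat assume "0 < n"
      then have "G n \<subseteq> g ` {x \<in> V. d x = n}"
        using d_eq g_\<iota> by (force simp: V_def image_iff)
      then show "TH n \<subseteq> pm.span (decomposables n \<union> g ` {x \<in> V. d x = n})"
        using G(3)[of n] pm.span_mono[of "decomposables n \<union> G n" "decomposables n \<union> g ` {x \<in> V. d x = n}"] by blast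
    qed
  qed
  have hom_inj: "P = 0" if "P \<in> PH V d n" "ev g P = 0" for P n
  proof (rule ev_eq_0[where V = V and g = g and d = d and \<phi> = "\<lambda>x. \<phi> (d x) (g x)", OF inj _ gTH _ _ _ that])
    show "\<phi> (d x) (g x) (g y) = (if x = y then 1 else 0)" if "x \<in> V" "y \<in> V" "d x = d y" for x y
      using \<phi>(3) d(1)[OF that(1)] d(1)[OF that(2)] g_inj that by auto
  qed (use d \<phi> in auto)
  let ?K = "supp_in {m. Poly_Mapping.keys m \<subseteq> V} :: (('x \<Rightarrow>\<^sub>0 nat) \<Rightarrow>\<^sub>0 'k) set"
  have PH_K: "PH V d n \<subseteq> ?K" for n
    by (auto simp: PH_def supp_in_def)
  have K: "pm.subspace ?K" by simp
  have ker: "P = 0" if P: "P \<in> ?K" "ev g P = 0" for P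
  proof -
    \<comment> \<open>Substitution preserves degrees, so the homogeneous parts of a relation are
      relations themselves.\<close>
    define part where "part n = lin (\<lambda>m. if wt d m = n then Poly_Mapping.single m 1 else 0) P" for n
    have lookup_part: "Poly_Mapping.lookup (part n) m = (if wt d m = n then Poly_Mapping.lookup P m else 0)" for n m
      unfolding part_def by (induction P rule: pm_induct) (auto simp: lookup_add lookup_single when_def)
    have PH: "part n \<in> PH V d n" for n
      using P(1) unfolding part_def PH_def
      by (intro lin_in_subspace) (auto simp: pm.subspace_0 dest: supp_in_keys)
    have "ev g (part n) = proj n (ev g P)" for n
      using P(1) unfolding part_def
    proof (induction rule: supp_in_induct)
      case (single m)
      then show ?case using monTH[of m] by (auto simp: proj_TH)
    qed auto
    then have "part n = 0" for n using hom_inj[OF PH] P(2) by simp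
    then show ?thesis using lookup_part by (intro poly_mapping_eqI) (metis lookup_zero)
  qed
  have "inj_on (ev g) ?K"
  proof (rule inj_onI)
    fix P Q assume PQ: "P \<in> ?K" "Q \<in> ?K" "ev g P = ev g Q"
    have "ev g (P - Q) = 0" using PQ(3) by (simp add: ev_def)
    then show "P = Q" using ker[OF pm.subspace_diff[OF K PQ(1,2)]] by simp
  qed
  moreover have "ev g ` ?K = TJ"
  proof
    show "ev g ` ?K \<subseteq> TJ"
    proof safe
      fix P assume "P \<in> ?K"
      then show "ev g P \<in> TJ"
        unfolding ev_def using TH_TJ[OF monTH]
        by (intro lin_in_subspace) (auto simp: supp_in_def)
    qed
    show "TJ \<subseteq> ev g ` ?K"
    proof
      fix t assume "t \<in> TJ"
      then obtain N where N: "t = (\<Sum>n\<in>N. proj n t)" using TJ_decomp by blast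
      have "\<exists>P. P \<in> PH V d n \<and> ev g P = proj n t" for n
        using surj[of n] proj_in_TH[of n t] by (metis imageE)
      then obtain P where P: "\<And>n. P n \<in> PH V d n" "\<And>n. ev g (P n) = proj n t" by metis
      have "t = ev g (\<Sum>n\<in>N. P n)" by (subst N) (simp add: ev_def lin_sum P(2)[unfolded ev_def])
      moreover have "(\<Sum>n\<in>N. P n) \<in> ?K" using P(1) PH_K by (intro pm.subspace_sum K) auto
      ultimately show "t \<in> ev g ` ?K" by blast
    qed
  qed
  ultimately show ?thesis using that[of V d g] d(2) surj by blast
qed

end

section \<open>Coordinates in a basis of the positive degree part\<close>

lemma ring_of_type_algebra_simps [simp]:
  "carrier (ring_of_type_algebra :: 'k::field ring) = UNIV"
  "x \<oplus>\<^bsub>ring_of_type_algebra\<^esub> y = x + y" "x \<otimes>\<^bsub>ring_of_type_algebra\<^esub> y = x * y"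
  "\<one>\<^bsub>ring_of_type_algebra\<^esub> = (1::'k)" "\<zero>\<^bsub>ring_of_type_algebra\<^esub> = (0::'k)"
  by (simp_all add: ring_of_type_algebra_def)

lemma map_mult_eq_pscale: "(\<lambda>c. Poly_Mapping.map ((*) c)) = pscale"
  by (intro ext) (simp add: pscale_def)

context connected_comm_graded_algebra
begin

lemma homog_carrier: "x \<in> homog A n \<Longrightarrow> x \<in> carrier A"
  using homog_subset by blast

lemma smult_simps:
  "x \<in> carrier A \<Longrightarrow> c \<odot> x \<in> carrier A"
  "x \<in> carrier A \<Longrightarrow> (c + d) \<odot> x = c \<odot> x \<oplus> d \<odot> x"
  "x \<in> carrier A \<Longrightarrow> y \<in> carrier A \<Longrightarrow> c \<odot> (x \<oplus> y) = c \<odot> x \<oplus> c \<odot> y"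
  "x \<in> carrier A \<Longrightarrow> (c * d) \<odot> x = c \<odot> (d \<odot> x)"
  "x \<in> carrier A \<Longrightarrow> 1 \<odot> x = x"
  "x \<in> carrier A \<Longrightarrow> 0 \<odot> x = \<zero>"
  "c \<odot> \<zero> = \<zero>"
  using smult_closed[of c x] smult_l_distr[of c d x] smult_r_distr[of c x y] smult_assoc1[of c d x]
    smult_one[of x] smult_l_null[of x] smult_r_null[of c] by simp_all

lemma homog_finsum:
  "(\<And>i. i \<in> I \<Longrightarrow> f i \<in> homog A n) \<Longrightarrow> (\<Oplus>i\<in>I. f i) \<in> homog A n"
proof (induction I rule: infinite_finite_induct)
  case (insert i I)
  then show ?case
    using homog_carrier by (subst finsum_insert) (auto intro!: homog_add)
qed (auto simp: homog_zero finsum_infinite)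

definition lcomb :: "'a set \<Rightarrow> ('a \<Rightarrow> 'k) \<Rightarrow> 'a" where
  "lcomb S c = (\<Oplus>b\<in>S. c b \<odot> b)"

context
  fixes S :: "'a set" and n :: nat
  assumes S: "finite S" "S \<subseteq> homog A n"
begin

lemma lcomb_homog: "lcomb S c \<in> homog A n"
  unfolding lcomb_def using S by (intro homog_finsum homog_smult) auto

lemma lcomb_add: "lcomb S (\<lambda>b. c b + d b) = lcomb S c \<oplus> lcomb S d"
proof -
  have S_carrier: "b \<in> carrier A" if "b \<in> S" for b using that S homog_carrier by blast
  have "lcomb S (\<lambda>b. c b + d b) = (\<Oplus>b\<in>S. c b \<odot> b \<oplus> d b \<odot> b)"
    unfolding lcomb_def by (intro finsum_cong') (auto simp: S_carrier smult_simps)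
  also have "\<dots> = lcomb S c \<oplus> lcomb S d"
    unfolding lcomb_def by (intro finsum_addf) (auto simp: S_carrier smult_simps)
  finally show ?thesis .
qed

lemma lcomb_scale: "lcomb S (\<lambda>b. e * c b) = e \<odot> lcomb S c"
proof -
  have S_carrier: "b \<in> carrier A" if "b \<in> S" for b using that S homog_carrier by blast
  have "e \<odot> lcomb S c = (\<Oplus>b\<in>S. e \<odot> (c b \<odot> b))"
    unfolding lcomb_def using S_carrier by (intro finsum_smult_ldistr S) (auto simp: smult_simps)
  also have "\<dots> = lcomb S (\<lambda>b. e * c b)"
    unfolding lcomb_def by (intro finsum_cong') (auto simp: S_carrier smult_simps)
  finally show ?thesis by simp
qed

end

text \<open>A spanning set of least size is independent: a relation with nonzero coefficient at
  \<open>b0\<close> would allow \<open>b0\<close> to be dropped.\<close>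

lemma homog_basis_exists:
  "\<exists>S. finite S \<and> S \<subseteq> homog A n \<and> (\<forall>x\<in>homog A n. \<exists>c. x = lcomb S c) \<and>
     (\<forall>c. lcomb S c = \<zero> \<longrightarrow> (\<forall>b\<in>S. c b = 0))"
proof -
  define spans where "spans S \<longleftrightarrow> finite S \<and> S \<subseteq> homog A n \<and> (\<forall>x\<in>homog A n. \<exists>c. x = lcomb S c)" for S
  have "\<exists>S. spans S"
    using finite_type[of n] unfolding spans_def lcomb_def by simp
  then obtain S where S: "spans S" and least: "\<And>S'. spans S' \<Longrightarrow> card S \<le> card S'"
    using ex_has_least_nat[of spans _ card] by metis
  have fin: "finite S" "S \<subseteq> homog A n"
    using S by (auto simp: spans_def)
  have "c b0 = 0" if c: "lcomb S c = \<zero>" and b0: "b0 \<in> S" for c b0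
  proof (rule ccontr)
    assume "c b0 \<noteq> 0"
    have "spans (S - {b0})"
      unfolding spans_def
    proof (intro conjI ballI)
      fix x assume "x \<in> homog A n"
      then obtain e where e: "x = lcomb S e" using S by (auto simp: spans_def)
      \<comment> \<open>The multiple of the relation that cancels the coefficient at
        \<open>b0\<close> is subtracted; the element represented stays the same.\<close>
      define e' where "e' b = e b + (- (e b0 / c b0)) * c b" for b
      have "lcomb S e' = x \<oplus> (- (e b0 / c b0)) \<odot> \<zero>"
        unfolding e'_def by (simp only: lcomb_add[OF fin] lcomb_scale[OF fin] c e)
      then have "lcomb S e' = x"
        using \<open>x \<in> homog A n\<close> homog_carrier by (simp add: smult_simps)
      moreover have "lcomb S e' = lcomb (S - {b0}) e'"
        unfolding lcomb_def
      proof (rule add.finprod_mono_neutral_cong_right)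
        show "e' i \<odot> i = \<zero>" if "i \<in> S - (S - {b0})" for i
          using that \<open>c b0 \<noteq> 0\<close> fin b0 homog_carrier by (auto simp: e'_def smult_simps)
      qed (use fin homog_carrier in \<open>auto simp: smult_simps\<close>)
      ultimately show "\<exists>c. x = lcomb (S - {b0}) c" by metis
    qed (use fin in auto)
    then have "card S \<le> card (S - {b0})" by (rule least)
    then show False using b0 fin(1) card_Diff1_less[of S b0] by simp
  qed
  then show ?thesis using S unfolding spans_def by blast
qed

definition basis :: "nat \<Rightarrow> 'a set" where
  "basis n = (SOME S. finite S \<and> S \<subseteq> homog A n \<and> (\<forall>x\<in>homog A n. \<exists>c. x = lcomb S c) \<and>
     (\<forall>c. lcomb S c = \<zero> \<longrightarrow> (\<forall>b\<in>S. c b = 0)))"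

lemma basis:
  "finite (basis n)" "basis n \<subseteq> homog A n" "\<And>x. x \<in> homog A n \<Longrightarrow> \<exists>c. x = lcomb (basis n) c"
  "\<And>c b. lcomb (basis n) c = \<zero> \<Longrightarrow> b \<in> basis n \<Longrightarrow> c b = 0"
  using someI_ex[OF homog_basis_exists[of n]] unfolding basis_def by blast+

text \<open>On homogeneous elements the chosen coefficients are unique by independence
  (\<open>coord_lcomb\<close>). The keys carry the degree, so they are letters again.\<close>

definition coord :: "nat \<times> 'a \<Rightarrow> (nat \<times> 'a \<Rightarrow>\<^sub>0 'k)" where
  "coord l = (\<Sum>b\<in>basis (fst l). Poly_Mapping.single (fst l, b)
     ((SOME c. snd l = lcomb (basis (fst l)) c) b))"

lemma coord_lcomb: "coord (n, lcomb (basis n) c) = (\<Sum>b\<in>basis n. Poly_Mapping.single (n, b) (c b))"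
proof -
  define d where "d = (SOME d. lcomb (basis n) c = lcomb (basis n) d)"
  have d: "lcomb (basis n) c = lcomb (basis n) d"
    unfolding d_def by (rule someI[of _ c]) simp
  have carr: "lcomb (basis n) c \<in> carrier A" using lcomb_homog[OF basis(1,2)] homog_carrier by blast
  \<comment> \<open>The difference of the two coefficient families represents 0, so they agree by
    independence.\<close>
  have "lcomb (basis n) (\<lambda>b. c b + - 1 * d b) = lcomb (basis n) c \<oplus> (- 1) \<odot> lcomb (basis n) c"
    by (simp only: lcomb_add[OF basis(1,2)] lcomb_scale[OF basis(1,2)] d)
  also have "\<dots> = (1 + - 1) \<odot> lcomb (basis n) c"
    using carr by (simp only: smult_simps(2,5))
  also have "\<dots> = \<zero>"
    using carr by (simp add: smult_simps)
  finally have "c b = d b" if "b \<in> basis n" for b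
    using basis(4)[OF _ that, of "\<lambda>b. c b + - 1 * d b"] by simp
  then show ?thesis unfolding coord_def d_def by simp
qed

lemma coord_add:
  assumes "x \<in> homog A n" "y \<in> homog A n"
  shows "coord (n, x \<oplus> y) = coord (n, x) + coord (n, y)"
proof -
  obtain c d where "x = lcomb (basis n) c" "y = lcomb (basis n) d"
    using assms basis(3) by metis
  then show ?thesis
    using lcomb_add[OF basis(1,2), of n c d] coord_lcomb[of n "\<lambda>b. c b + d b"]
    by (simp add: coord_lcomb single_add sum.distrib)
qed

lemma coord_smult:
  assumes "x \<in> homog A n"
  shows "coord (n, e \<odot> x) = pscale e (coord (n, x))"
proof -
  obtain c where "x = lcomb (basis n) c"
    using assms basis(3) by metis
  then show ?thesis
    using lcomb_scale[OF basis(1,2), of n e c] coord_lcomb[of n "\<lambda>b. e * c b"]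
    by (simp add: coord_lcomb pm.scale_sum_right)
qed

lemma coord_zero [simp]: "coord (n, \<zero>) = 0"
  using coord_smult[OF homog_zero, of n 0] by (simp add: smult_simps homog_carrier[OF homog_zero])

lemma coord_finsum:
  "(\<And>i. i \<in> I \<Longrightarrow> f i \<in> homog A n) \<Longrightarrow> coord (n, \<Oplus>i\<in>I. f i) = (\<Sum>i\<in>I. coord (n, f i))"
proof (induction I rule: infinite_finite_induct)
  case (insert i I)
  then show ?case
    using homog_carrier by (subst finsum_insert) (auto simp: coord_add homog_finsum)
qed (auto simp: finsum_infinite)

lemma coord_basis:
  assumes "b \<in> basis n"
  shows "coord (n, b) = Poly_Mapping.single (n, b) 1"
proof -
  have b: "b \<in> carrier A" using assms basis(2) homog_carrier by blast
  have "lcomb (basis n) (\<lambda>b'. if b' = b then 1 else 0) = (\<Oplus>b'\<in>basis n. if b' = b then b else \<zero>)"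
    unfolding lcomb_def using basis(2)[of n] homog_carrier b
    by (intro finsum_cong') (auto intro!: smult_simps)
  also have "\<dots> = b"
    using add.finprod_singleton_swap[of b "basis n" "\<lambda>_. b"] assms basis(1) b by simp
  finally have "coord (n, b) = coord (n, lcomb (basis n) (\<lambda>b'. if b' = b then 1 else 0))" by simp
  also have "\<dots> = (\<Sum>b'\<in>basis n. if b' = b then Poly_Mapping.single (n, b) 1 else 0)"
    unfolding coord_lcomb by (intro sum.cong) auto
  also have "\<dots> = Poly_Mapping.single (n, b) 1" using basis(1) assms by simp
  finally show ?thesis .
qed

lemma coord_inj:
  assumes "x \<in> homog A n" "coord (n, x) = 0"
  shows "x = \<zero>"
proof -
  obtain c where c: "x = lcomb (basis n) c"
    using assms basis(3) by metis
  have "c b = 0" if "b \<in> basis n" for b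
  proof -
    have "c b = Poly_Mapping.lookup (coord (n, x)) (n, b)"
      unfolding c coord_lcomb lookup_sum using that basis(1) by (simp add: lookup_single when_def)
    then show ?thesis using assms by simp
  qed
  then have "x = (\<Oplus>b\<in>basis n. \<zero>)"
    unfolding c lcomb_def using basis(2)[of n] homog_carrier by (intro finsum_cong') (auto intro!: smult_simps)
  then show ?thesis by simp
qed

definition basis_letters :: "(nat \<times> 'a) set" where
  "basis_letters = {(n, b). 0 < n \<and> b \<in> basis n}"

lemma basis_letters_subset: "basis_letters \<subseteq> letters A"
  using basis(2) by (auto simp: basis_letters_def letters_def)

lemma coord_supp: "0 < n \<Longrightarrow> coord (n, x) \<in> supp_in {l \<in> basis_letters. fst l = n}"
  unfolding coord_def by (intro pm.subspace_sum subspace_supp_in single_in_supp_in) (auto simp: basis_letters_def)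

lemma coord_surj:
  assumes "v \<in> supp_in {l \<in> basis_letters. fst l = n}"
  shows "\<exists>x\<in>homog A n. v = coord (n, x)"
proof -
  have "v = (\<Sum>b\<in>basis n. Poly_Mapping.single (n, b) (Poly_Mapping.lookup v (n, b)))"
  proof (rule poly_mapping_eqI)
    fix l :: "nat \<times> 'a"
    obtain m b where l: "l = (m, b)" by (cases l)
    show "Poly_Mapping.lookup v l = Poly_Mapping.lookup (\<Sum>b\<in>basis n. Poly_Mapping.single (n, b) (Poly_Mapping.lookup v (n, b))) l"
    proof (cases "m = n \<and> b \<in> basis n")
      case True
      then show ?thesis using basis(1) l by (simp add: lookup_sum lookup_single when_def)
    next
      case False
      then have "l \<notin> Poly_Mapping.keys v" using assms l by (auto simp: supp_in_def basis_letters_def)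
      then show ?thesis using False l by (auto simp: lookup_sum lookup_single when_def in_keys_iff intro!: sum.neutral)
    qed
  qed
  then have "v = coord (n, lcomb (basis n) (\<lambda>b. Poly_Mapping.lookup v (n, b)))"
    by (simp add: coord_lcomb)
  then show ?thesis using lcomb_homog[OF basis(1,2)] by blast
qed

text \<open>The value 0 outside \<open>basis_letters\<close> makes the laws of
  \<open>quasi_shuffle\<close>, which are required for all letters of the type, hold there
  trivially.\<close>

definition mu :: "nat \<times> 'a \<Rightarrow> nat \<times> 'a \<Rightarrow> (nat \<times> 'a \<Rightarrow>\<^sub>0 'k)" where
  "mu l l' = (if l \<in> basis_letters \<and> l' \<in> basis_letters then coord (fst l + fst l', snd l \<otimes> snd l') else 0)"

text \<open>Positive degrees make the keys of both factors basis letters, where \<open>mu\<close> is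
  the product of A in coordinates.\<close>

lemma coord_mult:
  assumes x: "x \<in> homog A m" and y: "y \<in> homog A n" and pos: "0 < m" "0 < n"
  shows "coord (m + n, x \<otimes> y) = bilin mu (coord (m, x)) (coord (n, y))"
proof -
  obtain c where c: "x = lcomb (basis m) c" using x basis(3) by metis
  obtain d where d: "y = lcomb (basis n) d" using y basis(3) by metis
  have bm: "b \<in> homog A m" "b \<in> carrier A" if "b \<in> basis m" for b
    using that basis(2) homog_carrier by blast+
  have bn: "b \<in> homog A n" "b \<in> carrier A" if "b \<in> basis n" for b
    using that basis(2) homog_carrier by blast+
  have carr: "x \<in> carrier A" "y \<in> carrier A" using x y homog_carrier by auto
  have b_y: "coord (m + n, b \<otimes> y) = (\<Sum>b'\<in>basis n. pscale (d b') (coord (m + n, b \<otimes> b')))" if b: "b \<in> basis m" for b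
  proof -
    have "b \<otimes> y = (\<Oplus>b'\<in>basis n. b \<otimes> (d b' \<odot> b'))"
      unfolding d lcomb_def using bm bn b basis(1) by (intro finsum_rdistr) (auto simp: smult_simps)
    also have "\<dots> = (\<Oplus>b'\<in>basis n. d b' \<odot> (b \<otimes> b'))"
      using bm bn b by (intro finsum_cong') (auto simp: smult_simps smult_mult_right)
    finally have "coord (m + n, b \<otimes> y) = (\<Sum>b'\<in>basis n. coord (m + n, d b' \<odot> (b \<otimes> b')))"
      using bm bn b by (simp add: coord_finsum homog_mult homog_smult)
    then show ?thesis using bm bn b by (simp add: coord_smult homog_mult)
  qed
  have "x \<otimes> y = (\<Oplus>b\<in>basis m. (c b \<odot> b) \<otimes> y)"
    unfolding c lcomb_def using bm carr basis(1) by (intro finsum_ldistr) (auto simp: smult_simps)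
  also have "\<dots> = (\<Oplus>b\<in>basis m. c b \<odot> (b \<otimes> y))"
    using bm carr by (intro finsum_cong') (auto simp: smult_simps smult_mult_left)
  finally have "coord (m + n, x \<otimes> y) = (\<Sum>b\<in>basis m. coord (m + n, c b \<odot> (b \<otimes> y)))"
    using bm y by (simp add: coord_finsum homog_mult homog_smult)
  also have "\<dots> = (\<Sum>b\<in>basis m. pscale (c b) (\<Sum>b'\<in>basis n. pscale (d b') (coord (m + n, b \<otimes> b'))))"
    using bm y by (simp add: coord_smult homog_mult b_y)
  also have "\<dots> = (\<Sum>b\<in>basis m. \<Sum>b'\<in>basis n. pscale (c b * d b') (mu (m, b) (n, b')))"
    using pos by (simp add: pm.scale_sum_right mu_def basis_letters_def)
  also have "\<dots> = bilin mu (coord (m, x)) (coord (n, y))"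
    unfolding c d coord_lcomb by (simp add: bilin_sum) (rule sum.swap)
  finally show ?thesis .
qed

section \<open>Reduction of tensors to words in the basis\<close>

text \<open>Multilinear expansion of a tensor into words in the basis; its linear extension
  \<open>reduce\<close> is the normal form modulo the relations.\<close>

primrec word_coord :: "'a word \<Rightarrow> ('a word \<Rightarrow>\<^sub>0 'k)" where
  "word_coord [] = wone"
| "word_coord (l # w) = pre (coord l) (word_coord w)"

definition reduce :: "('a word \<Rightarrow>\<^sub>0 'k) \<Rightarrow> ('a word \<Rightarrow>\<^sub>0 'k)" where
  "reduce = lin word_coord"

lemma reduce_simps [simp]:
  "reduce (s + t) = reduce s + reduce t" "reduce (pscale c t) = pscale c (reduce t)"
  "reduce (s - t) = reduce s - reduce t" "reduce 0 = 0"
  "reduce (Poly_Mapping.single w c) = pscale c (word_coord w)"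
  by (simp_all add: reduce_def)

lemma multilinear_relations_eq: "multilinear_relations A = pm.span (multilinear_relators A)"
  by (simp add: multilinear_relations_def map_mult_eq_pscale)

lemma word_coord_multilinear:
  assumes "a \<in> homog A n" "b \<in> homog A n"
  shows "word_coord (u @ (n, a \<oplus> b) # v) = word_coord (u @ (n, a) # v) + word_coord (u @ (n, b) # v)"
    and "word_coord (u @ (n, c \<odot> a) # v) = pscale c (word_coord (u @ (n, a) # v))"
  using assms by (induction u) (auto simp: coord_add coord_smult)

lemma reduce_relations:
  assumes "r \<in> multilinear_relations A"
  shows "reduce r = 0"
  using assms unfolding multilinear_relations_eq
proof (induction rule: pm.span_induct)
  case base
  show ?case by (auto simp: pm.subspace_def)
next
  case (step r)
  then show ?case
    unfolding multilinear_relators_def letters_def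
    by (auto simp: word_coord_multilinear)
qed

text \<open>Relators allow any word \<open>u\<close> in front of the changed letter, so prefixing a
  letter takes relators to relators.\<close>

lemma relations_pre:
  assumes "l \<in> letters A" "r \<in> multilinear_relations A"
  shows "pre (Poly_Mapping.single l 1) r \<in> multilinear_relations A"
  using assms(2) unfolding multilinear_relations_eq
proof (induction rule: pm.span_induct)
  case base
  show ?case
    by (auto simp: pm.subspace_def pm.span_zero intro: pm.span_add pm.span_scale)
next
  case (step r)
  have pre_diff: "pre (Poly_Mapping.single l 1) (s - t) = pre (Poly_Mapping.single l 1) s - pre (Poly_Mapping.single l 1) t" for s t :: "'a word \<Rightarrow>\<^sub>0 'k"
    using pre_simps(2)[of "Poly_Mapping.single l 1" "s - t" t] by (simp add: algebra_simps)
  from step consider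
    u v n a b where "r = Poly_Mapping.single (u @ (n, a \<oplus> b) # v) 1
        - Poly_Mapping.single (u @ (n, a) # v) 1 - Poly_Mapping.single (u @ (n, b) # v) 1"
      "u \<in> lists (letters A)" "v \<in> lists (letters A)" "(n, a) \<in> letters A" "(n, b) \<in> letters A"
  | u v n a c where "r = Poly_Mapping.single (u @ (n, c \<odot> a) # v) 1 - Poly_Mapping.single (u @ (n, a) # v) c"
      "u \<in> lists (letters A)" "v \<in> lists (letters A)" "(n, a) \<in> letters A"
    unfolding multilinear_relators_def by blast
  then have "pre (Poly_Mapping.single l 1) r \<in> multilinear_relators A"
  proof cases
    case 1
    then show ?thesis
      unfolding multilinear_relators_def using assms(1)
      by (intro UnI1 CollectI exI[of _ "l # u"] exI[of _ v] exI[of _ n] exI[of _ a] exI[of _ b]) (simp add: pre_diff)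
  next
    case 2
    then show ?thesis
      unfolding multilinear_relators_def using assms(1)
      by (intro UnI2 CollectI exI[of _ "l # u"] exI[of _ v] exI[of _ n] exI[of _ a] exI[of _ c]) (simp add: pre_diff)
  qed
  then show ?case by (rule pm.span_base)
qed

end

context connected_comm_graded_algebra
begin

lemma letters_iff: "(n, a) \<in> letters A \<longleftrightarrow> 0 < n \<and> a \<in> homog A n"
  by (simp add: letters_def)

lemma relations_subspace [simp]: "pm.subspace (multilinear_relations A)"
  by (simp add: multilinear_relations_eq)

lemma relation_add:
  assumes "v \<in> lists (letters A)" "(n, a) \<in> letters A" "(n, b) \<in> letters A"
  shows "Poly_Mapping.single ((n, a \<oplus> b) # v) 1 - Poly_Mapping.single ((n, a) # v) 1
    - Poly_Mapping.single ((n, b) # v) 1 \<in> multilinear_relations A"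
  unfolding multilinear_relations_eq multilinear_relators_def using assms
  by (intro pm.span_base UnI1 CollectI exI[of _ "[]"] exI[of _ v] exI[of _ n] exI[of _ a] exI[of _ b]) simp

lemma relation_smult:
  assumes "v \<in> lists (letters A)" "(n, a) \<in> letters A"
  shows "Poly_Mapping.single ((n, c \<odot> a) # v) 1 - Poly_Mapping.single ((n, a) # v) c
    \<in> multilinear_relations A"
  unfolding multilinear_relations_eq multilinear_relators_def using assms
  by (intro pm.span_base UnI2 CollectI exI[of _ "[]"] exI[of _ v] exI[of _ n] exI[of _ a] exI[of _ c]) simp

lemma relation_zero:
  assumes "v \<in> lists (letters A)" "0 < n"
  shows "Poly_Mapping.single ((n, \<zero>) # v) 1 \<in> multilinear_relations A"
  using relation_smult[OF assms(1), of n \<zero> 0] assms(2) homog_zero by (simp add: letters_iff smult_simps)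

lemma relation_lcomb:
  assumes v: "v \<in> lists (letters A)" and n: "0 < n"
    and S: "finite S" "S \<subseteq> homog A n"
  shows "Poly_Mapping.single ((n, lcomb S c) # v) 1 - (\<Sum>b\<in>S. Poly_Mapping.single ((n, b) # v) (c b))
    \<in> multilinear_relations A"
  using S
proof (induction S rule: finite_induct)
  case empty
  then show ?case using relation_zero[OF v n] by (simp add: lcomb_def)
next
  case (insert b S)
  have b: "b \<in> homog A n" "b \<in> carrier A" using insert homog_carrier by auto
  have lcomb: "lcomb (insert b S) c = c b \<odot> b \<oplus> lcomb S c"
    unfolding lcomb_def using insert homog_carrier by (subst finsum_insert) (auto intro!: smult_simps)
  have "lcomb S c \<in> homog A n" using insert by (intro lcomb_homog) auto
  then have "(n, lcomb S c) \<in> letters A" "(n, c b \<odot> b) \<in> letters A" "(n, b) \<in> letters A"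
    using b n by (auto simp: letters_iff intro: homog_smult)
  then have "(Poly_Mapping.single ((n, c b \<odot> b \<oplus> lcomb S c) # v) 1 - Poly_Mapping.single ((n, c b \<odot> b) # v) 1
      - Poly_Mapping.single ((n, lcomb S c) # v) 1)
    + (Poly_Mapping.single ((n, c b \<odot> b) # v) 1 - Poly_Mapping.single ((n, b) # v) (c b))
    + (Poly_Mapping.single ((n, lcomb S c) # v) 1 - (\<Sum>b\<in>S. Poly_Mapping.single ((n, b) # v) (c b)))
     \<in> multilinear_relations A"
    using insert by (intro pm.subspace_add relations_subspace relation_add relation_smult v) auto
  then show ?case
    unfolding lcomb using insert by (simp add: algebra_simps)
qed

lemma relation_coord:
  assumes v: "v \<in> lists (letters A)" and l: "l \<in> letters A"
  shows "Poly_Mapping.single (l # v) 1 - pre (coord l) (Poly_Mapping.single v 1) \<in> multilinear_relations A"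
proof -
  obtain n a where na: "l = (n, a)" by (cases l)
  then have n: "0 < n" "a \<in> homog A n" using l by (auto simp: letters_iff)
  obtain c where c: "a = lcomb (basis n) c" using n basis(3) by metis
  show ?thesis
    using relation_lcomb[OF v n(1) basis(1,2), of c] unfolding na c coord_lcomb by (simp add: pre_sum)
qed

lemma pre_diff: "pre x (s - t) = pre x s - pre x t" "pre (x - y) t = pre x t - pre y t"
  using pre_simps(2)[of x "s - t" t] pre_simps(1)[of "x - y" y t] by (simp_all add: algebra_simps)

lemma word_coord_supp:
  "w \<in> lists (letters A) \<Longrightarrow> word_coord w \<in> supp_in (lists basis_letters)"
proof (induction w)
  case (Cons l w)
  obtain n a where na: "l = (n, a)" by (cases l)
  then have "coord l \<in> supp_in {l \<in> basis_letters. fst l = n}"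
    using Cons.prems by (auto simp: letters_iff intro: coord_supp)
  then show ?case
    using Cons unfolding word_coord.simps pre_def
    by (intro bilin_in_subspace subspace_supp_in single_in_supp_in) (auto dest!: supp_in_keys)
qed simp

lemma relation_word_coord:
  "w \<in> lists (letters A) \<Longrightarrow> Poly_Mapping.single w 1 - word_coord w \<in> multilinear_relations A"
proof (induction w)
  case Nil
  then show ?case by (simp add: pm.subspace_0)
next
  case (Cons l w)
  then have l: "l \<in> letters A" and w: "w \<in> lists (letters A)" by auto
  have "pre (Poly_Mapping.single l 1 - coord l) t \<in> multilinear_relations A"
    if "t \<in> supp_in (lists (letters A))" for t
    using that
  proof (induction rule: supp_in_induct)
    case (single v)
    then show ?case using relation_coord[OF single l] by (simp add: pre_diff)
  qed (auto intro: pm.subspace_add pm.subspace_scale simp: pm.subspace_0)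
  moreover have "word_coord w \<in> supp_in (lists (letters A))"
    using word_coord_supp[OF w] lists_mono[OF basis_letters_subset] by (auto simp: supp_in_def)
  \<comment> \<open>Telescoping: the tail is expanded behind the letter \<open>l\<close>, then
    \<open>l\<close> itself in front of the expanded tail.\<close>
  ultimately have "pre (Poly_Mapping.single l 1) (Poly_Mapping.single w 1 - word_coord w)
    + pre (Poly_Mapping.single l 1 - coord l) (word_coord w) \<in> multilinear_relations A"
    using Cons.IH[OF w] l by (intro pm.subspace_add relations_pre relations_subspace) auto
  then show ?case by (simp add: pre_diff)
qed

lemma reduce_congr:
  "f \<in> supp_in (lists (letters A)) \<Longrightarrow> f - reduce f \<in> multilinear_relations A"
proof (induction rule: supp_in_induct)
  case (single w)
  then show ?case using relation_word_coord by simp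
next
  case (scale c t)
  then show ?case using pm.subspace_scale[OF relations_subspace scale(2), of c]
    by (simp add: pm.scale_right_diff_distrib)
next
  case (add s t)
  then show ?case using pm.subspace_add[OF relations_subspace add(3,4)] by (simp add: algebra_simps)
qed (simp add: pm.subspace_0)

lemma reduce_supp:
  "f \<in> supp_in (lists (letters A)) \<Longrightarrow> reduce f \<in> supp_in (lists basis_letters)"
  unfolding reduce_def by (intro lin_in_subspace subspace_supp_in word_coord_supp) (rule supp_in_keys)

lemma word_coord_basis: "w \<in> lists basis_letters \<Longrightarrow> word_coord w = Poly_Mapping.single w 1"
  by (induction w) (auto simp: basis_letters_def coord_basis)

lemma reduce_id: "t \<in> supp_in (lists basis_letters) \<Longrightarrow> reduce t = t"
  by (induction rule: supp_in_induct) (auto simp: word_coord_basis)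

lemma relations_supp: "multilinear_relations A \<subseteq> supp_in (lists (letters A))"
  unfolding multilinear_relations_eq
proof (rule pm.span_minimal)
  have "(n, a \<oplus> b) \<in> letters A" "(n, c \<odot> a) \<in> letters A"
    if "(n, a) \<in> letters A" "(n, b) \<in> letters A" for n a b c
    using that by (auto simp: letters_iff homog_add homog_smult)
  then show "multilinear_relators A \<subseteq> supp_in (lists (letters A))"
    unfolding multilinear_relators_def
    by (auto intro!: pm.subspace_diff single_in_supp_in)
qed simp

text \<open>Every element is congruent to its reduction and \<open>reduce\<close> kills the
  relations. Hence cosets correspond to normal forms.\<close>

lemma relations_iff:
  "f \<in> supp_in (lists (letters A)) \<Longrightarrow> f \<in> multilinear_relations A \<longleftrightarrow> reduce f = 0"
  using reduce_congr[of f] reduce_relations[of f] by auto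

end

section \<open>Recursion for quasi-shuffles\<close>

definition mono_maps :: "nat \<Rightarrow> nat \<Rightarrow> (nat \<Rightarrow> nat) set" where
  "mono_maps l n = {\<alpha> \<in> {..<l} \<rightarrow>\<^sub>E {..<n}. strict_mono_on {..<l} \<alpha>}"

text \<open>The first letter takes position 0 and the other letters move up. \<open>restrict\<close>
  keeps the map extensional, as \<open>quasi_shuffles\<close> demands.\<close>

definition cons_map :: "nat \<Rightarrow> (nat \<Rightarrow> nat) \<Rightarrow> (nat \<Rightarrow> nat)" where
  "cons_map l \<alpha> = restrict (case_nat 0 (\<lambda>j. Suc (\<alpha> j))) {..<Suc l}"

text \<open>Position 0 is left to the other word.\<close>

definition lift_map :: "nat \<Rightarrow> (nat \<Rightarrow> nat) \<Rightarrow> (nat \<Rightarrow> nat)" where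
  "lift_map l \<alpha> = restrict (\<lambda>j. Suc (\<alpha> j)) {..<l}"

lemma cons_map_simps [simp]: "cons_map l \<alpha> 0 = 0" "j < l \<Longrightarrow> cons_map l \<alpha> (Suc j) = Suc (\<alpha> j)"
  and lift_map_simps [simp]: "j < l \<Longrightarrow> lift_map l \<alpha> j = Suc (\<alpha> j)"
  by (simp_all add: cons_map_def lift_map_def)

lemma cons_map_mono: "\<alpha> \<in> mono_maps l n \<Longrightarrow> cons_map l \<alpha> \<in> mono_maps (Suc l) (Suc n)"
  by (auto simp: mono_maps_def cons_map_def strict_mono_on_def PiE_iff split: nat.splits)

lemma lift_map_mono: "\<alpha> \<in> mono_maps l n \<Longrightarrow> lift_map l \<alpha> \<in> mono_maps l (Suc n)"
  by (auto simp: mono_maps_def lift_map_def strict_mono_on_def PiE_iff)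

lemma cons_map_image: "cons_map l \<alpha> ` {..<Suc l} = insert 0 (Suc ` \<alpha> ` {..<l})"
  by (auto simp: lessThan_Suc_eq_insert_0 image_image)

lemma lift_map_image: "lift_map l \<alpha> ` {..<l} = Suc ` \<alpha> ` {..<l}"
  by (auto simp: image_image)

text \<open>By strict monotonicity, position 0 can only be the image of the first argument.\<close>

lemma mono_maps_cases:
  assumes \<alpha>: "\<alpha> \<in> mono_maps l (Suc n)"
  obtains (lift) \<alpha>' where "\<alpha>' \<in> mono_maps l n" "\<alpha> = lift_map l \<alpha>'" "0 \<notin> \<alpha> ` {..<l}"
  | (cons) l' \<alpha>' where "l = Suc l'" "\<alpha>' \<in> mono_maps l' n" "\<alpha> = cons_map l' \<alpha>'"
proof (cases "0 \<in> \<alpha> ` {..<l}")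
  case False
  define \<alpha>' where "\<alpha>' = restrict (\<lambda>j. \<alpha> j - 1) {..<l}"
  have pos: "\<alpha> j = Suc (\<alpha> j - 1)" if "j < l" for j
  proof -
    have "\<alpha> j \<noteq> 0" using False that by (metis imageI lessThan_iff)
    then show ?thesis by simp
  qed
  have "\<alpha>' \<in> mono_maps l n"
    unfolding mono_maps_def
  proof (intro CollectI conjI)
    show "\<alpha>' \<in> {..<l} \<rightarrow>\<^sub>E {..<n}"
    proof -
      have "\<alpha> j - 1 < n" if "j < l" for j
      proof -
        have "\<alpha> j < Suc n" using \<alpha> that by (auto simp: mono_maps_def PiE_iff)
        then show ?thesis using pos[OF that] by simp
      qed
      then show ?thesis by (auto simp: \<alpha>'_def)
    qed
    have "\<alpha> i - 1 < \<alpha> j - 1" if "i < j" "j < l" for i j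
    proof -
      have "\<alpha> i < \<alpha> j" using \<alpha> that by (auto simp: mono_maps_def strict_mono_on_def)
      then show ?thesis using pos[of i] pos[of j] that by simp
    qed
    then show "strict_mono_on {..<l} \<alpha>'" by (auto simp: \<alpha>'_def strict_mono_on_def)
  qed
  moreover have "\<alpha> = lift_map l \<alpha>'"
    using \<alpha> pos by (intro ext) (auto simp: \<alpha>'_def lift_map_def mono_maps_def PiE_iff extensional_def)
  ultimately show ?thesis using False lift by blast
next
  case True
  then obtain j where j: "j < l" "\<alpha> j = 0" by auto
  then obtain l' where l': "l = Suc l'" by (cases l) auto
  have less: "\<alpha> i < \<alpha> k" if "i < k" "k < l" for i k
    using \<alpha> that by (auto simp: mono_maps_def strict_mono_on_def)
  have 0: "\<alpha> 0 = 0" using j less[of 0 j] by (cases "j = 0") auto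
  define \<alpha>' where "\<alpha>' = restrict (\<lambda>j. \<alpha> (Suc j) - 1) {..<l'}"
  have pos: "\<alpha> (Suc j) = Suc (\<alpha> (Suc j) - 1)" if "j < l'" for j
    using less[of 0 "Suc j"] that l' 0 by simp
  have "\<alpha>' \<in> mono_maps l' n"
    unfolding mono_maps_def
  proof (intro CollectI conjI)
    have "\<alpha> (Suc j) - 1 < n" if "j < l'" for j
    proof -
      have "\<alpha> (Suc j) < Suc n" using \<alpha> that l' by (auto simp: mono_maps_def PiE_iff)
      then show ?thesis using pos[OF that] by simp
    qed
    then show "\<alpha>' \<in> {..<l'} \<rightarrow>\<^sub>E {..<n}" by (auto simp: \<alpha>'_def)
    have "\<alpha> (Suc i) - 1 < \<alpha> (Suc k) - 1" if "i < k" "k < l'" for i k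
      using less[of "Suc i" "Suc k"] pos[of i] pos[of k] that l' by simp
    then show "strict_mono_on {..<l'} \<alpha>'" by (auto simp: \<alpha>'_def strict_mono_on_def)
  qed
  moreover have "\<alpha> = cons_map l' \<alpha>'"
  proof
    fix j show "\<alpha> j = cons_map l' \<alpha>' j"
    proof (cases j)
      case (Suc i)
      then show ?thesis
        using \<alpha> pos[of i] l' by (auto simp: \<alpha>'_def cons_map_def mono_maps_def PiE_iff extensional_def)
    qed (simp add: 0)
  qed
  ultimately show ?thesis using l' cons by blast
qed

lemma cons_map_inj: "inj_on (cons_map l) (mono_maps l n)"
proof (rule inj_onI)
  fix \<alpha> \<beta> assume *: "\<alpha> \<in> mono_maps l n" "\<beta> \<in> mono_maps l n" "cons_map l \<alpha> = cons_map l \<beta>"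
  have "\<alpha> j = \<beta> j" if "j < l" for j
    using fun_cong[OF *(3), of "Suc j"] that by simp
  then show "\<alpha> = \<beta>" using *(1,2) by (auto simp: mono_maps_def intro: PiE_ext)
qed

lemma lift_map_inj: "inj_on (lift_map l) (mono_maps l n)"
proof (rule inj_onI)
  fix \<alpha> \<beta> assume *: "\<alpha> \<in> mono_maps l n" "\<beta> \<in> mono_maps l n" "lift_map l \<alpha> = lift_map l \<beta>"
  have "\<alpha> j = \<beta> j" if "j < l" for j
    using fun_cong[OF *(3), of j] that by simp
  then show "\<alpha> = \<beta>" using *(1,2) by (auto simp: mono_maps_def intro: PiE_ext)
qed

text \<open>The size bound in \<open>quasi_shuffles\<close> follows from covering by counting the
  two images.\<close>

lemma quasi_shuffles_iff:
  "(n, \<alpha>, \<beta>) \<in> quasi_shuffles l m \<longleftrightarrow>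
     \<alpha> \<in> mono_maps l n \<and> \<beta> \<in> mono_maps m n \<and> \<alpha> ` {..<l} \<union> \<beta> ` {..<m} = {..<n}"
proof -
  have "n \<le> l + m" if "\<alpha> ` {..<l} \<union> \<beta> ` {..<m} = {..<n}"
  proof -
    have "n = card (\<alpha> ` {..<l} \<union> \<beta> ` {..<m})" using that by simp
    also have "\<dots> \<le> card (\<alpha> ` {..<l}) + card (\<beta> ` {..<m})" by (rule card_Un_le)
    also have "\<dots> \<le> l + m" using card_image_le[of "{..<l}" \<alpha>] card_image_le[of "{..<m}" \<beta>] by simp
    finally show ?thesis .
  qed
  then show ?thesis by (auto simp: quasi_shuffles_def mono_maps_def)
qed

lemma finite_quasi_shuffles [simp]: "finite (quasi_shuffles l m)"
proof (rule finite_subset)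
  show "quasi_shuffles l m \<subseteq> (\<Union>n\<in>{..l + m}. {n} \<times> ({..<l} \<rightarrow>\<^sub>E {..<n}) \<times> ({..<m} \<rightarrow>\<^sub>E {..<n}))"
    by (auto simp: quasi_shuffles_def)
  show "finite (\<Union>n\<in>{..l + m}. {n} \<times> ({..<l} \<rightarrow>\<^sub>E {..<n}) \<times> ({..<m} \<rightarrow>\<^sub>E {..<n}))"
    by (intro finite_UN_I finite_cartesian_product finite_PiE) auto
qed

lemma insert_0_Suc_image: "insert 0 (Suc ` S) = {..<Suc n} \<longleftrightarrow> S = {..<n}"
proof
  assume *: "insert 0 (Suc ` S) = {..<Suc n}"
  have "j \<in> S \<longleftrightarrow> Suc j \<in> insert 0 (Suc ` S)" for j by auto
  then show "S = {..<n}" unfolding * by auto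
qed (simp add: lessThan_Suc_eq_insert_0)

lemma image_cons_lift:
  "cons_map l \<alpha> ` {..<Suc l} \<union> lift_map m \<beta> ` {..<m} = insert 0 (Suc ` (\<alpha> ` {..<l} \<union> \<beta> ` {..<m}))"
  "lift_map l \<alpha> ` {..<l} \<union> cons_map m \<beta> ` {..<Suc m} = insert 0 (Suc ` (\<alpha> ` {..<l} \<union> \<beta> ` {..<m}))"
  "cons_map l \<alpha> ` {..<Suc l} \<union> cons_map m \<beta> ` {..<Suc m} = insert 0 (Suc ` (\<alpha> ` {..<l} \<union> \<beta> ` {..<m}))"
  unfolding cons_map_image lift_map_image by blast+

lemma quasi_shuffles_extend:
  assumes "\<alpha> \<in> mono_maps l n" "\<beta> \<in> mono_maps m n"
  shows "(Suc n, cons_map l \<alpha>, lift_map m \<beta>) \<in> quasi_shuffles (Suc l) m \<longleftrightarrow> (n, \<alpha>, \<beta>) \<in> quasi_shuffles l m"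
    and "(Suc n, lift_map l \<alpha>, cons_map m \<beta>) \<in> quasi_shuffles l (Suc m) \<longleftrightarrow> (n, \<alpha>, \<beta>) \<in> quasi_shuffles l m"
    and "(Suc n, cons_map l \<alpha>, cons_map m \<beta>) \<in> quasi_shuffles (Suc l) (Suc m) \<longleftrightarrow> (n, \<alpha>, \<beta>) \<in> quasi_shuffles l m"
  unfolding quasi_shuffles_iff image_cons_lift insert_0_Suc_image
  using assms by (simp_all add: cons_map_mono lift_map_mono)

text \<open>There is a position because one of the words is nonempty, and position 0 must be
  covered: by the left word, by the right word, or by both.\<close>

lemma quasi_shuffles_cases:
  assumes "(n, \<alpha>, \<beta>) \<in> quasi_shuffles l m" "l + m > 0"
  obtains (left) l' n' \<alpha>' \<beta>' where "l = Suc l'" "n = Suc n'" "\<alpha> = cons_map l' \<alpha>'" "\<beta> = lift_map m \<beta>'"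
      "(n', \<alpha>', \<beta>') \<in> quasi_shuffles l' m"
  | (right) m' n' \<alpha>' \<beta>' where "m = Suc m'" "n = Suc n'" "\<alpha> = lift_map l \<alpha>'" "\<beta> = cons_map m' \<beta>'"
      "(n', \<alpha>', \<beta>') \<in> quasi_shuffles l m'"
  | (both) l' m' n' \<alpha>' \<beta>' where "l = Suc l'" "m = Suc m'" "n = Suc n'" "\<alpha> = cons_map l' \<alpha>'" "\<beta> = cons_map m' \<beta>'"
      "(n', \<alpha>', \<beta>') \<in> quasi_shuffles l' m'"
proof -
  have *: "\<alpha> \<in> mono_maps l n" "\<beta> \<in> mono_maps m n" "\<alpha> ` {..<l} \<union> \<beta> ` {..<m} = {..<n}"
    using assms(1) by (auto simp: quasi_shuffles_iff)
  have "n \<noteq> 0"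
  proof
    assume "n = 0"
    then have "\<alpha> ` {..<l} = {}" "\<beta> ` {..<m} = {}" using *(3) by auto
    then show False using assms(2) by (simp add: lessThan_empty_iff)
  qed
  then obtain n' where n: "n = Suc n'" by (cases n) auto
  from *(1)[unfolded n] show ?thesis
  proof (cases rule: mono_maps_cases)
    case \<alpha>: (lift \<alpha>')
    from *(2)[unfolded n] show ?thesis
    proof (cases rule: mono_maps_cases)
      case (lift \<beta>')
      then have "0 \<notin> {..<n}" using \<alpha>(3) unfolding *(3)[symmetric] by blast
      then show ?thesis using n by simp
    next
      case (cons m' \<beta>')
      then have "(n', \<alpha>', \<beta>') \<in> quasi_shuffles l m'"
        using assms(1) \<alpha> n quasi_shuffles_extend(2) by simp
      then show ?thesis using right n \<alpha> cons by blast
    qed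
  next
    case \<alpha>: (cons l' \<alpha>')
    from *(2)[unfolded n] show ?thesis
    proof (cases rule: mono_maps_cases)
      case (lift \<beta>')
      then have "(n', \<alpha>', \<beta>') \<in> quasi_shuffles l' m"
        using assms(1) \<alpha> n quasi_shuffles_extend(1) by simp
      then show ?thesis using left n \<alpha> lift by blast
    next
      case (cons m' \<beta>')
      then have "(n', \<alpha>', \<beta>') \<in> quasi_shuffles l' m'"
        using assms(1) \<alpha> n quasi_shuffles_extend(3) by simp
      then show ?thesis using both n \<alpha> cons by blast
    qed
  qed
qed

text \<open>The three extensions of a quasi-shuffle by a new position 0, one for each term of the
  product recursion.\<close>

definition cons_left where "cons_left l m = (\<lambda>(n, \<alpha>, \<beta>). (Suc n, cons_map l \<alpha>, lift_map m \<beta>))"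
definition cons_right where "cons_right l m = (\<lambda>(n, \<alpha>, \<beta>). (Suc n, lift_map l \<alpha>, cons_map m \<beta>))"
definition cons_both where "cons_both l m = (\<lambda>(n, \<alpha>, \<beta>). (Suc n, cons_map l \<alpha>, cons_map m \<beta>))"

text \<open>On an empty domain the only extensional map is constantly
  \<open>undefined\<close>.\<close>

lemma quasi_shuffles_0_0: "quasi_shuffles 0 0 = {(0, \<lambda>_. undefined, \<lambda>_. undefined)}"
  by (auto simp: quasi_shuffles_def strict_mono_on_def)

lemma cons_left_in: "x \<in> quasi_shuffles l m \<Longrightarrow> cons_left l m x \<in> quasi_shuffles (Suc l) m"
  and cons_right_in: "x \<in> quasi_shuffles l m \<Longrightarrow> cons_right l m x \<in> quasi_shuffles l (Suc m)"
  and cons_both_in: "x \<in> quasi_shuffles l m \<Longrightarrow> cons_both l m x \<in> quasi_shuffles (Suc l) (Suc m)"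
  by (cases x; simp add: cons_left_def cons_right_def cons_both_def quasi_shuffles_extend quasi_shuffles_iff[THEN iffD1])+

lemma quasi_shuffles_cons:
  assumes "x \<in> quasi_shuffles l m" "l + m > 0"
  shows "(\<exists>l'. l = Suc l' \<and> x \<in> cons_left l' m ` quasi_shuffles l' m) \<or>
    (\<exists>m'. m = Suc m' \<and> x \<in> cons_right l m' ` quasi_shuffles l m') \<or>
    (\<exists>l' m'. l = Suc l' \<and> m = Suc m' \<and> x \<in> cons_both l' m' ` quasi_shuffles l' m')"
proof -
  obtain n \<alpha> \<beta> where x: "x = (n, \<alpha>, \<beta>)" by (cases x)
  from assms[unfolded x] show ?thesis
  proof (cases rule: quasi_shuffles_cases)
    case (left l' n' \<alpha>' \<beta>')
    then have "x = cons_left l' m (n', \<alpha>', \<beta>')" by (simp add: x cons_left_def)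
    then show ?thesis using left by blast
  next
    case (right m' n' \<alpha>' \<beta>')
    then have "x = cons_right l m' (n', \<alpha>', \<beta>')" by (simp add: x cons_right_def)
    then show ?thesis using right by blast
  next
    case (both l' m' n' \<alpha>' \<beta>')
    then have "x = cons_both l' m' (n', \<alpha>', \<beta>')" by (simp add: x cons_both_def)
    then show ?thesis using both by blast
  qed
qed

lemma quasi_shuffles_Suc_0: "quasi_shuffles (Suc l) (0) = cons_left l 0 ` quasi_shuffles l 0"
proof (intro Set.equalityI subsetI)
  fix x assume "x \<in> quasi_shuffles (Suc l) (0)"
  then show "x \<in> cons_left l 0 ` quasi_shuffles l 0" using quasi_shuffles_cons[of x "Suc l" "0"] by auto
next
  fix x assume "x \<in> cons_left l 0 ` quasi_shuffles l 0"
  then show "x \<in> quasi_shuffles (Suc l) (0)" using cons_left_in cons_right_in cons_both_in by blast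
qed

lemma quasi_shuffles_0_Suc: "quasi_shuffles (0) (Suc m) = cons_right 0 m ` quasi_shuffles 0 m"
proof (intro Set.equalityI subsetI)
  fix x assume "x \<in> quasi_shuffles (0) (Suc m)"
  then show "x \<in> cons_right 0 m ` quasi_shuffles 0 m" using quasi_shuffles_cons[of x "0" "Suc m"] by auto
next
  fix x assume "x \<in> cons_right 0 m ` quasi_shuffles 0 m"
  then show "x \<in> quasi_shuffles (0) (Suc m)" using cons_left_in cons_right_in cons_both_in by blast
qed

lemma quasi_shuffles_Suc_Suc: "quasi_shuffles (Suc l) (Suc m) = cons_left l (Suc m) ` quasi_shuffles l (Suc m) \<union> cons_right (Suc l) m ` quasi_shuffles (Suc l) m
    \<union> cons_both l m ` quasi_shuffles l m"
proof (intro Set.equalityI subsetI)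
  fix x assume "x \<in> quasi_shuffles (Suc l) (Suc m)"
  then show "x \<in> cons_left l (Suc m) ` quasi_shuffles l (Suc m) \<union> cons_right (Suc l) m ` quasi_shuffles (Suc l) m
    \<union> cons_both l m ` quasi_shuffles l m" using quasi_shuffles_cons[of x "Suc l" "Suc m"] by auto
next
  fix x assume "x \<in> cons_left l (Suc m) ` quasi_shuffles l (Suc m) \<union> cons_right (Suc l) m ` quasi_shuffles (Suc l) m
    \<union> cons_both l m ` quasi_shuffles l m"
  then show "x \<in> quasi_shuffles (Suc l) (Suc m)" using cons_left_in cons_right_in cons_both_in by blast
qed

lemma cons_inj:
  "inj_on (cons_left l m) (quasi_shuffles l m)" "inj_on (cons_right l m) (quasi_shuffles l m)"
  "inj_on (cons_both l m) (quasi_shuffles l m)"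
  by (auto simp: cons_left_def cons_right_def cons_both_def quasi_shuffles_iff intro!: inj_onI)
    (blast dest: inj_onD[OF cons_map_inj] inj_onD[OF lift_map_inj])+

text \<open>The maps are told apart at argument 0, where \<open>cons_map\<close> is 0 and
  \<open>lift_map\<close> a successor; the domains \<open>Suc l\<close> and \<open>Suc m\<close>
  guarantee that this argument exists.\<close>

lemma cons_disjoint:
  "cons_left l (Suc m) ` S \<inter> cons_right (Suc l) m ` S' = {}"
  "(cons_left l (Suc m) ` S \<union> cons_right (Suc l) m ` S') \<inter> cons_both l m ` S'' = {}"
proof -
  have "lift_map (Suc l) \<alpha> \<noteq> cons_map l' \<beta>" for l l' \<alpha> \<beta>
  proof
    assume h: "lift_map (Suc l) \<alpha> = cons_map l' \<beta>"
    from fun_cong[OF h, of 0] show False by simp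
  qed
  then show "cons_left l (Suc m) ` S \<inter> cons_right (Suc l) m ` S' = {}"
    "(cons_left l (Suc m) ` S \<union> cons_right (Suc l) m ` S') \<inter> cons_both l m ` S'' = {}"
    by (auto simp: cons_left_def cons_right_def cons_both_def) metis+
qed

definition pick :: "(nat \<Rightarrow> nat) \<Rightarrow> 'b list \<Rightarrow> nat \<Rightarrow> 'b list" where
  "pick \<alpha> u i = map ((!) u) (filter (\<lambda>j. \<alpha> j = i) [0..<length u])"

lemma upt_Suc_shift: "[0..<Suc n] = 0 # map Suc [0..<n]"
  by (simp add: map_Suc_upt upt_conv_Cons del: upt_Suc)

lemma pick_cons_map:
  "pick (cons_map (length u) \<alpha>) (x # u) 0 = [x]"
  "pick (cons_map (length u) \<alpha>) (x # u) (Suc i) = pick \<alpha> u i"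
  by (auto simp: pick_def upt_Suc_shift filter_map o_def simp del: upt_Suc
      intro!: arg_cong[of _ _ "map _"] filter_cong)

lemma pick_lift_map:
  "pick (lift_map (length u) \<alpha>) u 0 = []"
  "pick (lift_map (length u) \<alpha>) u (Suc i) = pick \<alpha> u i"
  by (auto simp: pick_def intro!: arg_cong[of _ _ "map _"] filter_cong)

section \<open>The quasi-shuffle product as a recursion on words\<close>

context connected_comm_graded_algebra
begin

definition letter_prod :: "(nat \<times> 'a) list \<Rightarrow> nat \<times> 'a" where
  "letter_prod ls = (sum_list (map fst ls), foldr (\<otimes>) (map snd ls) \<one>)"

definition merge2 :: "(nat \<times> (nat \<Rightarrow> nat) \<times> (nat \<Rightarrow> nat)) \<Rightarrow> 'a word \<Rightarrow> 'a word \<Rightarrow> 'a word" where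
  "merge2 = (\<lambda>(n, \<alpha>, \<beta>) u v. map (\<lambda>i. letter_prod (pick \<alpha> u i @ pick \<beta> v i)) [0..<n])"

text \<open>In \<open>u @ v\<close> the letters of \<open>u\<close> precede those of
  \<open>v\<close>, so every merged letter is a part from \<open>u\<close> times a part from
  \<open>v\<close>, in this order.\<close>

lemma merge_word_eq:
  "merge_word A n (joint_map (length u) \<alpha> \<beta>) (u @ v) = merge2 (n, \<alpha>, \<beta>) u v"
proof -
  have filter: "filter (\<lambda>j. joint_map (length u) \<alpha> \<beta> j = i) [0..<length (u @ v)] =
     filter (\<lambda>j. \<alpha> j = i) [0..<length u] @ map (\<lambda>j. j + length u) (filter (\<lambda>j. \<beta> j = i) [0..<length v])" for i
  proof -
    have "[0..<length (u @ v)] = [0..<length u] @ map (\<lambda>j. j + length u) [0..<length v]"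
      using map_add_upt[of "length u" "length v"] upt_add_eq_append[of 0 "length u" "length v"] by (simp add: add.commute)
    then show ?thesis
      by (auto simp: filter_map o_def joint_map_def intro!: filter_cong)
  qed
  have "map (\<lambda>j. (u @ v) ! j) (filter (\<lambda>j. \<alpha> j = i) [0..<length u]) = pick \<alpha> u i"
    "map (\<lambda>j. (u @ v) ! (j + length u)) (filter (\<lambda>j. \<beta> j = i) [0..<length v]) = pick \<beta> v i" for i
    by (auto simp: pick_def nth_append)
  then have js: "map ((!) (u @ v)) (filter (\<lambda>j. joint_map (length u) \<alpha> \<beta> j = i) [0..<length (u @ v)])
     = pick \<alpha> u i @ pick \<beta> v i" for i
    unfolding filter by (simp add: o_def)
  have "(\<Sum>j\<leftarrow>js. fst (w ! j)) = sum_list (map fst (map ((!) w) js))"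
    "map (\<lambda>j. snd (w ! j)) js = map snd (map ((!) w) js)" for js :: "nat list" and w :: "'a word"
    by (simp_all add: o_def)
  then show ?thesis
    unfolding merge_word_def merge2_def letter_prod_def Let_def by (simp only: js prod.case)
qed

lemma merge2_cons:
  "merge2 (cons_left (length u) (length v) x) (a # u) v = letter_prod [a] # merge2 x u v"
  "merge2 (cons_right (length u) (length v) x) u (b # v) = letter_prod [b] # merge2 x u v"
  "merge2 (cons_both (length u) (length v) x) (a # u) (b # v) = letter_prod [a, b] # merge2 x u v"
  by (cases x; simp add: merge2_def cons_left_def cons_right_def cons_both_def upt_Suc_shift
      pick_cons_map pick_lift_map o_def del: upt_Suc)+

text \<open>The weight \<open>h\<close> is arbitrary so that a leading letter split off from the
  merged word can be absorbed into it; this closes the recursion \<open>qsum_simps\<close>.\<close>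

definition qsum :: "('a word \<Rightarrow> 'c::comm_monoid_add) \<Rightarrow> 'a word \<Rightarrow> 'a word \<Rightarrow> 'c" where
  "qsum h u v = (\<Sum>x\<in>quasi_shuffles (length u) (length v). h (merge2 x u v))"

lemma qsum_simps:
  "qsum h [] [] = h []"
  "qsum h (a # u) [] = qsum (\<lambda>w. h (letter_prod [a] # w)) u []"
  "qsum h [] (b # v) = qsum (\<lambda>w. h (letter_prod [b] # w)) [] v"
  "qsum h (a # u) (b # v) = qsum (\<lambda>w. h (letter_prod [a] # w)) u (b # v) +
     qsum (\<lambda>w. h (letter_prod [b] # w)) (a # u) v + qsum (\<lambda>w. h (letter_prod [a, b] # w)) u v"
proof -
  show "qsum h [] [] = h []"
    by (simp add: qsum_def quasi_shuffles_0_0 merge2_def)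
  show "qsum h (a # u) [] = qsum (\<lambda>w. h (letter_prod [a] # w)) u []"
    using merge2_cons(1)[of u "[]" _ a] cons_inj(1)[of "length u" 0]
    by (simp add: qsum_def quasi_shuffles_Suc_0 sum.reindex)
  show "qsum h [] (b # v) = qsum (\<lambda>w. h (letter_prod [b] # w)) [] v"
    using merge2_cons(2)[of "[]" v _ b] cons_inj(2)[of 0 "length v"]
    by (simp add: qsum_def quasi_shuffles_0_Suc sum.reindex)
  show "qsum h (a # u) (b # v) = qsum (\<lambda>w. h (letter_prod [a] # w)) u (b # v) +
     qsum (\<lambda>w. h (letter_prod [b] # w)) (a # u) v + qsum (\<lambda>w. h (letter_prod [a, b] # w)) u v"
  proof -
    let ?l = "length u" and ?m = "length v"
    let ?f = "\<lambda>x. h (merge2 x (a # u) (b # v))"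
    have "qsum h (a # u) (b # v) = sum ?f (cons_left ?l (Suc ?m) ` quasi_shuffles ?l (Suc ?m) \<union>
      cons_right (Suc ?l) ?m ` quasi_shuffles (Suc ?l) ?m \<union> cons_both ?l ?m ` quasi_shuffles ?l ?m)"
      by (simp add: qsum_def quasi_shuffles_Suc_Suc)
    also have "\<dots> = sum ?f (cons_left ?l (Suc ?m) ` quasi_shuffles ?l (Suc ?m)) +
      sum ?f (cons_right (Suc ?l) ?m ` quasi_shuffles (Suc ?l) ?m) +
      sum ?f (cons_both ?l ?m ` quasi_shuffles ?l ?m)"
      by (simp add: sum.union_disjoint cons_disjoint)
    also have "sum ?f (cons_left ?l (Suc ?m) ` quasi_shuffles ?l (Suc ?m)) =
        qsum (\<lambda>w. h (letter_prod [a] # w)) u (b # v)"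
      using merge2_cons(1)[of u "b # v" _ a] cons_inj(1)[of ?l "Suc ?m"]
      by (simp add: qsum_def sum.reindex)
    also have "sum ?f (cons_right (Suc ?l) ?m ` quasi_shuffles (Suc ?l) ?m) =
        qsum (\<lambda>w. h (letter_prod [b] # w)) (a # u) v"
      using merge2_cons(2)[of "a # u" v _ b] cons_inj(2)[of "Suc ?l" ?m]
      by (simp add: qsum_def sum.reindex)
    also have "sum ?f (cons_both ?l ?m ` quasi_shuffles ?l ?m) =
        qsum (\<lambda>w. h (letter_prod [a, b] # w)) u v"
      using merge2_cons(3)[of u v _ a b] cons_inj(3)[of ?l ?m]
      by (simp add: qsum_def sum.reindex)
    finally show ?thesis .
  qed
qed

lemma letter_prod_1: "l \<in> letters A \<Longrightarrow> letter_prod [l] = l"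
  by (cases l) (auto simp: letter_prod_def letters_iff dest: homog_carrier)

lemma letter_prod_2:
  "a \<in> letters A \<Longrightarrow> b \<in> letters A \<Longrightarrow> letter_prod [a, b] = (fst a + fst b, snd a \<otimes> snd b)"
  by (cases a; cases b) (auto simp: letter_prod_def letters_iff dest: homog_carrier)

lemma qsum_pre: "qsum (\<lambda>w. pre x (h w)) u v = pre x (qsum h u v)"
  by (simp add: qsum_def pre_sum)

end

text \<open>The two situations in which Koszul signs are invisible: -1 = 1, or no nonzero elements
  of odd degree.\<close>

locale strictly_commutative_graded_algebra = connected_comm_graded_algebra A
  for A :: "('k::field, 'a, 'm) graded_algebra_scheme" (structure) +
  assumes signs: "(- 1 :: 'k) = 1 \<or> (\<forall>n. odd n \<longrightarrow> homog A n = {\<zero>})"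
begin

lemma homog_comm:
  assumes "x \<in> homog A m" "y \<in> homog A n"
  shows "x \<otimes> y = y \<otimes> x"
proof (cases "(- 1 :: 'k) = 1")
  case True
  then have "(- 1 :: 'k) ^ (m * n) = 1" by (metis power_one)
  then show ?thesis using graded_commutative[OF assms] assms homog_carrier by (simp add: smult_simps)
next
  case False
  then have odd: "odd n \<Longrightarrow> homog A n = {\<zero>}" for n using signs by blast
  show ?thesis
  proof (cases "even (m * n)")
    case True
    then have "(- 1 :: 'k) ^ (m * n) = 1" by simp
    then show ?thesis using graded_commutative[OF assms] assms homog_carrier by (simp add: smult_simps)
  next
    case False
    then have "x = \<zero>" using odd[of m] assms by simp
    then show ?thesis using assms homog_carrier by simp
  qed
qed

lemma coord_bilin:
  assumes "l \<in> letters A" "l' \<in> letters A"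
  shows "coord (letter_prod [l, l']) = bilin mu (coord l) (coord l')"
  using coord_mult[of "snd l" "fst l" "snd l'" "fst l'"] assms letter_prod_2[OF assms]
  by (cases l; cases l') (simp add: letters_iff)

lemma basis_lettersD:
  assumes "l \<in> basis_letters"
  shows "0 < fst l" "snd l \<in> homog A (fst l)" "snd l \<in> carrier A" "l \<in> letters A" "coord l = Poly_Mapping.single l 1"
proof -
  show l: "l \<in> letters A" using assms basis_letters_subset by blast
  then show "0 < fst l" "snd l \<in> homog A (fst l)" by (cases l; simp add: letters_iff)+
  then show "snd l \<in> carrier A" using homog_carrier[of "snd l" "fst l"] by blast
  show "coord l = Poly_Mapping.single l 1" using assms by (cases l) (auto simp: basis_letters_def coord_basis)
qed

text \<open>In coordinates \<open>mu\<close> is the product of A (\<open>coord_mult\<close>), so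
  commutativity, associativity and the grading are inherited.\<close>

sublocale T: graded_quasi_shuffle mu basis_letters fst
proof
  show mu_comm: "mu a b = mu b a" for a b
    using homog_comm[of "snd a" "fst a" "snd b" "fst b"] basis_lettersD(2)
    by (auto simp: mu_def add.commute)
  show "lin (\<lambda>x. mu x c) (mu a b) = lin (\<lambda>x. mu a x) (mu b c)" for a b c
  proof (cases "a \<in> basis_letters \<and> b \<in> basis_letters \<and> c \<in> basis_letters")
    case True
    note B = basis_lettersD[of a] basis_lettersD[of b] basis_lettersD[of c]
    have "lin (\<lambda>x. mu x c) (mu a b) = bilin mu (coord (fst a + fst b, snd a \<otimes> snd b)) (coord (fst c, snd c))"
      using True B by (simp add: bilin_def mu_def[of a b])
    also have "\<dots> = coord (fst a + fst b + fst c, snd a \<otimes> snd b \<otimes> snd c)"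
      using True B by (intro coord_mult[symmetric] homog_mult) auto
    also have "\<dots> = coord (fst a + (fst b + fst c), snd a \<otimes> (snd b \<otimes> snd c))"
      using True B by (simp add: m_assoc add.assoc)
    also have "\<dots> = bilin mu (coord (fst a, snd a)) (coord (fst b + fst c, snd b \<otimes> snd c))"
      using True B by (intro coord_mult homog_mult) auto
    also have "\<dots> = lin (\<lambda>x. mu a x) (mu b c)"
      using True B by (simp add: bilin_def mu_def[of b c])
    finally show ?thesis .
  next
    case False
    then show ?thesis by (auto simp: mu_def)
  qed
  show "0 < fst l" if "l \<in> basis_letters" for l using basis_lettersD that by blast
  show "mu a b \<in> supp_in {l \<in> basis_letters. fst l = fst a + fst b}"
    if "a \<in> basis_letters" "b \<in> basis_letters" for a b
    using that basis_lettersD(1)[OF that(1)] coord_supp[of "fst a + fst b"] by (simp add: mu_def)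
qed

text \<open>The sum over quasi-shuffles obeys the recursion of \<open>T.qs\<close>; a merged letter
  contributes the product of the coordinates by \<open>coord_bilin\<close>.\<close>

lemma qsum_word_coord:
  "u \<in> lists (letters A) \<Longrightarrow> v \<in> lists (letters A) \<Longrightarrow>
     qsum word_coord u v = T.qm (word_coord u) (word_coord v)"
proof (induction u v rule: T.qs.induct)
  case (1 v)
  then show ?case
  proof (induction v)
    case (Cons b v)
    then show ?case by (simp add: qsum_simps letter_prod_1 qsum_pre)
  qed (simp add: qsum_simps)
next
  case (2 a u)
  have "qsum word_coord u [] = word_coord u" if "u \<in> lists (letters A)" for u
    using that by (induction u) (simp_all add: qsum_simps letter_prod_1 qsum_pre)
  then show ?case using 2(1) by (simp only: word_coord.simps T.qm_one)
next
  case (3 a u b v)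
  then have ab: "a \<in> letters A" "b \<in> letters A" by auto
  have "qsum word_coord (a # u) (b # v) = pre (coord a) (qsum word_coord u (b # v)) +
      pre (coord b) (qsum word_coord (a # u) v) + pre (bilin mu (coord a) (coord b)) (qsum word_coord u v)"
    by (simp add: qsum_simps letter_prod_1 ab qsum_pre coord_bilin)
  also have "\<dots> = pre (coord a) (T.qm (word_coord u) (word_coord (b # v))) +
      pre (coord b) (T.qm (word_coord (a # u)) (word_coord v)) + pre (T.vm (coord a) (coord b)) (T.qm (word_coord u) (word_coord v))"
    using 3 by (simp add: T.vm_def)
  also have "\<dots> = T.qm (word_coord (a # u)) (word_coord (b # v))"
    by (simp add: T.qm_pre)
  finally show ?case .
qed

lemma word_coord_zero: "(n, \<zero>) \<in> set w \<Longrightarrow> word_coord w = 0"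
  by (induction w) auto

lemma foldr_mult_carrier: "set xs \<subseteq> carrier A \<Longrightarrow> foldr (\<otimes>) xs \<one> \<in> carrier A"
  by (induction xs) auto

lemma foldr_mult_zero: "set xs \<subseteq> carrier A \<Longrightarrow> \<zero> \<in> set xs \<Longrightarrow> foldr (\<otimes>) xs \<one> = \<zero>"
  by (induction xs) (auto simp: foldr_mult_carrier)

text \<open>Either the sign is 1, or a letter of odd degree occurs. The entry of that letter is then
  0, so a merged letter is 0 and the whole word expands to 0.\<close>

lemma koszul_sign_irrelevant:
  assumes u: "u \<in> lists (letters A)" and v: "v \<in> lists (letters A)"
    and x: "(n, \<alpha>, \<beta>) \<in> quasi_shuffles (length u) (length v)"
  shows "pscale (koszul_sign (joint_map (length u) \<alpha> \<beta>) (u @ v)) (word_coord (merge2 (n, \<alpha>, \<beta>) u v))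
    = word_coord (merge2 (n, \<alpha>, \<beta>) u v)"
proof (cases "(- 1 :: 'k) = 1 \<or> (\<forall>l\<in>set (u @ v). even (fst l))")
  case True
  let ?I = "{(i, j). i < j \<and> j < length (u @ v) \<and> joint_map (length u) \<alpha> \<beta> j < joint_map (length u) \<alpha> \<beta> i}"
  have "(- 1 :: 'k) ^ (\<Sum>(i, j)\<in>?I. fst ((u @ v) ! i) * fst ((u @ v) ! j)) = 1"
  proof (cases "(- 1 :: 'k) = 1")
    case False
    then have even: "even (fst l)" if "l \<in> set (u @ v)" for l using True that by blast
    have "even (\<Sum>(i, j)\<in>?I. fst ((u @ v) ! i) * fst ((u @ v) ! j))"
    proof (intro dvd_sum)
      fix x assume "x \<in> ?I"
      then show "even (case x of (i, j) \<Rightarrow> fst ((u @ v) ! i) * fst ((u @ v) ! j))"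
        using even[OF nth_mem] by (cases x) simp
    qed
    then show ?thesis by (rule neg_one_even_power)
  next
    case True
    show ?thesis by (subst True) (rule power_one)
  qed
  then show ?thesis by (simp add: koszul_sign_def)
next
  case False
  then obtain l where l: "l \<in> set (u @ v)" "odd (fst l)" by blast
  have odd: "homog A n = {\<zero>}" if "odd n" for n using signs False that by blast
  have letters: "set u \<subseteq> letters A" "set v \<subseteq> letters A" using u v by auto
  then have "l \<in> letters A" using l by auto
  then have "snd l = \<zero>" using odd[OF l(2)] by (cases l) (auto simp: letters_iff)
  have maps: "\<alpha> j < n" if "j < length u" for j
    using x that by (auto simp: quasi_shuffles_def PiE_iff)
  have maps': "\<beta> j < n" if "j < length v" for j
    using x that by (auto simp: quasi_shuffles_def PiE_iff)
  have "\<exists>i<n. l \<in> set (pick \<alpha> u i @ pick \<beta> v i)"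
  proof (cases "l \<in> set u")
    case True
    then obtain j where "j < length u" "u ! j = l" by (auto simp: in_set_conv_nth)
    then show ?thesis using maps by (intro exI[of _ "\<alpha> j"]) (auto simp: pick_def)
  next
    case False
    then obtain j where "j < length v" "v ! j = l" using l by (auto simp: in_set_conv_nth)
    then show ?thesis using maps' by (intro exI[of _ "\<beta> j"]) (auto simp: pick_def)
  qed
  then obtain i where i: "i < n" "l \<in> set (pick \<alpha> u i @ pick \<beta> v i)" by blast
  let ?ls = "pick \<alpha> u i @ pick \<beta> v i"
  have "set ?ls \<subseteq> letters A" using letters by (auto simp: pick_def)
  moreover have "snd ` letters A \<subseteq> carrier A" using homog_carrier by (auto simp: letters_def)
  ultimately have carr: "set (map snd ?ls) \<subseteq> carrier A" unfolding set_map by blast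
  have "\<zero> \<in> set (map snd ?ls)" unfolding set_map using i(2) \<open>snd l = \<zero>\<close> by (metis image_eqI)
  then have "letter_prod ?ls = (sum_list (map fst ?ls), \<zero>)"
    unfolding letter_prod_def using foldr_mult_zero[OF carr] by simp
  moreover have "letter_prod ?ls \<in> set (merge2 (n, \<alpha>, \<beta>) u v)"
    using i(1) by (auto simp: merge2_def)
  ultimately have "word_coord (merge2 (n, \<alpha>, \<beta>) u v) = 0"
    by (metis word_coord_zero)
  then show ?thesis by simp
qed

text \<open>In normal form the signs disappear, and the remaining sum over quasi-shuffles is the
  product \<open>T.qm\<close> by \<open>qsum_word_coord\<close>.\<close>

lemma reduce_mult:
  assumes f: "f \<in> supp_in (lists (letters A))" and g: "g \<in> supp_in (lists (letters A))"
  shows "reduce (quasi_shuffle_mult A f g) = T.qm (reduce f) (reduce g)"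
proof -
  let ?c = "\<lambda>u v. Poly_Mapping.lookup f u * Poly_Mapping.lookup g v"
  have "reduce (quasi_shuffle_mult A f g) =
      (\<Sum>u\<in>Poly_Mapping.keys f. \<Sum>v\<in>Poly_Mapping.keys g. \<Sum>x\<in>quasi_shuffles (length u) (length v).
        pscale (?c u v) (word_coord (merge2 x u v)))"
    unfolding quasi_shuffle_mult_def reduce_def lin_sum
  proof (intro sum.cong refl, unfold split_paired_all prod.case)
    fix u v n \<alpha> \<beta>
    assume uv: "u \<in> Poly_Mapping.keys f" "v \<in> Poly_Mapping.keys g"
      and x: "(n, \<alpha>, \<beta>) \<in> quasi_shuffles (length u) (length v)"
    let ?s = "koszul_sign (joint_map (length u) \<alpha> \<beta>) (u @ v) :: 'k"
    have "u \<in> lists (letters A)" "v \<in> lists (letters A)"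
      using supp_in_keys[OF f uv(1)] supp_in_keys[OF g uv(2)] .
    from koszul_sign_irrelevant[OF this x]
    have sign: "pscale ?s (word_coord (merge2 (n, \<alpha>, \<beta>) u v)) = word_coord (merge2 (n, \<alpha>, \<beta>) u v)" .
    have "pscale (?s * Poly_Mapping.lookup f u * Poly_Mapping.lookup g v) (word_coord (merge2 (n, \<alpha>, \<beta>) u v))
      = pscale (?c u v) (pscale ?s (word_coord (merge2 (n, \<alpha>, \<beta>) u v)))"
      by (simp add: algebra_simps)
    then show "lin word_coord (Poly_Mapping.single (merge_word A n (joint_map (length u) \<alpha> \<beta>) (u @ v))
        (?s * Poly_Mapping.lookup f u * Poly_Mapping.lookup g v)) =
      pscale (?c u v) (word_coord (merge2 (n, \<alpha>, \<beta>) u v))"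
      by (simp add: merge_word_eq sign)
  qed
  also have "\<dots> = (\<Sum>u\<in>Poly_Mapping.keys f. \<Sum>v\<in>Poly_Mapping.keys g. pscale (?c u v) (qsum word_coord u v))"
    by (simp add: qsum_def pm.scale_sum_right)
  also have "\<dots> = (\<Sum>u\<in>Poly_Mapping.keys f. \<Sum>v\<in>Poly_Mapping.keys g. pscale (?c u v) (T.qm (word_coord u) (word_coord v)))"
    using supp_in_keys[OF f] supp_in_keys[OF g] by (intro sum.cong refl) (simp only: qsum_word_coord)
  also have "\<dots> = T.qm (reduce f) (reduce g)"
    unfolding reduce_def lin_def by (simp add: T.qm_sum pm.scale_sum_right) (subst sum.swap, simp add: mult.commute)
  finally show ?thesis .
qed

end

section \<open>The quasi-shuffle algebra as a ring of words in the basis\<close>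

context connected_comm_graded_algebra
begin

abbreviation words_ring :: "('a word \<Rightarrow>\<^sub>0 'k) set" where
  "words_ring \<equiv> supp_in (lists basis_letters)"

text \<open>For \<open>t\<close> in \<open>words_ring\<close> this is the coset whose unique normal
  form is \<open>t\<close> (\<open>coset_eq_fiber\<close>, \<open>fiber_inj\<close>).\<close>

definition fiber :: "('a word \<Rightarrow>\<^sub>0 'k) \<Rightarrow> ('a word \<Rightarrow>\<^sub>0 'k) set" where
  "fiber t = {f \<in> supp_in (lists (letters A)). reduce f = t}"

lemma free_word_algebra_simps:
  "carrier (free_word_algebra A) = supp_in (lists (letters A))"
  "monoid.mult (free_word_algebra A) = quasi_shuffle_mult A"
  "one (free_word_algebra A) = wone"
  "add (free_word_algebra A) = (+)"
  "module.smult (free_word_algebra A) = pscale"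
  "homog (free_word_algebra A) n = supp_in {w \<in> lists (letters A). word_degree w = n}"
  by (simp_all add: free_word_algebra_def supp_in_def map_mult_eq_pscale)

lemma words_ring_subset: "words_ring \<subseteq> supp_in (lists (letters A))"
  using lists_mono[OF basis_letters_subset] by (auto simp: supp_in_def)

lemma mem_fiber: "t \<in> words_ring \<Longrightarrow> t \<in> fiber t"
  using words_ring_subset reduce_id by (auto simp: fiber_def)

lemma fiber_inj: "inj_on fiber words_ring"
proof (rule inj_onI)
  fix s t assume "s \<in> words_ring" "t \<in> words_ring" "fiber s = fiber t"
  then have "s \<in> fiber t" using mem_fiber by blast
  then show "s = t" using \<open>s \<in> words_ring\<close> reduce_id by (simp add: fiber_def)
qed

lemma coset_eq_fiber:
  assumes f: "f \<in> supp_in (lists (letters A))"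
  shows "multilinear_relations A +>\<^bsub>free_word_algebra A\<^esub> f = fiber (reduce f)"
proof (intro Set.equalityI subsetI)
  fix g assume "g \<in> multilinear_relations A +>\<^bsub>free_word_algebra A\<^esub> f"
  then obtain r where r: "r \<in> multilinear_relations A" "g = r + f"
    by (auto simp: a_r_coset_def' free_word_algebra_simps)
  then show "g \<in> fiber (reduce f)"
    using relations_supp pm.subspace_add[OF subspace_supp_in _ f] reduce_relations[OF r(1)] by (auto simp: fiber_def)
next
  fix g assume "g \<in> fiber (reduce f)"
  then have g: "g \<in> supp_in (lists (letters A))" "reduce (g - f) = 0" by (auto simp: fiber_def)
  then have "g - f \<in> multilinear_relations A"
    using relations_iff[OF pm.subspace_diff[OF subspace_supp_in g(1) f]] by simp
  then show "g \<in> multilinear_relations A +>\<^bsub>free_word_algebra A\<^esub> f"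
    by (auto simp: a_r_coset_def' free_word_algebra_simps intro!: bexI[of _ "g - f"])
qed

lemma fiberD: "f \<in> fiber t \<Longrightarrow> f \<in> supp_in (lists (letters A)) \<and> reduce f = t"
  by (simp add: fiber_def)

lemma J_carrier: "carrier (quasi_shuffle_algebra A) = fiber ` words_ring"
proof -
  have "carrier (quasi_shuffle_algebra A) = (\<lambda>f. fiber (reduce f)) ` supp_in (lists (letters A))"
    by (auto simp: quasi_shuffle_algebra_def Let_def FactRing_def A_RCOSETS_def' free_word_algebra_simps coset_eq_fiber)
  also have "\<dots> = fiber ` reduce ` supp_in (lists (letters A))" by (simp add: image_image)
  also have "reduce ` supp_in (lists (letters A)) = words_ring"
  proof (intro Set.equalityI subsetI)
    fix t assume "t \<in> words_ring"
    then show "t \<in> reduce ` supp_in (lists (letters A))"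
      using reduce_id words_ring_subset by (metis image_eqI subsetD)
  qed (use reduce_supp in blast)
  finally show ?thesis .
qed

lemma J_add:
  assumes "s \<in> words_ring" "t \<in> words_ring"
  shows "fiber s \<oplus>\<^bsub>quasi_shuffle_algebra A\<^esub> fiber t = fiber (s + t)"
proof -
  have "fiber s \<oplus>\<^bsub>quasi_shuffle_algebra A\<^esub> fiber t = {f + g | f g. f \<in> fiber s \<and> g \<in> fiber t}"
    by (auto simp: quasi_shuffle_algebra_def Let_def FactRing_def set_add_def' free_word_algebra_simps)
  also have "\<dots> = fiber (s + t)"
  proof (intro Set.equalityI subsetI)
    fix x assume "x \<in> fiber (s + t)"
    then have "x - t \<in> fiber s" "x = (x - t) + t"
      using pm.subspace_diff[OF subspace_supp_in] words_ring_subset assms reduce_id[OF assms(2)] by (auto simp: fiber_def)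
    then show "x \<in> {f + g | f g. f \<in> fiber s \<and> g \<in> fiber t}" using mem_fiber[OF assms(2)] by blast
  next
    fix x assume "x \<in> {f + g | f g. f \<in> fiber s \<and> g \<in> fiber t}"
    then show "x \<in> fiber (s + t)" using pm.subspace_add[OF subspace_supp_in] by (auto simp: fiber_def)
  qed
  finally show ?thesis .
qed

lemma J_one: "\<one>\<^bsub>quasi_shuffle_algebra A\<^esub> = fiber wone"
  using coset_eq_fiber[of wone]
  by (simp add: quasi_shuffle_algebra_def Let_def FactRing_def free_word_algebra_simps)

lemma J_smult:
  assumes "t \<in> words_ring"
  shows "c \<odot>\<^bsub>quasi_shuffle_algebra A\<^esub> fiber t = fiber (pscale c t)"
proof -
  have "c \<odot>\<^bsub>quasi_shuffle_algebra A\<^esub> fiber t = (\<Union>f\<in>fiber t. multilinear_relations A +>\<^bsub>free_word_algebra A\<^esub> pscale c f)"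
    by (simp add: quasi_shuffle_algebra_def Let_def free_word_algebra_simps)
  also have "\<dots> = (\<Union>f\<in>fiber t. fiber (pscale c t))"
    using coset_eq_fiber[OF pm.subspace_scale[OF subspace_supp_in]] fiberD by auto
  also have "\<dots> = fiber (pscale c t)" using mem_fiber[OF assms] by blast
  finally show ?thesis .
qed

lemma word_coord_degree:
  "w \<in> lists (letters A) \<Longrightarrow> word_coord w \<in> supp_in {v \<in> lists basis_letters. word_degree v = word_degree w}"
proof (induction w)
  case (Cons l w)
  obtain n a where na: "l = (n, a)" by (cases l)
  then have "coord l \<in> supp_in {l \<in> basis_letters. fst l = n}"
    using Cons.prems by (auto simp: letters_iff intro: coord_supp)
  then show ?case
    using Cons na unfolding word_coord.simps pre_def
    by (intro bilin_in_subspace subspace_supp_in single_in_supp_in) (auto dest!: supp_in_keys simp: word_degree_def)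
qed (simp add: word_degree_def)

lemma J_homog: "homog (quasi_shuffle_algebra A) n =
    fiber ` supp_in {w \<in> lists basis_letters. word_degree w = n}"
proof -
  let ?F = "supp_in {w \<in> lists (letters A). word_degree w = n} :: ('a word \<Rightarrow>\<^sub>0 'k) set"
  let ?T = "supp_in {w \<in> lists basis_letters. word_degree w = n} :: ('a word \<Rightarrow>\<^sub>0 'k) set"
  have F: "f \<in> supp_in (lists (letters A))" if "f \<in> ?F" for f using that supp_in_mono by blast
  have "homog (quasi_shuffle_algebra A) n = (\<lambda>f. fiber (reduce f)) ` ?F"
    unfolding quasi_shuffle_algebra_def Let_def
    by (simp add: free_word_algebra_simps coset_eq_fiber[OF F] cong: image_cong)
  also have "\<dots> = fiber ` reduce ` ?F" by (simp add: image_image)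
  also have "reduce ` ?F = ?T"
  proof (intro Set.equalityI subsetI)
    fix t assume "t \<in> reduce ` ?F"
    then obtain f where f: "f \<in> ?F" "t = reduce f" by blast
    have "word_coord w \<in> ?T" if "w \<in> Poly_Mapping.keys f" for w
      using supp_in_keys[OF f(1) that] word_coord_degree[of w] by auto
    then show "t \<in> ?T" unfolding f(2) reduce_def by (intro lin_in_subspace subspace_supp_in)
  next
    fix t assume t: "t \<in> ?T"
    have "{w \<in> lists basis_letters. word_degree w = n} \<subseteq> {w \<in> lists (letters A). word_degree w = n}"
      using lists_mono[OF basis_letters_subset] by blast
    then have "t \<in> ?F" "t \<in> words_ring"
      using t supp_in_mono by blast+
    then show "t \<in> reduce ` ?F" using reduce_id[of t] by (intro image_eqI[of t reduce t]) simp_all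
  qed
  finally show ?thesis .
qed

lemma letter_prod_letters:
  assumes "set ls \<subseteq> letters A" "ls \<noteq> []"
  shows "letter_prod ls \<in> letters A"
proof -
  have hom: "foldr (\<otimes>) (map snd ls) \<one> \<in> homog A (sum_list (map fst ls))" if "set ls \<subseteq> letters A" for ls
    using that by (induction ls) (auto simp: homog_one letters_def intro!: homog_mult)
  obtain l ls' where ls: "ls = l # ls'" using assms by (cases ls) auto
  then have "0 < fst l" using assms by (cases l) (auto simp: letters_iff)
  then show ?thesis using hom[OF assms(1)] ls by (simp add: letter_prod_def letters_iff)
qed

text \<open>Covering puts a letter into every position, so each merged letter has positive
  degree.\<close>

lemma merge2_letters:
  assumes u: "u \<in> lists (letters A)" and v: "v \<in> lists (letters A)"
    and x: "(n, \<alpha>, \<beta>) \<in> quasi_shuffles (length u) (length v)"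
  shows "merge2 (n, \<alpha>, \<beta>) u v \<in> lists (letters A)"
proof -
  have "letter_prod (pick \<alpha> u i @ pick \<beta> v i) \<in> letters A" if i: "i < n" for i
  proof (rule letter_prod_letters)
    show "set (pick \<alpha> u i @ pick \<beta> v i) \<subseteq> letters A"
      using u v by (auto simp: pick_def)
    have "i \<in> \<alpha> ` {..<length u} \<union> \<beta> ` {..<length v}"
      using x i by (simp add: quasi_shuffles_iff)
    then show "pick \<alpha> u i @ pick \<beta> v i \<noteq> []"
      by (auto simp: pick_def filter_empty_conv)
  qed
  then show ?thesis by (auto simp: merge2_def)
qed

lemma quasi_shuffle_mult_closed:
  assumes f: "f \<in> supp_in (lists (letters A))" and g: "g \<in> supp_in (lists (letters A))"
  shows "quasi_shuffle_mult A f g \<in> supp_in (lists (letters A))"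
  unfolding quasi_shuffle_mult_def
proof (intro pm.subspace_sum subspace_supp_in)
  fix u v x
  assume "u \<in> Poly_Mapping.keys f" "v \<in> Poly_Mapping.keys g" and x: "x \<in> quasi_shuffles (length u) (length v)"
  then have uv: "u \<in> lists (letters A)" "v \<in> lists (letters A)"
    using supp_in_keys[OF f] supp_in_keys[OF g] by blast+
  obtain n \<alpha> \<beta> where "x = (n, \<alpha>, \<beta>)" by (cases x)
  then show "(case x of (n, \<alpha>, \<beta>) \<Rightarrow> Poly_Mapping.single (merge_word A n (joint_map (length u) \<alpha> \<beta>) (u @ v))
      (koszul_sign (joint_map (length u) \<alpha> \<beta>) (u @ v) * Poly_Mapping.lookup f u * Poly_Mapping.lookup g v))
     \<in> supp_in (lists (letters A))"
    using merge2_letters[OF uv] x by (simp add: merge_word_eq)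
qed

text \<open>No ideal property of the relations is available here, as the signs are not assumed trivial;
  it suffices that the product of two cosets contains the coset of the product.\<close>

lemma J_mult_superset:
  assumes "f \<in> supp_in (lists (letters A))" "g \<in> supp_in (lists (letters A))"
  shows "fiber (reduce (quasi_shuffle_mult A f g)) \<subseteq>
    fiber (reduce f) \<otimes>\<^bsub>quasi_shuffle_algebra A\<^esub> fiber (reduce g)"
proof -
  have "fiber (reduce (quasi_shuffle_mult A f g)) =
      multilinear_relations A +>\<^bsub>free_word_algebra A\<^esub> (f \<otimes>\<^bsub>free_word_algebra A\<^esub> g)"
    using coset_eq_fiber[OF quasi_shuffle_mult_closed[OF assms]] by (simp add: free_word_algebra_simps)
  moreover have "f \<in> fiber (reduce f)" "g \<in> fiber (reduce g)" using assms by (auto simp: fiber_def)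
  ultimately show ?thesis
    by (auto simp: quasi_shuffle_algebra_def Let_def FactRing_def rcoset_mult_def)
qed

text \<open>The two shuffles give the same word with opposite signs and cancel. The merged letter
  has the square of \<open>a\<close> as entry, which equals its own negative by graded commutativity
  and so has zero coordinates.\<close>

lemma odd_letter_square:
  assumes a: "a \<in> homog A n" and n: "odd n" and char: "(- 1 :: 'k) \<noteq> 1"
  shows "reduce (quasi_shuffle_mult A (Poly_Mapping.single [(n, a)] 1) (Poly_Mapping.single [(n, a)] 1)) = 0"
proof -
  let ?l = "(n, a)" and ?e = "\<lambda>_::nat. undefined :: nat"
  \<comment> \<open>The two orders of the letters and their merger; \<open>?e\<close> is the
    extensional map on the empty domain.\<close>
  let ?x1 = "(2, cons_map 0 (lift_map 0 ?e), lift_map 1 (cons_map 0 ?e))"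
  let ?x2 = "(2, lift_map 1 (cons_map 0 ?e), cons_map 0 (lift_map 0 ?e))"
  let ?x3 = "(1, cons_map 0 ?e, cons_map 0 ?e)"
  have QS: "quasi_shuffles 1 1 = {?x1, ?x2, ?x3}"
    using quasi_shuffles_Suc_Suc[of 0 0] quasi_shuffles_0_Suc[of 0] quasi_shuffles_Suc_0[of 0]
    by (simp add: quasi_shuffles_0_0 cons_left_def cons_right_def cons_both_def numeral_2_eq_2 insert_commute)
  \<comment> \<open>Keeps the two shuffles apart as summands.\<close>
  have ne: "cons_map 0 (lift_map 0 ?e) \<noteq> lift_map 1 (cons_map 0 ?e)"
  proof
    assume h: "cons_map 0 (lift_map 0 ?e) = lift_map 1 (cons_map 0 ?e)"
    from fun_cong[OF h, of 0] show False by simp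
  qed
  have inv: "{(i, j). i < j \<and> j < length [?l, ?l] \<and> joint_map 1 \<alpha> \<beta> j < joint_map 1 \<alpha> \<beta> i} =
      (if \<beta> 0 < \<alpha> 0 then {(0, 1)} else {})" for \<alpha> \<beta>
    by (auto simp: joint_map_def less_Suc_eq)
  have sign: "koszul_sign (joint_map 1 \<alpha> \<beta>) [?l, ?l] = (if \<beta> 0 < \<alpha> 0 then - 1 else 1 :: 'k)" for \<alpha> \<beta>
    unfolding koszul_sign_def inv using n by simp
  have pick: "pick \<alpha> [?l] i = (if \<alpha> 0 = i then [?l] else [])" for \<alpha> i
    by (simp add: pick_def)
  have merge: "merge_word A k (joint_map 1 \<alpha> \<beta>) [?l, ?l] = merge2 (k, \<alpha>, \<beta>) [?l] [?l]" for k \<alpha> \<beta>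
    using merge_word_eq[of k "[?l]" \<alpha> \<beta> "[?l]"] by simp
  have carr: "a \<in> carrier A" using a homog_carrier by blast
  have "coord (n + n, a \<otimes> a) = - coord (n + n, a \<otimes> a)"
  proof -
    have "a \<otimes> a = (- 1) \<odot> (a \<otimes> a)" using graded_commutative[OF a a] n by simp
    then have "coord (n + n, a \<otimes> a) = pscale (- 1) (coord (n + n, a \<otimes> a))"
      using coord_smult[OF homog_mult[OF a a], of "- 1"] by simp
    then show ?thesis by simp
  qed
  then have "Poly_Mapping.lookup (coord (n + n, a \<otimes> a)) w = - Poly_Mapping.lookup (coord (n + n, a \<otimes> a)) w" for w
    by (metis lookup_uminus)
  moreover have "c = 0" if "c = - c" for c :: 'k
  proof -
    have "(1 - (- 1)) * c = 0" using that by (simp add: algebra_simps)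
    then show ?thesis using char by (metis eq_iff_diff_eq_0 mult_eq_0_iff)
  qed
  ultimately have "Poly_Mapping.lookup (coord (n + n, a \<otimes> a)) w = 0" for w by blast
  then have sq: "coord (n + n, a \<otimes> a) = 0" by (intro poly_mapping_eqI) simp
  show ?thesis
    using ne carr sq
    by (simp add: quasi_shuffle_mult_def QS[unfolded One_nat_def] merge[unfolded One_nat_def]
        sign[unfolded One_nat_def] merge2_def pick letter_prod_def numeral_2_eq_2)
qed

end

context strictly_commutative_graded_algebra
begin

lemma TJ_eq: "T.TJ = words_ring"
  by (simp add: T.TJ_def)

lemma TH_eq: "T.TH n = supp_in {w \<in> lists basis_letters. word_degree w = n}"
  by (simp add: T.TH_def T.wdeg_def word_degree_def)

text \<open>A product of cosets is a union over representatives, and by \<open>reduce_mult\<close>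
  all representatives give the same coset.\<close>

lemma J_mult:
  assumes s: "s \<in> words_ring" and t: "t \<in> words_ring"
  shows "fiber s \<otimes>\<^bsub>quasi_shuffle_algebra A\<^esub> fiber t = fiber (T.qm s t)"
proof -
  have "fiber s \<otimes>\<^bsub>quasi_shuffle_algebra A\<^esub> fiber t = (\<Union>f\<in>fiber s. \<Union>g\<in>fiber t.
      multilinear_relations A +>\<^bsub>free_word_algebra A\<^esub> quasi_shuffle_mult A f g)"
    by (simp add: quasi_shuffle_algebra_def Let_def FactRing_def rcoset_mult_def free_word_algebra_simps)
  also have "\<dots> = (\<Union>f\<in>fiber s. \<Union>g\<in>fiber t. fiber (T.qm s t))"
    using coset_eq_fiber[OF quasi_shuffle_mult_closed] fiberD reduce_mult by (intro SUP_cong refl) metis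
  also have "\<dots> = fiber (T.qm s t)" using mem_fiber[OF s] mem_fiber[OF t] by blast
  finally show ?thesis .
qed

lemma vpow_coord:
  assumes "a \<in> homog A n" "0 < n" "0 < i"
  shows "T.vpow (coord (n, a)) i = coord (i * n, a [^] i)"
  using assms(3)
proof (induction i)
  case (Suc i)
  have pow: "a [^] i \<in> homog A (i * n)" for i :: nat
  proof (induction i)
    case (Suc i)
    then show ?case using homog_mult[OF Suc assms(1)] by (simp add: add.commute)
  qed (simp add: homog_one)
  show ?case
  proof (cases "i = 0")
    case True
    then show ?thesis using assms(1) homog_carrier by simp
  next
    case False
    have "T.vpow (coord (n, a)) (Suc i) = bilin mu (coord (n, a)) (coord (i * n, a [^] i))"
      using Suc False by (simp add: T.vpow_Suc T.vm_def)
    also have "\<dots> = coord (n + i * n, a \<otimes> a [^] i)"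
      using coord_mult[OF assms(1) pow] assms(2) False by simp
    finally show ?thesis using nat_pow_Suc2[OF homog_carrier[OF assms(1)], of i] by simp
  qed
qed simp

end

section \<open>Odd elements vanish when the quasi-shuffle algebra is polynomial\<close>

lemma poly_algebra_simps:
  "carrier (poly_algebra V d) = supp_in {m. Poly_Mapping.keys m \<subseteq> V}"
  "monoid.mult (poly_algebra V d) = (*)" "one (poly_algebra V d) = 1"
  "add (poly_algebra V d) = (+)" "module.smult (poly_algebra V d) = pscale"
  "homog (poly_algebra V d) n = PH V d n"
  by (auto simp: poly_algebra_def supp_in_def PH_def wt_def map_mult_eq_pscale)

lemma polynomials_closed:
  "P \<in> supp_in {m. Poly_Mapping.keys m \<subseteq> V} \<Longrightarrow> Q \<in> supp_in {m. Poly_Mapping.keys m \<subseteq> V} \<Longrightarrow>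
     P * Q \<in> supp_in {m. Poly_Mapping.keys (m :: 'x \<Rightarrow>\<^sub>0 nat) \<subseteq> V}"
  using keys_mult[of P Q] by (fastforce simp: supp_in_def keys_add_nat)

context connected_comm_graded_algebra
begin

lemma words_ring_0: "0 \<in> words_ring"
  by (simp add: pm.subspace_0)

context
  fixes V :: "'x set" and d :: "'x \<Rightarrow> nat" and h
  assumes h: "h \<in> graded_algebra_iso (poly_algebra V d) (quasi_shuffle_algebra A)"
begin

abbreviation "polys \<equiv> supp_in {m :: 'x \<Rightarrow>\<^sub>0 nat. Poly_Mapping.keys m \<subseteq> V} :: (('x \<Rightarrow>\<^sub>0 nat) \<Rightarrow>\<^sub>0 'k) set"

lemma iso_mult: "P \<in> polys \<Longrightarrow> Q \<in> polys \<Longrightarrow> h (P * Q) = h P \<otimes>\<^bsub>quasi_shuffle_algebra A\<^esub> h Q"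
  and iso_add: "P \<in> polys \<Longrightarrow> Q \<in> polys \<Longrightarrow> h (P + Q) = h P \<oplus>\<^bsub>quasi_shuffle_algebra A\<^esub> h Q"
  and iso_one: "h 1 = fiber wone"
  and iso_inj: "inj_on h polys"
  and iso_image: "h ` polys = fiber ` words_ring"
  using h unfolding graded_algebra_iso_def ring_iso_def ring_hom_def bij_betw_def
  by (auto simp: poly_algebra_simps J_carrier J_one)

lemma iso_cases: "P \<in> polys \<Longrightarrow> \<exists>t\<in>words_ring. h P = fiber t"
  using iso_image by blast

lemma polys_0: "0 \<in> polys"
  by (simp add: pm.subspace_0)

text \<open>The quasi-shuffle algebra is not known to be a ring at this stage, so the value at 0 is
  found from the equation t = t + t for its normal form.\<close>

lemma iso_zero: "h 0 = fiber 0"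
proof -
  obtain t where t: "t \<in> words_ring" "h 0 = fiber t" using iso_cases[OF polys_0] by blast
  have "fiber t = fiber (t + t)"
    using iso_add[OF polys_0 polys_0] t J_add by simp
  then have "t = t + t"
    using fiber_inj pm.subspace_add[OF subspace_supp_in t(1) t(1)] t(1) by (meson inj_onD)
  then show ?thesis using t by simp
qed

lemma iso_eq_zero: "P \<in> polys \<Longrightarrow> h P = fiber 0 \<Longrightarrow> P = 0"
  using iso_inj iso_zero polys_0 by (metis inj_onD)

lemma odd_letter_zero:
  assumes p: "prime p" "of_nat p = (0::'k)" and a: "a \<in> homog A n" "odd n" and char: "(- 1 :: 'k) \<noteq> 1"
  shows "a = \<zero>"
proof -
  have n: "0 < n" using a(2) by (cases n) auto
  let ?f = "Poly_Mapping.single [(n, a)] 1 :: 'a word \<Rightarrow>\<^sub>0 'k"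
  have f: "?f \<in> supp_in (lists (letters A))" using a n by (auto simp: letters_iff)
  obtain P where P: "P \<in> polys" "h P = fiber (reduce ?f)"
  proof -
    have "fiber (reduce ?f) \<in> h ` polys" unfolding iso_image using reduce_supp[OF f] by (rule imageI)
    then show ?thesis using that by auto
  qed
  obtain t where t: "t \<in> words_ring" "h (P * P) = fiber t"
    using iso_cases[OF polynomials_closed[OF P(1) P(1)]] by blast
  \<comment> \<open>The product of cosets contains the coset of 0, and it is a single coset, being
    the value of \<open>h\<close> at \<open>P * P\<close>. So it is the coset of 0.\<close>
  have "fiber 0 \<subseteq> fiber t"
    using J_mult_superset[OF f f] odd_letter_square[OF a char] iso_mult[OF P(1) P(1)] P(2) t(2) by simp
  then have "0 \<in> fiber t" using mem_fiber[OF words_ring_0] by blast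
  then have "t = 0" by (simp add: fiber_def)
  then have "P * P = 0" using iso_eq_zero[OF polynomials_closed[OF P(1) P(1)]] t(2) by simp
  \<comment> \<open>As p is at least 2, a vanishing square gives the vanishing p-th power that
    \<open>polynomial_reduced\<close> asks for.\<close>
  moreover obtain q where "p = Suc (Suc q)"
    using prime_gt_1_nat[OF p(1)] by (metis Suc_lessE less_imp_Suc_add One_nat_def)
  ultimately have "P ^ p = 0" by (simp flip: mult.assoc)
  then have "P = 0" by (rule polynomial_reduced[OF p])
  then have "fiber (reduce ?f) = fiber 0" using P(2) iso_zero by simp
  then have "reduce ?f = 0" using fiber_inj reduce_supp[OF f] words_ring_0 by (metis inj_onD)
  then have "pre (coord (n, a)) wone = 0" by simp
  then have "Poly_Mapping.lookup (coord (n, a)) l = 0" for l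
    using lookup_pre_Cons[of "coord (n, a)" wone l "[]"] by simp
  then have "coord (n, a) = 0" by (intro poly_mapping_eqI) simp
  then show ?thesis using coord_inj[OF a(1)] by simp
qed

end

end

section \<open>The Frobenius map of A and polynomiality when signs are invisible\<close>

locale strictly_commutative_char = strictly_commutative_graded_algebra A
  for A :: "('k::field, 'a, 'm) graded_algebra_scheme" (structure) +
  fixes p :: nat
  assumes char_p: "CHAR('k) = p" and p_pos: "0 < p" and perfect: "\<exists>d::'k. d ^ p = c"
begin

sublocale T: graded_quasi_shuffle_char mu basis_letters fst p
  by standard (rule char_p p_pos perfect)+

text \<open>Commutativity is known between homogeneous elements and is spread over the direct sum
  one argument at a time.\<close>

sublocale cring A
proof (intro cring.intro ring_axioms monoid_comm_monoidI)
  have half: "x \<otimes> z = z \<otimes> x"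
    if x: "x \<in> carrier A" and z: "z \<in> carrier A" and hom: "\<And>n y. y \<in> homog A n \<Longrightarrow> y \<otimes> z = z \<otimes> y" for x z
  proof -
    obtain c where c: "\<forall>n. c n \<in> homog A n" "finite {n. c n \<noteq> \<zero>}" "x = (\<Oplus>n\<in>{n. c n \<noteq> \<zero>}. c n)"
      using homog_direct_sum[OF x] by blast
    have carr: "c \<in> {n. c n \<noteq> \<zero>} \<rightarrow> carrier A" using c(1) homog_carrier by blast
    have "x \<otimes> z = (\<Oplus>n\<in>{n. c n \<noteq> \<zero>}. c n \<otimes> z)"
      unfolding c(3) by (rule finsum_ldistr[OF c(2) z carr])
    also have "\<dots> = (\<Oplus>n\<in>{n. c n \<noteq> \<zero>}. z \<otimes> c n)"
    proof (intro finsum_cong')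
      show "c n \<otimes> z = z \<otimes> c n" for n using hom c(1) by blast
    qed (use carr z in auto)
    also have "\<dots> = z \<otimes> x"
      unfolding c(3) by (rule finsum_rdistr[OF c(2) z carr, symmetric])
    finally show ?thesis .
  qed
  show "x \<otimes> y = y \<otimes> x" if "x \<in> carrier A" "y \<in> carrier A" for x y
  proof (rule half[OF that])
    fix n z assume "z \<in> homog A n"
    then show "z \<otimes> y = y \<otimes> z"
      using half[OF that(2) homog_carrier] homog_comm by metis
  qed
qed

lemma add_pow_smult: "x \<in> carrier A \<Longrightarrow> [i] \<cdot>\<^bsub>A\<^esub> x = of_nat i \<odot> x" for i :: nat
proof (induction i)
  case (Suc i)
  have "[Suc i] \<cdot>\<^bsub>A\<^esub> x = [i] \<cdot>\<^bsub>A\<^esub> x \<oplus> x" using add.nat_pow_Suc[of i x] by simp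
  also have "\<dots> = of_nat i \<odot> x \<oplus> 1 \<odot> x" using Suc by (simp add: smult_simps)
  also have "\<dots> = (of_nat i + 1) \<odot> x" using smult_simps(2)[OF Suc.prems, of "of_nat i" 1] by simp
  finally show ?case by (simp add: add.commute)
qed (use add.nat_pow_0 in \<open>simp add: smult_simps\<close>)

lemma frobenius:
  assumes "x \<in> carrier A" "y \<in> carrier A"
  shows "(x \<oplus> y) [^] p = x [^] p \<oplus> y [^] p"
  using frobenius_add[OF T.prime_p _ assms] T.of_nat_p by (simp add: add_pow_smult smult_simps)

lemma frobenius_finsum:
  "finite I \<Longrightarrow> (\<And>i. i \<in> I \<Longrightarrow> f i \<in> carrier A) \<Longrightarrow> (\<Oplus>i\<in>I. f i) [^] p = (\<Oplus>i\<in>I. f i [^] p)"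
proof (induction I rule: finite_induct)
  case empty
  then show ?case using p_pos by (simp add: nat_pow_zero)
next
  case (insert i I)
  then have "f \<in> I \<rightarrow> carrier A" "f i \<in> carrier A" "(\<lambda>i. f i [^] p) \<in> I \<rightarrow> carrier A" by auto
  then show ?case using insert by (simp add: frobenius)
qed

lemma homog_pow: "a \<in> homog A n \<Longrightarrow> a [^] i \<in> homog A (i * n)" for i :: nat
proof (induction i)
  case (Suc i)
  then show ?case using homog_mult[of "a [^] i" "i * n" a n] by (simp add: add.commute)
qed (simp add: homog_one)

text \<open>Uniqueness of the decomposition of 0, in comparison with the zero family.\<close>

lemma homog_decomposition_zero:
  assumes e: "\<And>n. e n \<in> homog A n" "finite {n. e n \<noteq> \<zero>}" "(\<Oplus>n\<in>{n. e n \<noteq> \<zero>}. e n) = \<zero>"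
  shows "e n = \<zero>"
proof -
  have "e = (\<lambda>_. \<zero>)"
  proof (rule ex1E[OF homog_direct_sum[OF zero_closed]])
    fix c
    assume "\<forall>c'. (\<forall>n. c' n \<in> homog A n) \<and> finite {n. c' n \<noteq> \<zero>} \<and> \<zero> = (\<Oplus>n\<in>{n. c' n \<noteq> \<zero>}. c' n) \<longrightarrow> c' = c"
    from this[rule_format, of e] this[rule_format, of "\<lambda>_. \<zero>"] show ?thesis
      using e homog_zero by simp
  qed
  then show ?thesis by simp
qed

text \<open>The p-th powers of the homogeneous components of \<open>z\<close> lie in different
  degrees, so each of them vanishes when \<open>z [^] p\<close> does.\<close>

lemma frobenius_injI:
  assumes hom: "\<And>n a. a \<in> homog A n \<Longrightarrow> a [^] p = \<zero> \<Longrightarrow> a = \<zero>"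
  shows "inj_on (\<lambda>x. x [^] p) (carrier A)"
proof (rule inj_onI)
  have ker: "z = \<zero>" if z: "z \<in> carrier A" "z [^] p = \<zero>" for z
  proof -
    obtain c where c: "\<And>n. c n \<in> homog A n" "finite {n. c n \<noteq> \<zero>}" "z = (\<Oplus>n\<in>{n. c n \<noteq> \<zero>}. c n)"
      using homog_direct_sum[OF z(1)] by blast
    let ?N = "{n. c n \<noteq> \<zero>}"
    have carr: "c n \<in> carrier A" for n using c(1) homog_carrier by blast
    \<comment> \<open>The homogeneous components of \<open>z [^] p\<close>, placed in the degrees
      divisible by p.\<close>
    define e where "e m = (if p dvd m then c (m div p) [^] p else \<zero>)" for m
    have e: "e m \<in> homog A m" for m
      using homog_pow[OF c(1), of "m div p" p] homog_zero by (cases "p dvd m") (simp_all add: e_def)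
    have e_p: "e (p * n) = c n [^] p" for n using p_pos by (simp add: e_def)
    have supp: "{m. e m \<noteq> \<zero>} \<subseteq> (\<lambda>n. p * n) ` ?N"
    proof safe
      fix m assume "e m \<noteq> \<zero>"
      then have "p dvd m" "c (m div p) \<noteq> \<zero>" using p_pos by (auto simp: e_def nat_pow_zero split: if_splits)
      then show "m \<in> (\<lambda>n. p * n) ` ?N" by (intro image_eqI[of _ _ "m div p"]) auto
    qed
    have "(\<Oplus>m\<in>{m. e m \<noteq> \<zero>}. e m) = (\<Oplus>m\<in>(\<lambda>n. p * n) ` ?N. e m)"
      using supp c(2) e homog_carrier
      by (intro add.finprod_mono_neutral_cong_left) auto
    also have "\<dots> = (\<Oplus>n\<in>?N. e (p * n))"
      using p_pos e homog_carrier by (intro finsum_reindex) (auto intro!: inj_onI)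
    also have "\<dots> = z [^] p"
      unfolding e_p c(3) using c(2) carr by (intro frobenius_finsum[symmetric]) auto
    finally have "(\<Oplus>m\<in>{m. e m \<noteq> \<zero>}. e m) = \<zero>" using z(2) by simp
    moreover have "finite {m. e m \<noteq> \<zero>}" using finite_subset[OF supp] c(2) by blast
    ultimately have "e m = \<zero>" for m using homog_decomposition_zero[of e m] e by blast
    then have "c n [^] p = \<zero>" for n using e_p[of n] by simp
    then have "c n = \<zero>" for n using hom[OF c(1)] by blast
    then show "z = \<zero>" using c(3) by simp
  qed
  fix x y assume xy: "x \<in> carrier A" "y \<in> carrier A" "x [^] p = y [^] p"
  have "x = (x \<ominus> y) \<oplus> y" using xy by (simp add: a_minus_def a_assoc l_neg)
  then have "x [^] p = (x \<ominus> y) [^] p \<oplus> y [^] p"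
    using frobenius[of "x \<ominus> y" y] xy by simp
  then have "(x \<ominus> y) [^] p = \<zero>"
    using xy(1,2) add.right_cancel[of "y [^] p" "(x \<ominus> y) [^] p" \<zero>] unfolding xy(3) by simp
  then have "x \<ominus> y = \<zero>" using ker xy by simp
  then show "x = y" using xy by simp
qed

text \<open>Letters have positive degree, so words say nothing about degree 0; there A is the field
  itself.\<close>

lemma degree_zero_reduced:
  assumes "a \<in> homog A 0" "a [^] p = \<zero>"
  shows "a = \<zero>"
proof -
  obtain c where c: "a = c \<odot> \<one>"
    using connected assms(1) by (auto simp: bij_betw_def)
  have "(c \<odot> \<one>) [^] i = (c ^ i) \<odot> \<one>" for i :: nat
  proof (induction i)
    case (Suc i)
    have "(c \<odot> \<one>) [^] Suc i = ((c ^ i) \<odot> \<one>) \<otimes> (c \<odot> \<one>)" using Suc by simp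
    also have "\<dots> = (c ^ i) \<odot> (c \<odot> \<one>)" by (simp add: smult_mult_left smult_simps)
    also have "\<dots> = (c ^ i * c) \<odot> \<one>" by (simp add: smult_simps)
    finally show ?case by (simp add: mult.commute)
  qed (simp add: smult_simps)
  then have "(c ^ p) \<odot> \<one> = 0 \<odot> \<one>" using assms(2) c by (simp add: smult_simps)
  then have "c ^ p = 0" using connected unfolding bij_betw_def inj_on_def by blast
  then show ?thesis using c p_pos by (simp add: smult_simps)
qed

lemma polynomial_imp_frobenius_inj:
  assumes "is_polynomial_algebra (quasi_shuffle_algebra A)"
  shows "inj_on (\<lambda>x. x [^] p) (carrier A)"
proof (rule frobenius_injI)
  fix n a assume a: "a \<in> homog A n" "a [^] p = \<zero>"
  obtain V :: "('a word \<Rightarrow>\<^sub>0 'k) set set" and d h where h: "h \<in> graded_algebra_iso (poly_algebra V d) (quasi_shuffle_algebra A)"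
    using assms unfolding is_polynomial_algebra_def by blast
  show "a = \<zero>"
  proof (cases "n = 0")
    case True
    then show ?thesis using degree_zero_reduced a by simp
  next
    case False
    let ?t = "pre (coord (n, a)) wone"
    have "?t \<in> T.TH (n + 0)"
      using coord_supp[of n a] False by (intro T.pre_TH T.wone_TH) (simp add: T.VH_def)
    then have t: "?t \<in> words_ring" using T.TH_TJ TJ_eq by blast
    have "T.qpow ?t p = pre (coord (p * n, a [^] p)) wone"
      using T.char_p_simps(1) T.Q.nat_pow_one[of p] vpow_coord[OF a(1) _ p_pos] False by simp
    then have t0: "T.qpow ?t p = 0" by (simp add: a(2))
    obtain P where P: "P \<in> polys V" "h P = fiber ?t"
    proof -
      have "fiber ?t \<in> h ` polys V" unfolding iso_image[OF h] using t by (rule imageI)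
      then show ?thesis using that by auto
    qed
    have "P ^ i \<in> polys V \<and> h (P ^ i) = fiber (T.qpow ?t i)" for i
    proof (induction i)
      case 0
      have "Poly_Mapping.single 0 1 \<in> polys V" by (intro single_in_supp_in) simp
      then show ?case using iso_one[OF h] by simp
    next
      case (Suc i)
      have "T.qpow ?t i \<in> words_ring" using T.qpow_TJ t TJ_eq by blast
      then have "h (P ^ i * P) = fiber (T.qm (T.qpow ?t i) ?t)"
        using Suc iso_mult[OF h _ P(1)] P(2) J_mult t by simp
      moreover have "P ^ i * P \<in> polys V" using Suc polynomials_closed[OF _ P(1)] by blast
      ultimately show ?case by (simp add: mult.commute)
    qed
    then have "P ^ p = 0" using iso_eq_zero[OF h] t0 by metis
    then have "P = 0" by (rule polynomial_reduced[OF T.prime_p T.of_nat_p])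
    then have "fiber ?t = fiber 0" using P(2) iso_zero[OF h] by simp
    then have "?t = 0" using fiber_inj t words_ring_0 by (metis inj_onD)
    then have "Poly_Mapping.lookup (coord (n, a)) l = 0" for l
      using lookup_pre_Cons[of "coord (n, a)" wone l "[]"] by simp
    then have "coord (n, a) = 0" by (intro poly_mapping_eqI) simp
    then show ?thesis using coord_inj[OF a(1)] by simp
  qed
qed

lemma frobenius_inj_imp_polynomial:
  assumes inj: "inj_on (\<lambda>x. x [^] p) (carrier A)"
  shows "is_polynomial_algebra (quasi_shuffle_algebra A)"
proof -
  have V: "x = 0" if x: "x \<in> T.VH n" "T.vpow x p = 0" for x n
  proof (cases "n = 0")
    case True
    \<comment> \<open>There are no letters of degree 0.\<close>
    have "{l \<in> basis_letters. fst l = 0} = {}" by (auto simp: basis_letters_def)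
    from x(1)[unfolded T.VH_def True this supp_in_def] show ?thesis by simp
  next
    case False
    obtain a where a: "a \<in> homog A n" "x = coord (n, a)"
      using coord_surj x(1) unfolding T.VH_def by blast
    then have "coord (p * n, a [^] p) = 0" using vpow_coord[OF a(1) _ p_pos] False x(2) by simp
    then have "a [^] p = \<zero>" using coord_inj[OF homog_pow[OF a(1)]] by blast
    then have "a [^] p = \<zero> [^] p" using p_pos by (simp add: nat_pow_zero)
    then have "a = \<zero>" using inj homog_carrier[OF a(1)] by (metis inj_onD zero_closed)
    then show ?thesis using a(2) by simp
  qed
  have red: "t = 0" if "t \<in> T.TJ" "T.qpow t p = 0" for t
    using T.frobenius_inj[OF V that] .
  \<comment> \<open>\<open>fiber\<close> serves as the renaming of the generators, which makes the
    variables elements of the quotient algebra.\<close>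
  have "inj_on fiber T.TJ" using fiber_inj TJ_eq by simp
  from T.polynomial_generators[OF red this]
  obtain V :: "('a word \<Rightarrow>\<^sub>0 'k) set set" and d g where g: "\<And>x. x \<in> V \<Longrightarrow> 0 < d x"
    "\<And>n. T.ev g ` PH V d n = T.TH n" "T.ev g ` supp_in {m. Poly_Mapping.keys m \<subseteq> V} = T.TJ"
    "inj_on (T.ev g) (supp_in {m. Poly_Mapping.keys m \<subseteq> V})" by blast
  define h where "h P = fiber (T.ev g P)" for P
  have ev: "T.ev g P \<in> words_ring" if "P \<in> supp_in {m. Poly_Mapping.keys m \<subseteq> V}" for P
    using g(3) that TJ_eq by blast
  have "bij_betw h (supp_in {m. Poly_Mapping.keys m \<subseteq> V}) (fiber ` words_ring)"
    unfolding bij_betw_def h_def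
  proof
    show "inj_on (\<lambda>P. fiber (T.ev g P)) (supp_in {m. Poly_Mapping.keys m \<subseteq> V})"
      using comp_inj_on[OF g(4), of fiber] fiber_inj g(3) TJ_eq by (simp add: o_def)
    show "(\<lambda>P. fiber (T.ev g P)) ` supp_in {m. Poly_Mapping.keys m \<subseteq> V} = fiber ` words_ring"
      using g(3) TJ_eq by (simp add: image_image[symmetric])
  qed
  moreover have "h ` PH V d n = fiber ` T.TH n" for n
    unfolding h_def g(2)[symmetric] by (simp add: image_image)
  ultimately have "h \<in> graded_algebra_iso (poly_algebra V d) (quasi_shuffle_algebra A)"
    unfolding graded_algebra_iso_def ring_iso_def ring_hom_def
    using ev J_mult J_add J_smult
    by (auto simp: poly_algebra_simps J_carrier J_homog J_one h_def T.ev_mult TH_eq)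
  then show ?thesis unfolding is_polynomial_algebra_def using g(1) by blast
qed

end

theorem theorem7p4:
  fixes A :: "('k::field, 'a) graded_algebra" and p :: nat
  assumes "CHAR('k) = p" and "p > 0" and "perfect_field TYPE('k)"
    and "connected_comm_graded_algebra A"
  shows "is_polynomial_algebra (quasi_shuffle_algebra A) \<longleftrightarrow>
      (p = 2 \<and> inj_on (\<lambda>x. x [^]\<^bsub>A\<^esub> (2::nat)) (carrier A)) \<or>
      (odd p \<and> (\<forall>n. odd n \<longrightarrow> homog A n = {\<zero>\<^bsub>A\<^esub>}) \<and> inj_on (\<lambda>x. x [^]\<^bsub>A\<^esub> p) (carrier A))"
proof -
  interpret connected_comm_graded_algebra A by fact
  have prime: "prime p" using prime_CHAR_semidom[where 'a = 'k] assms(1,2) by simp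
  have of_nat_p: "of_nat p = (0::'k)" using of_nat_CHAR[where 'a = 'k] assms(1) by simp
  have perfect: "\<exists>d::'k. d ^ p = c" for c
    using assms(1-3) unfolding perfect_field_def surj_def by (metis less_irrefl)
  \<comment> \<open>The sign condition is automatic for p = 2. For odd p it is part of the
    right-hand side of the theorem, and \<open>odd\<close> derives it from polynomiality.\<close>
  have main: "is_polynomial_algebra (quasi_shuffle_algebra A) \<longleftrightarrow> inj_on (\<lambda>x. x [^]\<^bsub>A\<^esub> p) (carrier A)"
    if "(- 1 :: 'k) = 1 \<or> (\<forall>n. odd n \<longrightarrow> homog A n = {\<zero>\<^bsub>A\<^esub>})"
  proof -
    interpret strictly_commutative_char A p
      using that assms(1,2) perfect by unfold_locales
    show ?thesis using polynomial_imp_frobenius_inj frobenius_inj_imp_polynomial by blast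
  qed
  have p2: "p = 2 \<or> odd p" using prime prime_odd_nat prime_ge_2_nat by (metis le_neq_implies_less)
  have minus: "(- 1 :: 'k) = 1 \<longleftrightarrow> p = 2"
  proof -
    have "(- 1 :: 'k) = 1 \<longleftrightarrow> of_nat 2 = (0::'k)" by (auto simp: eq_neg_iff_add_eq_0 minus_equation_iff)
    also have "\<dots> \<longleftrightarrow> p dvd 2" using assms(1) of_nat_eq_0_iff_char_dvd by blast
    also have "\<dots> \<longleftrightarrow> p = 2" using primes_dvd_imp_eq[OF prime two_is_prime_nat] by auto
    finally show ?thesis .
  qed
  have odd: "\<forall>n. odd n \<longrightarrow> homog A n = {\<zero>\<^bsub>A\<^esub>}"
    if poly: "is_polynomial_algebra (quasi_shuffle_algebra A)" "p \<noteq> 2"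
  proof (intro allI impI)
    fix n :: nat assume n: "odd n"
    obtain V :: "('a word \<Rightarrow>\<^sub>0 'k) set set" and d h where "h \<in> graded_algebra_iso (poly_algebra V d) (quasi_shuffle_algebra A)"
      using poly(1) unfolding is_polynomial_algebra_def by blast
    then have "a = \<zero>\<^bsub>A\<^esub>" if "a \<in> homog A n" for a
      using odd_letter_zero[OF _ prime of_nat_p that n] minus poly(2) by blast
    then show "homog A n = {\<zero>\<^bsub>A\<^esub>}" using homog_zero by blast
  qed
  show ?thesis
  proof (cases "p = 2")
    case True
    then show ?thesis using main minus by simp
  next
    case False
    then show ?thesis using main odd p2 by blast
  qed
qed

end
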